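(* Let $\mathcal{B}$ be a primitive unital C*-algebra and let $\mathcal{A}$ be a unital AF C*-subalgebra of $\mathcal{B}$. Then $$K_{an}(\mathcal{A},\mathcal{B})\leq 1.$$
   Context: A C*-algebra is primitive if it has a faithful irreducible representation. A unital subalgebra of $\mathcal{B}$ contains the unit of $\mathcal{B}$. A unital C*-algebra is AF if it is the norm closure of the union of an increasingly directed family of finite-dimensional unital C*-subalgebras. For a unital norm closed subalgebra $\mathcal{A}$ of a unital C*-algebra $\mathcal{B}$ and $T\in\mathcal{B}$, let $$d_{an}(T,\mathcal{A},\mathcal{B})=\sup_{\{W_\lambda\}}\limsup_\lambda\|W_\lambda T-TW_\lambda\|,$$ the supremum being over all nets $\{W_\lambda\}$ of contractions in $\mathcal{B}$ such that $\|AW_\lambda-W_\lambda A\|\to 0$ for every $A\in\mathcal{A}$. Let $dist(T,\mathcal{A})$ be the norm distance and $$K_{an}(\mathcal{A},\mathcal{B})=\sup\{dist(T,\mathcal{A}):T\in\mathcal{B},\ d_{an}(T,\mathcal{A},\mathcal{B})\leq 1\}\in[0,\infty].$$ Equivalently, $K_{an}(\mathcal{A},\mathcal{B})$ is the smallest $N\ge 0$ with $dist(T,\mathcal{A})\leq N\,d_{an}(T,\mathcal{A},\mathcal{B})$ for all $T\in\mathcal{B}$ (and is $\infty$ if there is no such $N$). *)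

theory Defs
  imports "HOL-Analysis.Analysis"
begin

text \<open>The library only has real scalars. The real scalar multiplication, and with it the norm,
  metric and topology of the library classes, is required to be the restriction of the complex one.\<close>

class complex_vector = real_vector +
  fixes scaleC :: "complex \<Rightarrow> 'a \<Rightarrow> 'a"  (infixr "*\<^sub>C" 75)
  assumes scaleC_add_right: "c *\<^sub>C (x + y) = c *\<^sub>C x + c *\<^sub>C y"
    and scaleC_add_left: "(c + d) *\<^sub>C x = c *\<^sub>C x + d *\<^sub>C x"
    and scaleC_scaleC: "c *\<^sub>C d *\<^sub>C x = (c * d) *\<^sub>C x"
    and scaleC_one: "1 *\<^sub>C x = x"
    and scaleR_scaleC: "r *\<^sub>R x = complex_of_real r *\<^sub>C x"

interpretation complex_vector: vector_space "scaleC :: complex \<Rightarrow> 'a \<Rightarrow> 'a::complex_vector"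
  by unfold_locales (rule scaleC_add_right scaleC_add_left scaleC_scaleC scaleC_one)+

text \<open>The inner product is linear in its first argument.\<close>

class chilbert_space = complex_vector + real_normed_vector + complete_space +
  fixes cinner :: "'a \<Rightarrow> 'a \<Rightarrow> complex"
  assumes cinner_commute: "cinner x y = cnj (cinner y x)"
    and cinner_add_left: "cinner (x + y) z = cinner x z + cinner y z"
    and cinner_scaleC_left: "cinner (c *\<^sub>C x) y = c * cinner x y"
    and cinner_norm_sq: "cinner x x = complex_of_real ((norm x)\<^sup>2)"

text \<open>The superclass \<^class>\<open>real_normed_algebra_1\<close> includes \<open>0 \<noteq> 1\<close>; this
  excludes only the zero algebra, which has no irreducible representation.\<close>

class unital_cstar_algebra = complex_vector + real_normed_algebra_1 + complete_space +
  fixes star :: "'a \<Rightarrow> 'a"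
  assumes scaleC_mult_left: "(c *\<^sub>C x) * y = c *\<^sub>C (x * y)"
    and scaleC_mult_right: "x * (c *\<^sub>C y) = c *\<^sub>C (x * y)"
    and norm_scaleC: "norm (c *\<^sub>C x) = cmod c * norm x"
    and star_star: "star (star x) = x"
    and star_add: "star (x + y) = star x + star y"
    and star_scaleC: "star (c *\<^sub>C x) = cnj c *\<^sub>C star x"
    and star_mult: "star (x * y) = star y * star x"
    and cstar_identity: "norm (star x * x) = (norm x)\<^sup>2"

definition star_representation ::
    "('b::unital_cstar_algebra \<Rightarrow> 'h::chilbert_space \<Rightarrow>\<^sub>L 'h) \<Rightarrow> bool" where
  "star_representation \<pi> \<longleftrightarrow>
     (\<forall>a c x. blinfun_apply (\<pi> a) (c *\<^sub>C x) = c *\<^sub>C blinfun_apply (\<pi> a) x) \<and>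
     (\<forall>a b. \<pi> (a + b) = \<pi> a + \<pi> b) \<and>
     (\<forall>c a x. blinfun_apply (\<pi> (c *\<^sub>C a)) x = c *\<^sub>C blinfun_apply (\<pi> a) x) \<and>
     (\<forall>a b. \<pi> (a * b) = \<pi> a o\<^sub>L \<pi> b) \<and>
     (\<forall>a x y. cinner (blinfun_apply (\<pi> (star a)) x) y = cinner x (blinfun_apply (\<pi> a) y))"

definition irreducible_representation ::
    "('b::unital_cstar_algebra \<Rightarrow> 'h::chilbert_space \<Rightarrow>\<^sub>L 'h) \<Rightarrow> bool" where
  "irreducible_representation \<pi> \<longleftrightarrow>
     star_representation \<pi> \<and> (\<exists>x::'h. x \<noteq> 0) \<and>
     (\<forall>M. complex_vector.subspace M \<and> closed M \<and> (\<forall>a. \<forall>x\<in>M. blinfun_apply (\<pi> a) x \<in> M)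
        \<longrightarrow> M = {0} \<or> M = UNIV)"

text \<open>The Hilbert space is an explicit type argument, since HOL has no existential quantifier over
  types. As an assumption with a type variable \<^typ>\<open>'h\<close> it says that there is a faithful irreducible
  representation on some Hilbert space.\<close>

definition primitive_cstar_algebra ::
    "'h::chilbert_space itself \<Rightarrow> 'b::unital_cstar_algebra itself \<Rightarrow> bool" where
  "primitive_cstar_algebra _ _ \<longleftrightarrow>
     (\<exists>\<pi> :: 'b \<Rightarrow> 'h \<Rightarrow>\<^sub>L 'h. irreducible_representation \<pi> \<and> inj \<pi>)"

definition unital_cstar_subalgebra :: "'b::unital_cstar_algebra set \<Rightarrow> bool" where
  "unital_cstar_subalgebra A \<longleftrightarrow>
     complex_vector.subspace A \<and> 1 \<in> A \<and> (\<forall>x\<in>A. \<forall>y\<in>A. x * y \<in> A) \<and>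
     (\<forall>x\<in>A. star x \<in> A) \<and> closed A"

definition finite_dimensional :: "'b::complex_vector set \<Rightarrow> bool" where
  "finite_dimensional F \<longleftrightarrow> (\<exists>S. finite S \<and> F \<subseteq> complex_vector.span S)"

definition unital_AF_subalgebra :: "'b::unital_cstar_algebra set \<Rightarrow> bool" where
  "unital_AF_subalgebra A \<longleftrightarrow>
     unital_cstar_subalgebra A \<and>
     (\<exists>\<F>. \<F> \<noteq> {} \<and>
          (\<forall>F\<in>\<F>. unital_cstar_subalgebra F \<and> finite_dimensional F) \<and>
          (\<forall>F\<in>\<F>. \<forall>G\<in>\<F>. \<exists>H\<in>\<F>. F \<subseteq> H \<and> G \<subseteq> H) \<and>
          A = closure (\<Union>\<F>))"

text \<open>A net is a function on a nonempty set \<open>I\<close> directed by a preorder \<open>r\<close>, where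
  \<open>(i, j) \<in> r\<close> means that \<open>j\<close> is above \<open>i\<close>. Its limits and limits superior are taken
  along the filter generated by the tails of \<open>I\<close>.\<close>

definition directed_set :: "'i set \<Rightarrow> 'i rel \<Rightarrow> bool" where
  "directed_set I r \<longleftrightarrow>
     I \<noteq> {} \<and> preorder_on I r \<and> (\<forall>i\<in>I. \<forall>j\<in>I. \<exists>k\<in>I. (i, k) \<in> r \<and> (j, k) \<in> r)"

definition tails :: "'i set \<Rightarrow> 'i rel \<Rightarrow> 'i filter" where
  "tails I r = (INF i\<in>I. principal {j. (i, j) \<in> r})"

lemma eventually_tails:
  assumes "directed_set I r"
  shows "eventually P (tails I r) \<longleftrightarrow> (\<exists>i\<in>I. \<forall>j. (i, j) \<in> r \<longrightarrow> P j)"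
proof -
  have tr: "trans r"
    using assms by (auto simp: directed_set_def preorder_on_def)
  have "eventually P (tails I r) \<longleftrightarrow> (\<exists>i\<in>I. eventually P (principal {j. (i, j) \<in> r}))"
    unfolding tails_def
  proof (rule eventually_INF_base)
    show "I \<noteq> {}" using assms by (auto simp: directed_set_def)
  next
    fix i j assume "i \<in> I" "j \<in> I"
    then obtain k where k: "k \<in> I" "(i, k) \<in> r" "(j, k) \<in> r"
      using assms unfolding directed_set_def by blast
    show "\<exists>x\<in>I. principal {l. (x, l) \<in> r}
            \<le> inf (principal {l. (i, l) \<in> r}) (principal {l. (j, l) \<in> r})"
      using k tr by (intro bexI[of _ k]) (auto dest: transD)
  qed
  then show ?thesis by (simp add: eventually_principal)
qed

definition asymp_commuting_contractions ::
    "'b::unital_cstar_algebra set \<Rightarrow> 'i set \<Rightarrow> 'i rel \<Rightarrow> ('i \<Rightarrow> 'b) \<Rightarrow> bool" where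
  "asymp_commuting_contractions A I r W \<longleftrightarrow>
     directed_set I r \<and> (\<forall>i\<in>I. norm (W i) \<le> 1) \<and>
     (\<forall>a\<in>A. ((\<lambda>i. norm (a * W i - W i * a)) \<longlongrightarrow> 0) (tails I r))"

text \<open>The supremum over all nets has to be taken over nets indexed by subsets of one fixed type.
  The type \<open>'b \<times> 'b set\<close> is large enough: by \<open>net_le_d_an\<close> below, nets indexed by any other
  type do not enlarge the supremum.\<close>

definition d_an :: "'b::unital_cstar_algebra \<Rightarrow> 'b set \<Rightarrow> ereal" where
  "d_an T A = Sup {Limsup (tails I r) (\<lambda>i. ereal (norm (W i * T - T * W i))) | I r W.
     asymp_commuting_contractions A (I :: ('b \<times> 'b set) set) r W}"

lemma Limsup_filtermap:
  fixes g :: "'y \<Rightarrow> ereal"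
  shows "Limsup (filtermap f F) g = Limsup F (\<lambda>x. g (f x))"
proof (rule antisym)
  show "Limsup (filtermap f F) g \<le> Limsup F (\<lambda>x. g (f x))"
    unfolding Limsup_def
  proof (rule INF_mono)
    fix P assume "P \<in> {P. eventually P F}"
    then have "eventually (\<lambda>y. y \<in> f ` Collect P) (filtermap f F)"
      by (auto simp: eventually_filtermap elim: eventually_mono)
    then show "\<exists>Q\<in>{Q. eventually Q (filtermap f F)}.
        (SUP y\<in>Collect Q. g y) \<le> (SUP x\<in>Collect P. g (f x))"
      by (intro bexI[of _ "\<lambda>y. y \<in> f ` Collect P"]) (auto intro!: SUP_least intro: SUP_upper2)
  qed
qed (rule Limsup_filtermap_ge)

lemma net_le_d_an:
  fixes V :: "'j \<Rightarrow> 'b::unital_cstar_algebra"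
  assumes V: "asymp_commuting_contractions A J s V"
  shows "Limsup (tails J s) (\<lambda>j. ereal (norm (V j * T - T * V j))) \<le> d_an T A"
proof -
  have dir: "directed_set J s"
    using V by (simp add: asymp_commuting_contractions_def)
  have rfl: "\<And>j. j \<in> J \<Longrightarrow> (j, j) \<in> s" and tr: "trans s" and sub: "s \<subseteq> J \<times> J"
    using dir by (auto simp: directed_set_def preorder_on_def refl_on_def)
  define t where "t j = V ` {k. (j, k) \<in> s}" for j
  define I where "I = {(b, S). b \<in> S \<and> (\<exists>j\<in>J. S = t j)}"
  define r where "r = {(p, q). p \<in> I \<and> q \<in> I \<and> snd q \<subseteq> snd p}"
  have t_mono: "t k \<subseteq> t j" if "(j, k) \<in> s" for j k
    using that tr by (auto simp: t_def dest: transD)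
  have t_mem: "(V j, t j) \<in> I" if "j \<in> J" for j
    using that rfl by (auto simp: I_def t_def)
  have dirI: "directed_set I r"
    unfolding directed_set_def
  proof (intro conjI ballI)
    show "I \<noteq> {}" using dir t_mem by (auto simp: directed_set_def)
    show "preorder_on I r" by (auto simp: preorder_on_def refl_on_def trans_def r_def)
  next
    fix p q assume pq: "p \<in> I" "q \<in> I"
    then obtain i j where ij: "i \<in> J" "j \<in> J" "snd p = t i" "snd q = t j"
      by (auto simp: I_def)
    then obtain k where k: "k \<in> J" "(i, k) \<in> s" "(j, k) \<in> s"
      using dir unfolding directed_set_def by blast
    show "\<exists>m\<in>I. (p, m) \<in> r \<and> (q, m) \<in> r"
      using pq ij k t_mono t_mem by (intro bexI[of _ "(V k, t k)"]) (auto simp: r_def)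
  qed
  have ev: "eventually (\<lambda>p. P (fst p)) (tails I r) \<longleftrightarrow> eventually (\<lambda>j. P (V j)) (tails J s)" for P
  proof -
    have *: "(\<forall>q. (p, q) \<in> r \<longrightarrow> P (fst q)) \<longleftrightarrow> (\<forall>k. (j, k) \<in> s \<longrightarrow> P (V k))"
      if p: "p \<in> I" "snd p = t j" "j \<in> J" for p j
    proof
      assume L: "\<forall>q. (p, q) \<in> r \<longrightarrow> P (fst q)"
      show "\<forall>k. (j, k) \<in> s \<longrightarrow> P (V k)"
      proof (intro allI impI)
        fix k assume "(j, k) \<in> s"
        then have "(p, (V k, t k)) \<in> r"
          using p t_mono t_mem sub by (auto simp: r_def)
        with L show "P (V k)" by fastforce
      qed
    next
      assume R: "\<forall>k. (j, k) \<in> s \<longrightarrow> P (V k)"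
      show "\<forall>q. (p, q) \<in> r \<longrightarrow> P (fst q)"
      proof (intro allI impI)
        fix q assume "(p, q) \<in> r"
        then have "fst q \<in> t j" using p by (auto simp: r_def I_def)
        then show "P (fst q)" using R by (auto simp: t_def)
      qed
    qed
    have "(\<exists>p\<in>I. \<forall>q. (p, q) \<in> r \<longrightarrow> P (fst q)) \<longleftrightarrow> (\<exists>j\<in>J. \<forall>k. (j, k) \<in> s \<longrightarrow> P (V k))"
    proof
      assume "\<exists>p\<in>I. \<forall>q. (p, q) \<in> r \<longrightarrow> P (fst q)"
      then obtain p where p: "p \<in> I" "\<forall>q. (p, q) \<in> r \<longrightarrow> P (fst q)" by blast
      from p(1) obtain j where j: "j \<in> J" "snd p = t j" by (auto simp: I_def)
      from *[OF p(1) j(2) j(1)] p(2) j(1) show "\<exists>j\<in>J. \<forall>k. (j, k) \<in> s \<longrightarrow> P (V k)" by blast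
    next
      assume "\<exists>j\<in>J. \<forall>k. (j, k) \<in> s \<longrightarrow> P (V k)"
      then obtain j where j: "j \<in> J" "\<forall>k. (j, k) \<in> s \<longrightarrow> P (V k)" by blast
      from *[OF t_mem[OF j(1)] _ j(1)] j(2) t_mem[OF j(1)]
      show "\<exists>p\<in>I. \<forall>q. (p, q) \<in> r \<longrightarrow> P (fst q)" by auto
    qed
    then show ?thesis by (simp only: eventually_tails[OF dirI] eventually_tails[OF dir])
  qed
  have fm: "filtermap fst (tails I r) = filtermap V (tails J s)"
    by (simp add: filter_eq_iff eventually_filtermap ev)
  have "asymp_commuting_contractions A I r fst"
    unfolding asymp_commuting_contractions_def
  proof (intro conjI ballI dirI)
    fix p assume "p \<in> I"
    then show "norm (fst p) \<le> 1"
      using V sub by (auto simp: I_def t_def asymp_commuting_contractions_def)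
  next
    fix a assume "a \<in> A"
    then have "((\<lambda>j. norm (a * V j - V j * a)) \<longlongrightarrow> 0) (tails J s)"
      using V by (simp add: asymp_commuting_contractions_def)
    then have "((\<lambda>x. norm (a * x - x * a)) \<longlongrightarrow> 0) (filtermap fst (tails I r))"
      by (simp add: fm filterlim_filtermap)
    then show "((\<lambda>p. norm (a * fst p - fst p * a)) \<longlongrightarrow> 0) (tails I r)"
      by (simp add: filterlim_filtermap)
  qed
  moreover have "Limsup (tails I r) (\<lambda>p. ereal (norm (fst p * T - T * fst p)))
      = Limsup (tails J s) (\<lambda>j. ereal (norm (V j * T - T * V j)))"
    using arg_cong[OF fm, of "\<lambda>F. Limsup F (\<lambda>x. ereal (norm (x * T - T * x)))"]
    by (simp add: Limsup_filtermap)
  ultimately show ?thesis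
    unfolding d_an_def by (intro Sup_upper CollectI exI[of _ I] exI[of _ r] exI[of _ fst]) simp
qed

definition K_an :: "'b::unital_cstar_algebra set \<Rightarrow> ereal" where
  "K_an A = (SUP T\<in>{T. d_an T A \<le> 1}. ereal (infdist T A))"

end

theory Submission
  imports Defs
begin

text \<open>
  Let \<open>\<pi>\<close> be a faithful irreducible representation of \<open>\<B>\<close> on \<open>H\<close>; it is isometric
  (\<open>norm_act_le\<close>, \<open>norm_le_of_act_le\<close>). The theorem reduces to one estimate for a finite-dimensional unital
  C*-subalgebra \<open>F\<close> of \<open>\<B>\<close> (\<open>close_to_F\<close>): if \<open>\<parallel>W T - T W\<parallel> \<le> \<kappa>\<close> for all contractions \<open>W\<close> in \<open>\<B>\<close> that commute
  with \<open>F\<close>, then some \<open>c\<close> in \<open>F\<close> has \<open>\<parallel>T - c\<parallel> \<le> \<kappa>\<close>. Indeed, if \<open>1 < \<kappa> < dist(T, \<A>)\<close>, then for every \<open>F\<close> in the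
  directed family generating \<open>\<A>\<close> it yields a contraction \<open>W\<^sub>F\<close> that commutes with \<open>F\<close> and has
  \<open>\<parallel>W\<^sub>F T - T W\<^sub>F\<parallel> > \<kappa>\<close>. This net commutes asymptotically with \<open>\<A>\<close>, hence \<open>d\<^sub>a\<^sub>n(T, \<A>, \<B>) \<ge> \<kappa> > 1\<close>.

  The estimate is the classical averaging argument for the distance to the bicommutant of \<open>F\<close>, carried out on
  finite-dimensional \<open>F\<close>-invariant subspaces \<open>K\<close> of \<open>H\<close> on which \<open>F\<close> is faithful. Let \<open>u\<close> be a unitary that
  commutes with \<open>F\<close> and leaves \<open>K\<close> invariant. By a version of Kaplansky's density theorem, contractions in \<open>\<B>\<close>
  commuting with \<open>F\<close> approximate \<open>u\<close> and its adjoint on \<open>K\<close> (\<open>F_commutant_approximation\<close>), so the compression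
  \<open>\<tau>\<close> of \<open>T\<close> to \<open>K\<close> is at distance at most \<open>\<kappa>\<close> from \<open>u \<tau> u\<^sup>*\<close> (\<open>unitary_commutator_bound\<close>). The element of
  least Hilbert--Schmidt norm in the closed convex hull of all \<open>u \<tau> u\<^sup>*\<close> is invariant under conjugation, and by
  the double commutant theorem it is the restriction of an element of \<open>F\<close> (\<open>compression_close_to_F\<close>).
  Compactness of bounded sets of \<open>F\<close> provides one such element for all \<open>K\<close>.

  The approximation of \<open>u\<close> has three ingredients. Schur's lemma and the projection onto an invariant subspace
  of \<open>H\<^sup>n\<close> give \<^emph>\<open>some\<close> element of \<open>\<B>\<close> that, with its adjoint, approximates \<open>u\<close> and \<open>u\<^sup>*\<close> on \<open>K\<close>
  (\<open>density\<close>, \<open>star_approximation\<close>). The map \<open>x \<mapsto> (\<Sum> a x a\<^sup>*) (\<Sum> a a\<^sup>*)\<^sup>-\<^sup>1\<close>, over an orthonormal basis of \<open>F\<close>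
  for a Hilbert--Schmidt form, moves it into the commutant of \<open>F\<close>. Finally \<open>y \<mapsto> 2 y (1 + y\<^sup>* y)\<^sup>-\<^sup>1\<close> makes it a contraction
  without disturbing the approximation (\<open>contraction_from_operator\<close>).

  Functional calculus is replaced throughout by one square root, obtained as the limit of an iteration
  (\<open>square_root_exists\<close>).
\<close>


section \<open>Square roots by iteration\<close>

text \<open>The iteration \<open>y \<mapsto> (1 + y\<^sup>2) / 2\<close> starting from \<open>0\<close>. It dominates, increments included, the norms in
  the iteration \<open>y \<mapsto> (x + y\<^sup>2) / 2\<close> when \<open>x\<close> has norm at most one.\<close>

fun majorant :: "nat \<Rightarrow> real" where
  "majorant 0 = 0"
| "majorant (Suc n) = (1 + (majorant n)\<^sup>2) / 2"

lemma majorant_bounds: "0 \<le> majorant n \<and> majorant n \<le> 1"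
proof (induction n)
  case (Suc n)
  then have "(majorant n)\<^sup>2 \<le> 1" by (simp add: power_le_one)
  then show ?case by simp
qed simp

lemma convergent_majorant: "convergent majorant"
proof (rule Bseq_monoseq_convergent)
  show "Bseq majorant"
    using majorant_bounds by (intro BseqI'[of _ 1]) simp
  have "majorant n \<le> majorant (Suc n)" for n
    using sum_power2_ge_zero[of "1 - majorant n" 0] by (simp add: power2_eq_square algebra_simps)
  then show "monoseq majorant" by (simp add: monoseq_Suc)
qed

text \<open>\<open>1 - y\<close> is a square root of \<open>1 - x\<close>. The product is a parameter, so that the result applies to
  the algebra \<open>'b\<close> and to operators with composition; the set \<open>Z\<close> serves to transfer further
  properties of \<open>x\<close> to \<open>y\<close>.\<close>

lemma square_root_exists:
  fixes p :: "'v::banach \<Rightarrow> 'v \<Rightarrow> 'v"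
  assumes p: "bounded_bilinear p" and p_le: "\<And>u v. norm (p u v) \<le> norm u * norm v"
    and x: "norm x \<le> 1"
    and Z: "closed Z" "0 \<in> Z" "\<And>u. u \<in> Z \<Longrightarrow> (1/2) *\<^sub>R (x + p u u) \<in> Z"
  obtains y where "norm y \<le> 1" "y \<in> Z" "x + p y y = 2 *\<^sub>R y"
proof -
  interpret p: bounded_bilinear p by (rule p)
  define s where "s = rec_nat 0 (\<lambda>_ u. (1/2) *\<^sub>R (x + p u u))"
  have s0: "s 0 = 0" and sS: "s (Suc n) = (1/2) *\<^sub>R (x + p (s n) (s n))" for n
    by (simp_all add: s_def)
  have s_le: "norm (s n) \<le> majorant n" for n
  proof (induction n)
    case (Suc n)
    have "norm (x + p (s n) (s n)) \<le> norm x + norm (s n) * norm (s n)"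
      by (intro order.trans[OF norm_triangle_ineq] add_left_mono p_le)
    also have "\<dots> \<le> 1 + majorant n * majorant n"
      using x Suc majorant_bounds by (intro add_mono mult_mono) auto
    finally show ?case by (simp add: sS power2_eq_square)
  qed (simp add: s0)
  \<comment> \<open>With \<open>u = s (Suc n)\<close> and \<open>v = s n\<close>, the next increment is half of \<open>u\<^sup>2 - v\<^sup>2 = (u - v) u + v (u - v)\<close>.\<close>
  have step: "norm (s (Suc n) - s n) \<le> majorant (Suc n) - majorant n" for n
  proof (induction n)
    case 0
    show ?case using x by (simp add: s0 sS p.zero_left)
  next
    case (Suc n)
    have "s (Suc (Suc n)) - s (Suc n) = (1/2) *\<^sub>R (p (s (Suc n)) (s (Suc n)) - p (s n) (s n))"
      unfolding sS[of "Suc n"] by (subst (3) sS) (simp add: scaleR_diff_right scaleR_add_right)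
    then have eq: "s (Suc (Suc n)) - s (Suc n)
        = (1/2) *\<^sub>R (p (s (Suc n) - s n) (s (Suc n)) + p (s n) (s (Suc n) - s n))"
      by (simp add: p.diff_left p.diff_right)
    have "norm (p (s (Suc n) - s n) (s (Suc n)) + p (s n) (s (Suc n) - s n))
        \<le> norm (s (Suc n) - s n) * norm (s (Suc n)) + norm (s n) * norm (s (Suc n) - s n)"
      by (intro order.trans[OF norm_triangle_ineq] add_mono p_le)
    also have "\<dots> \<le> (majorant (Suc n) - majorant n) * majorant (Suc n)
        + majorant n * (majorant (Suc n) - majorant n)"
      using Suc s_le order.trans[OF norm_ge_zero Suc] majorant_bounds
      by (intro add_mono mult_mono) (simp_all del: majorant.simps)
    also have "\<dots> = 2 * (majorant (Suc (Suc n)) - majorant (Suc n))"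
      by (simp add: power2_eq_square field_simps)
    finally show ?case unfolding eq by (simp del: majorant.simps)
  qed
  have mono: "norm (s m - s n) \<le> majorant m - majorant n" if "n \<le> m" for m n
    using that
  proof (induction m rule: dec_induct)
    case (step m)
    have "norm (s (Suc m) - s n) \<le> norm (s (Suc m) - s m) + norm (s m - s n)"
      using norm_triangle_ineq[of "s (Suc m) - s m" "s m - s n"] by simp
    then show ?case using step.IH \<open>\<And>n. norm (s (Suc n) - s n) \<le> majorant (Suc n) - majorant n\<close>[of m]
      by linarith
  qed simp
  have "Cauchy s"
  proof (rule metric_CauchyI)
    fix e :: real assume "0 < e"
    moreover have "Cauchy majorant" using convergent_majorant by (simp add: Cauchy_convergent_iff)
    ultimately obtain N where N: "\<And>m n. N \<le> m \<Longrightarrow> N \<le> n \<Longrightarrow> dist (majorant m) (majorant n) < e"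
      using metric_CauchyD by metis
    show "\<exists>M. \<forall>m\<ge>M. \<forall>n\<ge>M. dist (s m) (s n) < e"
    proof (intro exI allI impI)
      fix m n assume mn: "N \<le> m" "N \<le> n"
      show "dist (s m) (s n) < e"
      proof (cases "n \<le> m")
        case True
        then show ?thesis using mono[OF True] N[OF mn] by (simp add: dist_norm)
      next
        case False
        then have "m \<le> n" by simp
        then show ?thesis using mono[OF \<open>m \<le> n\<close>] N[OF mn] by (simp add: dist_norm norm_minus_commute)
      qed
    qed
  qed
  then obtain y where y: "s \<longlonglongrightarrow> y" by (auto simp: Cauchy_convergent_iff convergent_def)
  show ?thesis
  proof (rule that)
    show "norm y \<le> 1"
      by (rule LIMSEQ_le_const2[OF tendsto_norm[OF y]])
        (use s_le majorant_bounds in \<open>auto intro: order.trans\<close>)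
    have "s n \<in> Z" for n by (induction n) (simp_all add: s0 sS Z)
    then show "y \<in> Z" using Z(1) y closed_sequentially by blast
    have "(\<lambda>n. s (Suc n)) \<longlonglongrightarrow> (1/2) *\<^sub>R (x + p y y)"
      unfolding sS by (intro tendsto_intros p.tendsto y)
    then have "(1/2) *\<^sub>R (x + p y y) = y"
      using LIMSEQ_Suc[OF y] LIMSEQ_unique by blast
    then have "2 *\<^sub>R ((1/2) *\<^sub>R (x + p y y)) = 2 *\<^sub>R y" by simp
    then show "x + p y y = 2 *\<^sub>R y" by simp
  qed
qed

section \<open>Hilbert spaces\<close>

subclass (in chilbert_space) banach ..

subclass (in unital_cstar_algebra) banach ..

lemmas scaleC_simps = complex_vector.scale_zero_left complex_vector.scale_zero_right
  complex_vector.scale_minus_left complex_vector.scale_minus_right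
  complex_vector.scale_left_diff_distrib complex_vector.scale_right_diff_distrib
  complex_vector.scale_sum_left complex_vector.scale_sum_right scaleC_add_left scaleC_add_right

lemma cinner_add_right: "cinner x (y + z) = cinner x y + cinner x z"
  for x y z :: "'h::chilbert_space"
  by (metis cinner_commute cinner_add_left complex_cnj_add)

lemma cinner_scaleC_right: "cinner x (c *\<^sub>C y) = cnj c * cinner x y"
  for x y :: "'h::chilbert_space"
  by (metis cinner_commute cinner_scaleC_left complex_cnj_mult)

lemma cinner_zero_left [simp]: "cinner 0 (x::'h::chilbert_space) = 0"
  using cinner_add_left[of 0 0 x] by simp

lemma cinner_zero_right [simp]: "cinner (x::'h::chilbert_space) 0 = 0"
  by (metis cinner_commute cinner_zero_left complex_cnj_zero)

lemma cinner_minus_left: "cinner (- x) y = - cinner x y" for x y :: "'h::chilbert_space"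
  using cinner_add_left[of x "- x" y] by (simp add: minus_unique)

lemma cinner_minus_right: "cinner x (- y) = - cinner x y" for x y :: "'h::chilbert_space"
  using cinner_add_right[of x y "- y"] by (simp add: minus_unique)

lemma cinner_diff_left: "cinner (x - y) z = cinner x z - cinner y z"
  for x y z :: "'h::chilbert_space"
  using cinner_add_left[of x "- y" z] by (simp add: cinner_minus_left)

lemma cinner_diff_right: "cinner x (y - z) = cinner x y - cinner x z"
  for x y z :: "'h::chilbert_space"
  using cinner_add_right[of x y "- z"] by (simp add: cinner_minus_right)

lemma cinner_sum_left: "cinner (\<Sum>i\<in>I. f i) y = (\<Sum>i\<in>I. cinner (f i) y)"
  for y :: "'h::chilbert_space"
  by (induction I rule: infinite_finite_induct) (auto simp: cinner_add_left)

lemma cinner_sum_right: "cinner y (\<Sum>i\<in>I. f i) = (\<Sum>i\<in>I. cinner y (f i))"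
  for y :: "'h::chilbert_space"
  by (induction I rule: infinite_finite_induct) (auto simp: cinner_add_right)

lemma cinner_scaleR_left: "cinner (r *\<^sub>R x) y = of_real r * cinner x y"
  for x y :: "'h::chilbert_space"
  by (simp add: scaleR_scaleC cinner_scaleC_left)

lemma cinner_scaleR_right: "cinner x (r *\<^sub>R y) = of_real r * cinner x y"
  for x y :: "'h::chilbert_space"
  by (simp add: scaleR_scaleC cinner_scaleC_right)

lemmas cinner_simps = cinner_add_left cinner_add_right cinner_diff_left cinner_diff_right
  cinner_minus_left cinner_minus_right cinner_scaleC_left cinner_scaleC_right
  cinner_scaleR_left cinner_scaleR_right cinner_sum_left cinner_sum_right

lemma Re_cinner_self: "Re (cinner x x) = (norm x)\<^sup>2" for x :: "'h::chilbert_space"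
  by (simp add: cinner_norm_sq)

lemma Re_cinner_commute: "Re (cinner x y) = Re (cinner y x)" for x y :: "'h::chilbert_space"
  by (metis cinner_commute cnj.simps(1))

lemma norm_add_square: "(norm (x + y))\<^sup>2 = (norm x)\<^sup>2 + 2 * Re (cinner x y) + (norm y)\<^sup>2"
  for x y :: "'h::chilbert_space"
  unfolding Re_cinner_self[symmetric] using Re_cinner_commute[of x y] by (simp add: cinner_simps)

lemma norm_diff_square: "(norm (x - y))\<^sup>2 = (norm x)\<^sup>2 - 2 * Re (cinner x y) + (norm y)\<^sup>2"
  for x y :: "'h::chilbert_space"
  unfolding Re_cinner_self[symmetric] using Re_cinner_commute[of x y] by (simp add: cinner_simps)

lemma norm_scaleC_chilbert: "norm (c *\<^sub>C x) = cmod c * norm x" for x :: "'h::chilbert_space"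
proof -
  have "cinner (c *\<^sub>C x) (c *\<^sub>C x) = (c * cnj c) * cinner x x"
    by (simp only: cinner_simps mult_ac)
  then have "complex_of_real ((norm (c *\<^sub>C x))\<^sup>2) = complex_of_real ((cmod c * norm x)\<^sup>2)"
    by (simp only: cinner_norm_sq complex_norm_square[symmetric] of_real_mult[symmetric] power_mult_distrib)
  then have "(norm (c *\<^sub>C x))\<^sup>2 = (cmod c * norm x)\<^sup>2"
    using of_real_eq_iff by blast
  then show ?thesis by (simp add: power2_eq_iff_nonneg)
qed

text \<open>The Cauchy--Schwarz inequality for the positive form \<open>\<langle>S x, y\<rangle>\<close> of a positive operator.\<close>

lemma Cauchy_Schwarz_positive:
  fixes S :: "'h::chilbert_space \<Rightarrow> 'h"
  assumes sa: "\<And>x y. cinner (S x) y = cinner x (S y)"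
    and pos: "\<And>x. 0 \<le> Re (cinner (S x) x)"
  shows "(Re (cinner (S x) y))\<^sup>2 \<le> Re (cinner (S x) x) * Re (cinner (S y) y)"
proof -
  define a b c where "a = Re (cinner (S x) x)" and "b = Re (cinner (S x) y)"
    and "c = Re (cinner (S y) y)"
  have S: "cinner (S (u + v)) w = cinner (S u) w + cinner (S v) w"
    "cinner (S (r *\<^sub>R u)) w = of_real r * cinner (S u) w" for u v w r
    by (simp_all add: sa cinner_simps)
  have *: "0 \<le> r\<^sup>2 * a + 2 * r * q * b + q\<^sup>2 * c" for r q :: real
  proof -
    have "Re (cinner (S y) x) = b"
      unfolding b_def by (metis sa Re_cinner_commute)
    then show ?thesis
      using pos[of "r *\<^sub>R x + q *\<^sub>R y"]
      by (simp add: S cinner_simps a_def b_def[symmetric] c_def power2_eq_square algebra_simps)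
  qed
  have a: "0 \<le> a" and c: "0 \<le> c" by (simp_all add: a_def c_def pos)
  have "b\<^sup>2 \<le> a * c"
  proof (cases "c = 0")
    case False
    have "0 \<le> c\<^sup>2 * a + 2 * c * (- b) * b + (- b)\<^sup>2 * c" by (rule *)
    also have "\<dots> = c * (a * c - b\<^sup>2)" by (simp add: power2_eq_square algebra_simps)
    finally show ?thesis using False c by (simp add: zero_le_mult_iff)
  next
    case True
    have "b = 0"
    proof (rule ccontr)
      assume "b \<noteq> 0"
      moreover have "0 \<le> 1\<^sup>2 * a + 2 * 1 * (- (a + 1) / (2 * b)) * b + (- (a + 1) / (2 * b))\<^sup>2 * c"
        by (rule *)
      ultimately show False using True a by (simp add: field_simps)
    qed
    then show ?thesis using True by simp
  qed
  then show ?thesis by (simp add: a_def b_def c_def)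
qed

lemma Cauchy_Schwarz_Re: "Re (cinner x y) \<le> norm x * norm y" for x y :: "'h::chilbert_space"
proof -
  have "(Re (cinner x y))\<^sup>2 \<le> (norm x * norm y)\<^sup>2"
    using Cauchy_Schwarz_positive[of "\<lambda>z. z" x y] by (simp add: Re_cinner_self power_mult_distrib)
  then show ?thesis by (metis abs_le_square_iff abs_le_D1 abs_mult abs_norm_cancel)
qed

lemma Cauchy_Schwarz: "cmod (cinner x y) \<le> norm x * norm y" for x y :: "'h::chilbert_space"
proof (cases "cinner x y = 0")
  case False
  define c where "c = cnj (cinner x y) / cmod (cinner x y)"
  have c: "cmod c = 1" using False by (simp add: c_def norm_divide)
  have "cinner (c *\<^sub>C x) y = cmod (cinner x y)"
    using False by (simp add: cinner_simps c_def complex_norm_square[symmetric] mult.commute power2_eq_square)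
  then have "cmod (cinner x y) = Re (cinner (c *\<^sub>C x) y)" by simp
  also have "\<dots> \<le> norm (c *\<^sub>C x) * norm y" by (rule Cauchy_Schwarz_Re)
  finally show ?thesis by (simp add: norm_scaleC_chilbert c)
qed simp

lemma bounded_bilinear_cinner: "bounded_bilinear (cinner :: 'h::chilbert_space \<Rightarrow> 'h \<Rightarrow> complex)"
proof
  show "\<exists>K. \<forall>a b. norm (cinner (a::'h) b) \<le> norm a * norm b * K"
    using Cauchy_Schwarz by (intro exI[of _ 1]) (simp only: mult_1_right, blast)
qed (simp_all add: cinner_simps scaleR_conv_of_real)

lemmas tendsto_cinner = bounded_bilinear.tendsto[OF bounded_bilinear_cinner]

lemma tendsto_scaleC:
  fixes x :: "'h::chilbert_space"
  assumes "(f \<longlongrightarrow> x) F" shows "((\<lambda>n. c *\<^sub>C f n) \<longlongrightarrow> c *\<^sub>C x) F"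
proof -
  have "bounded_linear (\<lambda>x::'h. c *\<^sub>C x)"
    by (rule bounded_linear_intro[where K = "cmod c"])
      (simp_all add: scaleC_add_right scaleR_scaleC scaleC_scaleC norm_scaleC_chilbert mult.commute)
  then show ?thesis using assms by (rule bounded_linear.tendsto)
qed

lemma cinner_eqI:
  fixes x y :: "'h::chilbert_space"
  assumes "\<And>z. cinner x z = cinner y z" shows "x = y"
proof -
  have "cinner (x - y) (x - y) = 0" using assms[of "x - y"] by (simp add: cinner_diff_left)
  then show ?thesis using Re_cinner_self[of "x - y"] by simp
qed

lemma positive_kernel:
  fixes S :: "'h::chilbert_space \<Rightarrow> 'h"
  assumes sa: "\<And>x y. cinner (S x) y = cinner x (S y)"
    and pos: "\<And>x. 0 \<le> Re (cinner (S x) x)" and z: "Re (cinner (S x) x) = 0"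
  shows "S x = 0"
  using Cauchy_Schwarz_positive[OF sa pos, of x "S x"] z by (simp add: Re_cinner_self)

text \<open>A positive operator bounded by \<open>c\<close> as a quadratic form has norm at most \<open>c\<close>.\<close>

lemma norm_le_of_form_le:
  fixes S :: "'h::chilbert_space \<Rightarrow> 'h"
  assumes sa: "\<And>x y. cinner (S x) y = cinner x (S y)"
    and pos: "\<And>x. 0 \<le> Re (cinner (S x) x)"
    and le: "\<And>x. Re (cinner (S x) x) \<le> c * (norm x)\<^sup>2"
  shows "norm (S x) \<le> c * norm x"
proof (cases "S x = 0")
  case True
  then show ?thesis
  proof (cases "x = 0")
    case False
    then show ?thesis using le[of x] pos[of x] True by (simp add: zero_le_mult_iff)
  qed (use True in simp)
next
  case False
  then have x: "x \<noteq> 0" using sa[of 0] by (metis Re_cinner_self cinner_zero_left norm_eq_zero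
    power_zero_numeral sa zero_eq_power2 zero_complex.sel(1))
  have "((norm (S x))\<^sup>2)\<^sup>2 \<le> Re (cinner (S x) x) * Re (cinner (S (S x)) (S x))"
    using Cauchy_Schwarz_positive[OF sa pos, of x "S x"] by (simp add: Re_cinner_self)
  also have "\<dots> \<le> (c * (norm x)\<^sup>2) * (c * (norm (S x))\<^sup>2)"
    using pos[of x] le[of x] by (intro mult_mono le pos) auto
  finally have "(norm (S x))\<^sup>2 * (norm (S x))\<^sup>2 \<le> (c * norm x)\<^sup>2 * (norm (S x))\<^sup>2"
    by (simp only: power2_eq_square mult_ac)
  then have "(norm (S x))\<^sup>2 \<le> (c * norm x)\<^sup>2"
    by (rule mult_right_le_imp_le) (use False in simp)
  moreover have "0 \<le> c" using le[of x] pos[of x] x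
    by (metis order.trans zero_le_mult_iff zero_less_power2 norm_eq_zero not_le)
  ultimately show ?thesis by (simp add: power2_le_iff_abs_le abs_le_iff)
qed

section \<open>Faithful representations are isometric\<close>

lemma norm_star [simp]: "norm (star x) = norm x" for x :: "'b::unital_cstar_algebra"
proof -
  have *: "norm y \<le> norm (star y)" for y :: 'b
  proof (cases "y = 0")
    case False
    have "norm y * norm y \<le> norm (star y) * norm y"
      using norm_mult_ineq[of "star y" y] by (simp add: cstar_identity power2_eq_square)
    then show ?thesis using False by simp
  qed simp
  show ?thesis using *[of x] *[of "star x"] by (simp add: star_star)
qed

lemma star_zero [simp]: "star (0::'b::unital_cstar_algebra) = 0"
  using star_add[of "0::'b" 0] by simp

lemma star_minus: "star (- x) = - star x" for x :: "'b::unital_cstar_algebra"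
  using star_add[of x "- x"] by (simp add: minus_unique)

lemma star_diff: "star (x - y) = star x - star y" for x y :: "'b::unital_cstar_algebra"
  using star_add[of x "- y"] by (simp add: star_minus)

lemma star_sum: "star (\<Sum>i\<in>I. f i) = (\<Sum>i\<in>I. star (f i))" for f :: "'i \<Rightarrow> 'b::unital_cstar_algebra"
  by (induction I rule: infinite_finite_induct) (auto simp: star_add)

lemma star_scaleR: "star (r *\<^sub>R x) = r *\<^sub>R star x" for x :: "'b::unital_cstar_algebra"
  by (simp add: scaleR_scaleC star_scaleC)

lemma star_one [simp]: "star (1::'b::unital_cstar_algebra) = 1"
  by (metis mult_1_left mult_1_right star_mult star_star)

lemma bounded_linear_star: "bounded_linear (star :: 'b::unital_cstar_algebra \<Rightarrow> 'b)"
  by (rule bounded_linear_intro[where K = 1]) (simp_all add: star_add star_scaleR)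

lemma continuous_on_star [continuous_intros]:
  fixes f :: "'a::topological_space \<Rightarrow> 'b::unital_cstar_algebra"
  assumes "continuous_on S f" shows "continuous_on S (\<lambda>x. star (f x))"
  by (rule bounded_linear.continuous_on[OF bounded_linear_star assms])

lemmas star_simps = star_star star_add star_diff star_minus star_sum star_scaleR star_scaleC star_mult

text \<open>The commutation clause replaces the statement that \<open>y\<close> is a limit of polynomials in \<open>x\<close>.\<close>

lemma cstar_square_root:
  fixes x :: "'b::unital_cstar_algebra"
  assumes sa: "star x = x" and le: "norm x \<le> 1"
  obtains y where "star y = y" "y * y = 1 - x" "norm (1 - y) \<le> 1"
    "\<And>z. x * z = z * x \<Longrightarrow> y * z = z * y"
proof -
  define Z where "Z = {u. star u = u \<and> (\<forall>z. x * z = z * x \<longrightarrow> u * z = z * u)}"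
  have Z: "closed Z"
  proof -
    have "Z = {u. star u = u} \<inter> (\<Inter>z\<in>{z. x * z = z * x}. {u. u * z = z * u})"
      by (auto simp: Z_def)
    then show ?thesis
      by (auto intro!: closed_Int closed_INT closed_Collect_eq continuous_intros)
  qed
  have step: "(1/2) *\<^sub>R (x + u * u) \<in> Z" if u: "u \<in> Z" for u
  proof -
    have su: "star u = u" and uz: "\<And>z. x * z = z * x \<Longrightarrow> u * z = z * u"
      using u by (auto simp: Z_def)
    have "(x + u * u) * z = z * (x + u * u)" if "x * z = z * x" for z
    proof -
      have "u * u * z = z * (u * u)"
        by (simp only: mult.assoc uz[OF that]) (simp only: mult.assoc[symmetric] uz[OF that])
      then show ?thesis by (simp only: distrib_left distrib_right that)
    qed
    moreover have "star (x + u * u) = x + u * u" by (simp add: star_add star_mult su sa)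
    ultimately show ?thesis
      unfolding Z_def mem_Collect_eq star_scaleR mult_scaleR_left mult_scaleR_right
      by (intro conjI allI impI arg_cong[where f = "\<lambda>v. (1/2) *\<^sub>R v"])
  qed
  have zero: "0 \<in> Z" by (simp add: Z_def)
  obtain y where y: "norm y \<le> 1" "y \<in> Z" "x + y * y = 2 *\<^sub>R y"
    by (rule square_root_exists[OF bounded_bilinear_mult norm_mult_ineq le Z zero step])
  have sy: "star y = y" and yz: "\<And>z. x * z = z * x \<Longrightarrow> y * z = z * y"
    using y(2) by (auto simp: Z_def)
  show ?thesis
  proof (rule that[of "1 - y"])
    have "(1 - y) * (1 - y) = 1 - 2 *\<^sub>R y + y * y"
      by (simp add: algebra_simps scaleR_2)
    then show "(1 - y) * (1 - y) = 1 - x" using y(3) by (simp add: algebra_simps)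
    show "(1 - y) * z = z * (1 - y)" if "x * z = z * x" for z
      using yz[OF that] by (simp add: left_diff_distrib right_diff_distrib)
  qed (use y(1) sy in \<open>simp_all add: star_diff\<close>)
qed

lemma scaleC_minus_one: "(- 1) *\<^sub>C x = - x" for x :: "'a::complex_vector"
  by (simp add: scaleC_simps scaleC_one)

text \<open>With \<open>u = s + i (1 - s\<^sup>2)\<^sup>1\<^sup>/\<^sup>2\<close>, which is unitary, \<open>2 s\<^sup>2 - 1\<close> is the mean of \<open>u\<^sup>2\<close> and its adjoint.\<close>

lemma norm_one_minus_double_square:
  fixes s :: "'b::unital_cstar_algebra"
  assumes sa: "star s = s" and le: "norm s \<le> 1"
  shows "norm (1 - 2 *\<^sub>R (s * s)) \<le> 1"
proof -
  have ss: "norm (s * s) \<le> 1"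
    using le norm_mult_ineq[of s s] by (meson mult_le_one norm_ge_zero order.trans)
  have sss: "star (s * s) = s * s" by (simp add: star_mult sa)
  obtain y where y: "star y = y" "y * y = 1 - s * s" "norm (1 - y) \<le> 1"
    "\<And>z. s * s * z = z * (s * s) \<Longrightarrow> y * z = z * y"
    using cstar_square_root[OF sss ss] by blast
  have ys: "y * s = s * y" by (rule y(4)) (simp add: mult.assoc)
  define u where "u = s + \<i> *\<^sub>C y"
  have su: "star u = s - \<i> *\<^sub>C y"
    by (simp add: u_def star_simps sa y(1) scaleC_simps)
  have uu: "u * u = (s * s - y * y) + 2 *\<^sub>R (\<i> *\<^sub>C (s * y))"
    "star u * star u = (s * s - y * y) - 2 *\<^sub>R (\<i> *\<^sub>C (s * y))"
    "star u * u = s * s + y * y"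
    unfolding su unfolding u_def
    by (simp_all add: distrib_left distrib_right left_diff_distrib right_diff_distrib
        scaleC_mult_left scaleC_mult_right scaleC_scaleC ys scaleC_minus_one scaleR_2
        scaleC_add_right complex_vector.scale_right_diff_distrib)
  have "star u * u = 1" unfolding uu y(2) by simp
  then have "(norm u)\<^sup>2 = 1" by (simp flip: cstar_identity)
  then have u1: "norm u = 1" using norm_ge_zero[of u] by (auto simp: power2_eq_1_iff)
  have "u * u + star u * star u = 2 *\<^sub>R (s * s - y * y)"
    unfolding uu by (simp add: scaleR_2)
  then have "2 *\<^sub>R (1 - 2 *\<^sub>R (s * s)) = - (u * u + star u * star u)"
    by (simp add: y(2) scaleR_2 algebra_simps)
  then have "norm (2 *\<^sub>R (1 - 2 *\<^sub>R (s * s))) = norm (u * u + star u * star u)"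
    by (metis norm_minus_cancel)
  also have "\<dots> \<le> norm u * norm u + norm (star u) * norm (star u)"
    by (intro order.trans[OF norm_triangle_ineq] add_mono norm_mult_ineq)
  also have "\<dots> = 2" by (simp add: u1)
  finally show ?thesis by simp
qed

text \<open>A faithful irreducible representation, written as an action \<open>a \<odot> x\<close> of the algebra on the Hilbert
  space.\<close>

locale faithful_irreducible =
  fixes \<pi> :: "'b::unital_cstar_algebra \<Rightarrow> 'h::chilbert_space \<Rightarrow>\<^sub>L 'h"
  assumes irreducible: "irreducible_representation \<pi>" and faithful: "inj \<pi>"
begin

abbreviation act :: "'b \<Rightarrow> 'h \<Rightarrow> 'h"  (infixr "\<odot>" 75) where
  "a \<odot> x \<equiv> blinfun_apply (\<pi> a) x"

lemma star_rep: "star_representation \<pi>"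
  using irreducible by (simp add: irreducible_representation_def)

lemma act_scaleC: "a \<odot> (c *\<^sub>C x) = c *\<^sub>C (a \<odot> x)"
  and act_add_left: "(a + b) \<odot> x = a \<odot> x + b \<odot> x"
  and act_scaleC_left: "(c *\<^sub>C a) \<odot> x = c *\<^sub>C (a \<odot> x)"
  and act_mult: "(a * b) \<odot> x = a \<odot> b \<odot> x"
  and cinner_star_act: "cinner (star a \<odot> x) y = cinner x (a \<odot> y)"
  using star_rep by (auto simp: star_representation_def blinfun.add_left)

lemma cinner_act_star: "cinner (a \<odot> x) y = cinner x (star a \<odot> y)"
  using cinner_star_act[of "star a"] by (simp add: star_star)

lemma act_zero_left [simp]: "0 \<odot> x = 0"
  using act_add_left[of 0 0 x] by simp

lemma act_minus_left: "(- a) \<odot> x = - (a \<odot> x)"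
  using act_add_left[of a "- a" x] by (simp add: minus_unique)

lemma act_diff_left: "(a - b) \<odot> x = a \<odot> x - b \<odot> x"
  using act_add_left[of a "- b" x] by (simp add: act_minus_left)

lemma act_scaleR_left: "(r *\<^sub>R a) \<odot> x = r *\<^sub>R (a \<odot> x)"
  by (simp add: scaleR_scaleC act_scaleC_left)

lemma act_sum_left: "(\<Sum>i\<in>I. f i) \<odot> x = (\<Sum>i\<in>I. f i \<odot> x)"
  by (induction I rule: infinite_finite_induct) (auto simp: act_add_left)

lemma act_sum_right: "a \<odot> (\<Sum>i\<in>I. f i) = (\<Sum>i\<in>I. a \<odot> f i)"
  by (induction I rule: infinite_finite_induct) (auto simp: blinfun.add_right)

lemmas act_right = blinfun.add_right blinfun.diff_right blinfun.minus_right blinfun.scaleR_right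
  act_scaleC act_sum_right

lemmas act_left = act_add_left act_diff_left act_minus_left act_scaleR_left act_scaleC_left
  act_sum_left act_mult

lemma act_inject: "(\<And>x. a \<odot> x = b \<odot> x) \<Longrightarrow> a = b"
  using faithful by (metis blinfun_eqI injD)

lemma invariant_subspace_trivial:
  assumes "complex_vector.subspace M" "closed M" "\<And>a x. x \<in> M \<Longrightarrow> a \<odot> x \<in> M"
  shows "M = {0} \<or> M = UNIV"
  using irreducible assms unfolding irreducible_representation_def by blast

lemma Hilbert_space_nontrivial: "\<exists>x::'h. x \<noteq> 0"
  using irreducible by (simp add: irreducible_representation_def)

text \<open>Representations are not required to be unital, but the range of the projection \<open>\<pi> 1\<close> is invariant and
  nonzero.\<close>

lemma act_one [simp]: "1 \<odot> x = x"
proof -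
  define M where "M = {x. 1 \<odot> x = x}"
  have "complex_vector.subspace M"
    unfolding complex_vector.subspace_def by (auto simp: M_def act_right)
  moreover have "closed M"
    unfolding M_def by (intro closed_Collect_eq continuous_intros)
  moreover have "a \<odot> x \<in> M" if "x \<in> M" for a x
    by (simp add: M_def flip: act_mult)
  ultimately have "M = {0} \<or> M = UNIV" by (rule invariant_subspace_trivial)
  moreover have "M \<noteq> {0}"
  proof
    assume "M = {0}"
    moreover have "1 \<odot> y \<in> M" for y by (simp add: M_def flip: act_mult)
    ultimately have "1 \<odot> y = 0 \<odot> y" for y by simp
    then have "(1::'b) = 0" by (rule act_inject)
    then show False by simp
  qed
  ultimately show ?thesis by (auto simp: M_def)
qed

lemma Re_cinner_star_mult: "Re (cinner ((star a * a) \<odot> x) x) = (norm (a \<odot> x))\<^sup>2"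
  by (simp add: act_mult cinner_star_act Re_cinner_self)

lemma norm_act_le: "norm (a \<odot> x) \<le> norm a * norm x"
proof -
  have contraction: "norm (a \<odot> x) \<le> norm x" if a: "norm a \<le> 1" for a x
  proof -
    \<comment> \<open>For a contraction \<open>a\<close>, positivity of \<open>1 - a\<^sup>* a = y\<^sup>2\<close> survives in the representation.\<close>
    have "star (star a * a) = star a * a" "norm (star a * a) \<le> 1"
      using a by (simp_all add: star_mult star_star cstar_identity power_le_one)
    then obtain y where y: "star y = y" "y * y = 1 - star a * a"
      by (rule cstar_square_root)
    have "(norm (y \<odot> x))\<^sup>2 = Re (cinner ((star y * y) \<odot> x) x)"
      by (simp only: Re_cinner_star_mult)
    also have "\<dots> = (norm x)\<^sup>2 - (norm (a \<odot> x))\<^sup>2"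
      by (simp add: y act_left cinner_simps cinner_star_act Re_cinner_self)
    finally have "(norm (a \<odot> x))\<^sup>2 \<le> (norm x)\<^sup>2"
      using zero_le_power2[of "norm (y \<odot> x)"] by linarith
    then show ?thesis by simp
  qed
  show ?thesis
  proof (cases "a = 0")
    case False
    then have "norm ((inverse (norm a) *\<^sub>R a) \<odot> x) \<le> norm x" by (intro contraction) simp
    then show ?thesis using False by (simp add: act_left field_simps)
  qed simp
qed

lemma norm_star_act_le:
  assumes "\<And>x. norm (a \<odot> x) \<le> r * norm x" shows "norm (star a \<odot> x) \<le> r * norm x"
proof (cases "star a \<odot> x = 0")
  case True
  have "0 \<le> norm (a \<odot> x)" by simp
  then show ?thesis using assms[of x] True by (metis norm_zero order.trans)
next
  case False
  have "(norm (star a \<odot> x))\<^sup>2 = Re (cinner x (a \<odot> star a \<odot> x))"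
    by (simp flip: Re_cinner_self add: cinner_star_act)
  also have "\<dots> \<le> norm x * norm (a \<odot> star a \<odot> x)" by (rule Cauchy_Schwarz_Re)
  also have "\<dots> \<le> norm x * (r * norm (star a \<odot> x))" by (intro mult_left_mono assms) simp
  finally show ?thesis using False by (simp add: power2_eq_square mult_ac)
qed

text \<open>Suppose that \<open>b = s\<^sup>2\<close> has norm one in the algebra, but norm at most \<open>\<rho> < 1\<close> as an operator. For
  \<open>t = b - \<rho>\<close>, the element \<open>\<bar>t\<bar> + t\<close> acts as zero since \<open>t\<close> acts as a negative operator, hence
  \<open>\<bar>t\<bar> = \<rho> - b\<close>; then \<open>\<parallel>1 - \<bar>t\<bar>\<parallel> \<le> 1\<close> contradicts \<open>\<parallel>b\<parallel> = 1\<close>.\<close>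

lemma square_not_contracted:
  assumes sa: "star s = s" and n: "norm s = 1" and q: "\<And>x. norm (s \<odot> x) \<le> q * norm x"
    and q01: "0 \<le> q" "q < 1"
  shows False
proof -
  define b \<rho> where "b = s * s" and "\<rho> = q\<^sup>2"
  have \<rho>: "0 \<le> \<rho>" "\<rho> < 1" using q01 by (simp_all add: \<rho>_def power_less_one_iff)
  have b1: "norm b = 1" using cstar_identity[of s] by (simp add: b_def sa n)
  have sb: "star b = b" by (simp add: b_def star_simps sa)
  have b_form: "Re (cinner (b \<odot> x) x) \<le> \<rho> * (norm x)\<^sup>2" for x
  proof -
    have "Re (cinner (b \<odot> x) x) = (norm (s \<odot> x))\<^sup>2"
      using Re_cinner_star_mult[of s x] by (simp add: b_def sa)
    also have "\<dots> \<le> (q * norm x)\<^sup>2" by (intro power_mono q) simp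
    finally show ?thesis by (simp add: \<rho>_def power_mult_distrib)
  qed
  have b_half: "norm (1 - 2 *\<^sub>R b) \<le> 1"
    unfolding b_def by (rule norm_one_minus_double_square) (simp_all add: sa n)
  define t where "t = b - \<rho> *\<^sub>R 1"
  have st: "star t = t" by (simp add: t_def star_simps sb)
  have "t = (1/2 - \<rho>) *\<^sub>R 1 - (1/2) *\<^sub>R (1 - 2 *\<^sub>R b)"
    by (simp add: t_def algebra_simps)
  then have "norm t \<le> \<bar>1/2 - \<rho>\<bar> + (1/2) * norm (1 - 2 *\<^sub>R b)"
    using norm_triangle_ineq4[of "(1/2 - \<rho>) *\<^sub>R (1::'b)" "(1/2) *\<^sub>R (1 - 2 *\<^sub>R b)"] by simp
  then have t1: "norm t \<le> 1" using b_half \<rho> by linarith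
  define x where "x = 1 - t * t"
  have "x = (1/2) *\<^sub>R (1 + (1 - 2 *\<^sub>R (t * t)))"
    by (simp add: x_def scaleR_diff_right scaleR_add_right flip: scaleR_add_left)
  then have "norm x \<le> (1/2) * (norm (1::'b) + norm (1 - 2 *\<^sub>R (t * t)))"
    using norm_triangle_ineq[of "1::'b" "1 - 2 *\<^sub>R (t * t)"] by simp
  then have x1: "norm x \<le> 1" using norm_one_minus_double_square[OF st t1] by simp
  have sx: "star x = x" by (simp add: x_def star_simps st)
  obtain w where w: "star w = w" "w * w = 1 - x" "norm (1 - w) \<le> 1"
    "\<And>z. x * z = z * x \<Longrightarrow> w * z = z * w"
    using cstar_square_root[OF sx x1] by blast
  have wt: "w * t = t * w" by (rule w(4)) (simp add: x_def algebra_simps)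
  have w_pos: "0 \<le> Re (cinner (w \<odot> y) y)" for y
  proof -
    have "Re (cinner ((1 - w) \<odot> y) y) \<le> norm ((1 - w) \<odot> y) * norm y" by (rule Cauchy_Schwarz_Re)
    also have "\<dots> \<le> (1 * norm y) * norm y"
      using w(3) by (intro mult_right_mono order.trans[OF norm_act_le]) auto
    finally show ?thesis
      by (simp add: act_left cinner_simps Re_cinner_self power2_eq_square)
  qed
  have nt: "star (- t) = - t" by (simp add: star_minus st)
  have t_neg: "0 \<le> Re (cinner ((- t) \<odot> y) y)" for y
    using b_form[of y] by (simp add: t_def act_left cinner_simps Re_cinner_self)
  have "(w + t) \<odot> y = 0 \<odot> y" for y
  proof -
    define z where "z = (w + t) \<odot> y"
    have "(w - t) * (w + t) = 0" using w(2) wt by (simp add: x_def algebra_simps)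
    then have "(w - t) \<odot> z = 0" by (simp add: z_def flip: act_mult)
    then have "Re (cinner (w \<odot> z) z) + Re (cinner ((- t) \<odot> z) z) = 0"
      by (simp add: act_left cinner_minus_left)
    then have 0: "Re (cinner (w \<odot> z) z) = 0" "Re (cinner ((- t) \<odot> z) z) = 0"
      using w_pos[of z] t_neg[of z] by simp_all
    have "w \<odot> z = 0"
      by (rule positive_kernel[OF _ w_pos 0(1)]) (metis cinner_act_star w(1))
    moreover have "(- t) \<odot> z = 0"
      by (rule positive_kernel[OF _ t_neg 0(2)]) (metis cinner_act_star nt)
    ultimately have "(w + t) \<odot> z = 0" by (simp add: act_left)
    moreover have "cinner z z = cinner y ((w + t) \<odot> z)"
      by (subst z_def) (simp add: cinner_act_star star_simps w(1) st)
    ultimately have "z = 0" using Re_cinner_self[of z] by simp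
    then show ?thesis by (simp add: z_def)
  qed
  then have "w + t = 0" by (rule act_inject)
  then have "w = - t" by (rule eq_neg_iff_add_eq_0[THEN iffD2])
  then have "1 - w = (1 - \<rho>) *\<^sub>R 1 + b"
    by (simp add: t_def scaleR_diff_left)
  then have le: "norm ((1 - \<rho>) *\<^sub>R 1 + b) \<le> 1" using w(3) by simp
  \<comment> \<open>On the spectrum, \<open>\<bar>1 - 2 b\<bar> \<le> 1\<close> and \<open>\<bar>\<delta> + b\<bar> \<le> 1\<close> force \<open>b \<le> 1 - \<delta>\<close>; a combination of the two
    norms gives the weaker bound \<open>\<parallel>b\<parallel> \<le> (1 + \<delta>) / (1 + 2 \<delta>)\<close>, which suffices.\<close>
  define \<delta> where "\<delta> = 1 - \<rho>"
  have "(1 + 2 * \<delta>) *\<^sub>R b = (- \<delta>) *\<^sub>R (1 - 2 *\<^sub>R b) + (\<delta> *\<^sub>R 1 + b)"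
    by (simp add: algebra_simps)
  then have "norm ((1 + 2 * \<delta>) *\<^sub>R b) \<le> norm ((- \<delta>) *\<^sub>R (1 - 2 *\<^sub>R b)) + norm (\<delta> *\<^sub>R 1 + b)"
    by (metis norm_triangle_ineq)
  also have "\<dots> \<le> \<delta> * 1 + 1"
    using le b_half \<rho> by (intro add_mono) (auto simp: \<delta>_def mult_left_le)
  finally show False using \<rho> by (simp add: b1 \<delta>_def)
qed

lemma norm_le_of_act_le:
  assumes r: "0 \<le> r" and le: "\<And>x. norm (a \<odot> x) \<le> r * norm x"
  shows "norm a \<le> r"
proof (rule ccontr)
  assume "\<not> norm a \<le> r"
  then have a: "r < norm a" "0 < norm a" using r by auto
  define q s where "q = r / norm a" and "s = (inverse (norm a))\<^sup>2 *\<^sub>R (star a * a)"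
  have q: "0 \<le> q" "q < 1" using a r by (simp_all add: q_def)
  show False
  proof (rule square_not_contracted)
    show "star s = s" by (simp add: s_def star_simps)
    show "norm s = 1" using a by (simp add: s_def cstar_identity power_inverse)
    show "0 \<le> q\<^sup>2" "q\<^sup>2 < 1" using q by (simp_all add: power_less_one_iff)
    show "norm (s \<odot> x) \<le> q\<^sup>2 * norm x" for x
    proof -
      have "norm (star a \<odot> a \<odot> x) \<le> r * (r * norm x)"
        using norm_star_act_le[OF le, of "a \<odot> x"] mult_left_mono[OF le[of x] r] by linarith
      then have "(inverse (norm a))\<^sup>2 * norm (star a \<odot> a \<odot> x) \<le> (inverse (norm a))\<^sup>2 * (r * (r * norm x))"
        by (rule mult_left_mono) simp
      then show ?thesis
        by (simp add: s_def act_left q_def power2_eq_square divide_inverse mult_ac)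
    qed
  qed
qed

end

section \<open>Finite orthonormal systems and minimal vectors\<close>

text \<open>Positive hermitian forms, possibly degenerate. Two instances are needed: the inner product of the
  Hilbert space, and Hilbert--Schmidt forms on the algebra, which are definite only on subalgebras.\<close>

locale positive_form =
  fixes g :: "'v::complex_vector \<Rightarrow> 'v \<Rightarrow> complex"
  assumes form_add: "g (x + y) z = g x z + g y z"
    and form_scaleC: "g (c *\<^sub>C x) y = c * g x y"
    and form_commute: "g x y = cnj (g y x)"
    and form_nonneg: "0 \<le> Re (g x x)"
begin

text \<open>Orthonormal sets are finite by definition.\<close>

definition orthonormal :: "'v set \<Rightarrow> bool" where
  "orthonormal E \<longleftrightarrow> finite E \<and> (\<forall>e\<in>E. \<forall>f\<in>E. g e f = (if e = f then 1 else 0))"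

lemma form_zero: "g 0 x = 0"
  using form_add[of 0 0 x] by simp

lemma form_minus: "g (- x) y = - g x y"
  using form_add[of x "- x" y] by (simp add: form_zero minus_unique)

lemma form_diff: "g (x - y) z = g x z - g y z"
  using form_add[of x "- y" z] by (simp add: form_minus)

lemma form_sum: "g (\<Sum>i\<in>I. f i) y = (\<Sum>i\<in>I. g (f i) y)"
  by (induction I rule: infinite_finite_induct) (auto simp: form_add form_zero)

lemma form_scaleC_right: "g x (c *\<^sub>C y) = cnj c * g x y"
  by (metis form_commute form_scaleC complex_cnj_mult)

lemma orthonormal_expansion:
  assumes E: "orthonormal E" and x: "x \<in> complex_vector.span E"
  shows "x = (\<Sum>e\<in>E. g x e *\<^sub>C e)"
proof -
  have fin: "finite E" using E by (simp add: orthonormal_def)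
  obtain u where u: "x = (\<Sum>e\<in>E. u e *\<^sub>C e)"
    using x complex_vector.span_finite[OF fin] by auto
  have "g x e = u e" if "e \<in> E" for e
  proof -
    have "g x e = (\<Sum>f\<in>E. if f = e then u f else 0)"
      unfolding u form_sum form_scaleC using E that by (intro sum.cong) (auto simp: orthonormal_def)
    then show ?thesis using fin that by simp
  qed
  then show ?thesis by (subst u) (intro sum.cong, auto)
qed

lemma Gram_Schmidt:
  assumes "finite S" "\<And>x. x \<in> complex_vector.span S \<Longrightarrow> g x x = 0 \<Longrightarrow> x = 0"
  shows "\<exists>E. orthonormal E \<and> complex_vector.span E = complex_vector.span S"
  using assms
proof (induction S rule: finite_induct)
  case empty
  then show ?case by (intro exI[of _ "{}"]) (simp add: orthonormal_def)
next
  case (insert s S)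
  have "x = 0" if "x \<in> complex_vector.span S" "g x x = 0" for x
    using that insert.prems complex_vector.span_mono[of S "insert s S"] by blast
  then obtain E where E: "orthonormal E" and span: "complex_vector.span E = complex_vector.span S"
    using insert.IH by auto
  have fin: "finite E" using E by (simp add: orthonormal_def)
  have span': "complex_vector.span (insert s E) = complex_vector.span (insert s S)"
    by (simp add: complex_vector.span_insert span)
  define p where "p = (\<Sum>e\<in>E. g s e *\<^sub>C e)"
  have p: "p \<in> complex_vector.span E"
    unfolding p_def by (intro complex_vector.span_sum complex_vector.span_scale complex_vector.span_base)
  define u where "u = s - p"
  have us: "u \<in> complex_vector.span (insert s E)"
    unfolding u_def using p complex_vector.span_mono[OF subset_insertI[of E s]]
    by (intro complex_vector.span_diff complex_vector.span_base[OF insertI1]) blast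
  have orth: "g u e = 0" if "e \<in> E" for e
  proof -
    have "g p e = (\<Sum>f\<in>E. if f = e then g s f else 0)"
      unfolding p_def form_sum form_scaleC using E that
      by (intro sum.cong) (auto simp: orthonormal_def)
    then show ?thesis using fin that by (simp add: u_def form_diff)
  qed
  show ?case
  proof (cases "g u u = 0")
    case True
    then have "u = 0" using us insert.prems span' by auto
    then have "s \<in> complex_vector.span E" using p by (simp add: u_def)
    then have "complex_vector.span E = complex_vector.span (insert s S)"
      using span span' complex_vector.span_redundant by metis
    then show ?thesis using E by blast
  next
    case False
    have im: "Im (g u u) = 0" using arg_cong[OF form_commute[of u u], of Im] by simp
    have pos: "0 < Re (g u u)"
      using False im form_nonneg[of u] by (auto simp: complex_eq_iff)
    define r where "r = sqrt (Re (g u u))"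
    have r: "0 < r" "g u u = complex_of_real (r\<^sup>2)"
      using pos im by (simp_all add: r_def complex_eq_iff)
    define w where "w = complex_of_real (1 / r) *\<^sub>C u"
    have ww: "g w w = 1"
      unfolding w_def form_scaleC form_scaleC_right r(2)
      using r(1) by (simp add: power2_eq_square field_simps)
    have we: "g w e = 0" "g e w = 0" if "e \<in> E" for e
      using orth[OF that] form_commute[of e u]
      by (simp_all add: w_def form_scaleC form_scaleC_right)
    have "orthonormal (insert w E)"
      using E ww we by (auto simp: orthonormal_def)
    moreover have "complex_vector.span (insert w E) = complex_vector.span (insert s E)"
    proof (rule complex_vector.span_eq[THEN iffD2], intro conjI subsetI)
      fix x assume "x \<in> insert w E"
      then show "x \<in> complex_vector.span (insert s E)"
        using us by (auto simp: w_def intro: complex_vector.span_scale complex_vector.span_base)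
    next
      fix x assume x: "x \<in> insert s E"
      have "s = complex_of_real r *\<^sub>C w + p"
        using r(1) by (simp add: w_def scaleC_scaleC scaleC_one u_def)
      moreover have "complex_of_real r *\<^sub>C w + p \<in> complex_vector.span (insert w E)"
        using p complex_vector.span_mono[OF subset_insertI[of E w]]
        by (intro complex_vector.span_add complex_vector.span_scale
            complex_vector.span_base[OF insertI1]) blast
      ultimately show "x \<in> complex_vector.span (insert w E)"
        using x by (auto intro: complex_vector.span_base)
    qed
    ultimately show ?thesis using span' by auto
  qed
qed

end

interpretation cinner: positive_form "cinner :: 'h::chilbert_space \<Rightarrow> 'h \<Rightarrow> complex"
  by unfold_locales
    (auto simp: cinner_add_left cinner_scaleC_left Re_cinner_self intro: cinner_commute)

lemma orthonormal_basis_exists: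
  fixes S :: "'h::chilbert_space set"
  assumes "finite S"
  obtains E where "cinner.orthonormal E" "complex_vector.span E = complex_vector.span S"
proof -
  have "\<exists>E. cinner.orthonormal E \<and> complex_vector.span E = complex_vector.span S"
  proof (rule cinner.Gram_Schmidt[OF assms])
    show "x = 0" if "cinner x x = 0" for x :: 'h using that Re_cinner_self[of x] by simp
  qed
  then show ?thesis using that by blast
qed

text \<open>Vectors of the Hilbert space \<open>H\<^sup>n\<close> are families indexed by a finite set \<open>I\<close>, with values outside
  \<open>I\<close> ignored. The family \<open>m\<close> is the vector of minimal norm in the closure of the convex set \<open>C\<close>.\<close>

lemma minimal_family:
  fixes C :: "('i \<Rightarrow> 'h::chilbert_space) set"
  assumes I: "finite I" and ne: "C \<noteq> {}"
    and conv: "\<And>f g t. f \<in> C \<Longrightarrow> g \<in> C \<Longrightarrow> 0 \<le> t \<Longrightarrow> t \<le> 1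
      \<Longrightarrow> (\<lambda>i. t *\<^sub>R f i + (1 - t) *\<^sub>R g i) \<in> C"
  obtains m where "\<And>e. 0 < e \<Longrightarrow> \<exists>f\<in>C. \<forall>i\<in>I. norm (f i - m i) < e"
    and "\<And>f. f \<in> C \<Longrightarrow> 0 \<le> (\<Sum>i\<in>I. Re (cinner (m i) (f i - m i)))"
proof -
  define N where "N f = (\<Sum>i\<in>I. (norm (f i))\<^sup>2)" for f :: "'i \<Rightarrow> 'h"
  define d where "d = Inf (N ` C)"
  have N0: "0 \<le> N f" for f by (simp add: N_def sum_nonneg)
  have bdd: "bdd_below (N ` C)" using N0 by (intro bdd_belowI2)
  have d_le: "d \<le> N f" if "f \<in> C" for f
    unfolding d_def using that bdd by (intro cInf_lower) auto
  have "\<exists>f\<in>C. N f < d + 1 / real (Suc n)" for n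
  proof -
    have "Inf (N ` C) < d + 1 / real (Suc n)" by (simp add: d_def)
    then show ?thesis using ne by (subst (asm) cInf_less_iff[OF _ bdd]) auto
  qed
  then obtain s where s: "\<And>n. s n \<in> C" "\<And>n. N (s n) < d + 1 / real (Suc n)" by metis
  have parallelogram: "N (\<lambda>i. f i - g i) \<le> 2 * N f + 2 * N g - 4 * d" if "f \<in> C" "g \<in> C" for f g
  proof -
    have "(\<lambda>i. (1/2) *\<^sub>R f i + (1 - 1/2) *\<^sub>R g i) \<in> C" by (rule conv) (use that in auto)
    then have "d \<le> N (\<lambda>i. (1/2) *\<^sub>R f i + (1 - 1/2) *\<^sub>R g i)" by (rule d_le)
    also have "\<dots> = (\<Sum>i\<in>I. (norm (f i + g i))\<^sup>2 / 4)"
      unfolding N_def by (intro sum.cong refl)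
        (simp add: power_divide flip: scaleR_add_right)
    also have "4 * (\<Sum>i\<in>I. (norm (f i + g i))\<^sup>2 / 4) + N (\<lambda>i. f i - g i) = 2 * N f + 2 * N g"
      by (simp add: N_def norm_add_square norm_diff_square sum_distrib_left add_divide_distrib
          flip: sum.distrib)
    finally show ?thesis by linarith
  qed
  have "Cauchy (\<lambda>n. s n i)" if i: "i \<in> I" for i
  proof (rule metric_CauchyI)
    fix e :: real assume e: "0 < e"
    obtain K where K: "4 / e\<^sup>2 < real K" using reals_Archimedean2 by blast
    show "\<exists>M. \<forall>m\<ge>M. \<forall>n\<ge>M. dist (s m i) (s n i) < e"
    proof (intro exI allI impI)
      fix m n assume mn: "K \<le> m" "K \<le> n"
      have K0: "0 < real K" using K e by (smt (verit) divide_pos_pos zero_less_power)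
      have inv: "1 / real (Suc l) \<le> 1 / real K" if "K \<le> l" for l
        using that K0 by (intro divide_left_mono) auto
      have "(norm (s m i - s n i))\<^sup>2 \<le> N (\<lambda>i. s m i - s n i)"
        unfolding N_def using I i by (intro member_le_sum) auto
      also have "\<dots> \<le> 2 * N (s m) + 2 * N (s n) - 4 * d" by (intro parallelogram s)
      also have "\<dots> < 4 / real K"
        using s(2)[of m] s(2)[of n] inv[OF mn(1)] inv[OF mn(2)] by linarith
      also have "\<dots> < e\<^sup>2" using K K0 e by (simp add: field_simps)
      finally show "dist (s m i) (s n i) < e"
        using e by (simp add: dist_norm power2_less_imp_less)
    qed
  qed
  then have "\<forall>i\<in>I. \<exists>l. (\<lambda>n. s n i) \<longlonglongrightarrow> l"
    using Cauchy_convergent convergent_def by blast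
  then obtain m where m: "\<And>i. i \<in> I \<Longrightarrow> (\<lambda>n. s n i) \<longlonglongrightarrow> m i" by metis
  show ?thesis
  proof (rule that[of m])
    fix e :: real assume e: "0 < e"
    have "\<forall>i\<in>I. eventually (\<lambda>n. norm (s n i - m i) < e) sequentially"
      using m e by (auto simp: tendsto_iff dist_norm)
    then have "eventually (\<lambda>n. \<forall>i\<in>I. norm (s n i - m i) < e) sequentially"
      using I by (simp add: eventually_ball_finite)
    then show "\<exists>f\<in>C. \<forall>i\<in>I. norm (f i - m i) < e"
      using s(1) eventually_happens'[OF sequentially_bot] by blast
  next
    fix f assume f: "f \<in> C"
    define A B where "A = (\<Sum>i\<in>I. Re (cinner (m i) (f i - m i)))" and "B = N (\<lambda>i. f i - m i)"
    have Nm: "N m \<le> d"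
    proof (rule LIMSEQ_le)
      show "(\<lambda>n. N (s n)) \<longlonglongrightarrow> N m"
        unfolding N_def by (intro tendsto_intros m)
      show "(\<lambda>n. d + 1 / real (Suc n)) \<longlonglongrightarrow> d"
        using LIMSEQ_inverse_real_of_nat_add[of d] by (simp add: divide_inverse)
      show "\<exists>K. \<forall>n\<ge>K. N (s n) \<le> d + 1 / real (Suc n)"
        using s(2) less_imp_le by blast
    qed
    have *: "0 \<le> 2 * A + t * B" if t: "0 < t" "t \<le> 1" for t
    proof -
      have "d \<le> N (\<lambda>i. t *\<^sub>R f i + (1 - t) *\<^sub>R m i)"
      proof (rule LIMSEQ_le_const)
        show "(\<lambda>n. N (\<lambda>i. t *\<^sub>R f i + (1 - t) *\<^sub>R s n i)) \<longlonglongrightarrow> N (\<lambda>i. t *\<^sub>R f i + (1 - t) *\<^sub>R m i)"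
          unfolding N_def by (intro tendsto_intros m)
        show "\<exists>K. \<forall>n\<ge>K. d \<le> N (\<lambda>i. t *\<^sub>R f i + (1 - t) *\<^sub>R s n i)"
          using t f s(1) by (intro exI allI impI d_le conv) auto
      qed
      also have "\<dots> = (\<Sum>i\<in>I. (norm (m i + t *\<^sub>R (f i - m i)))\<^sup>2)"
        unfolding N_def by (intro sum.cong refl) (simp add: algebra_simps)
      also have "\<dots> = N m + 2 * t * A + t\<^sup>2 * B"
        unfolding N_def A_def B_def norm_add_square
        by (simp add: sum.distrib sum_distrib_left cinner_simps power_mult_distrib mult_ac)
      finally have "0 \<le> t * (2 * A + t * B)"
        using Nm by (simp add: power2_eq_square algebra_simps)
      then show ?thesis using t by (simp add: zero_le_mult_iff)
    qed
    show "0 \<le> (\<Sum>i\<in>I. Re (cinner (m i) (f i - m i)))"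
    proof (rule ccontr)
      assume "\<not> ?thesis"
      then have A: "A < 0" by (simp add: A_def)
      have B: "0 \<le> B" by (simp add: B_def N0)
      define t where "t = min 1 (- A / (B + 1))"
      have t: "0 < t" "t \<le> 1" using A B by (auto simp: t_def intro: divide_neg_pos)
      have "t * B \<le> (- A / (B + 1)) * B" using B by (intro mult_right_mono) (auto simp: t_def)
      also have "\<dots> \<le> - A" using A B by (simp add: field_simps)
      finally show False using *[OF t] A by linarith
    qed
  qed
qed

text \<open>The case \<open>C = v - L\<close> for a real subspace \<open>L\<close>: \<open>v - m\<close> is the projection of \<open>v\<close> onto the closure of \<open>L\<close>.\<close>

lemma projection_family:
  fixes L :: "('i \<Rightarrow> 'h::chilbert_space) set"
  assumes I: "finite I" and ne: "L \<noteq> {}"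
    and lin: "\<And>f g r. f \<in> L \<Longrightarrow> g \<in> L \<Longrightarrow> (\<lambda>i. f i + r *\<^sub>R g i) \<in> L"
  obtains m where "\<And>e. 0 < e \<Longrightarrow> \<exists>l\<in>L. \<forall>i\<in>I. norm (v i - m i - l i) < e"
    and "\<And>l. l \<in> L \<Longrightarrow> (\<Sum>i\<in>I. Re (cinner (m i) (l i))) = 0"
proof -
  define C where "C = (\<lambda>l i. v i - l i) ` L"
  have conv: "(\<lambda>i. t *\<^sub>R f i + (1 - t) *\<^sub>R g i) \<in> C" if fg: "f \<in> C" "g \<in> C" for f g t
  proof -
    obtain k l where kl: "k \<in> L" "l \<in> L" "f = (\<lambda>i. v i - k i)" "g = (\<lambda>i. v i - l i)"
      using fg by (auto simp: C_def)
    have "(\<lambda>i. (l i + t *\<^sub>R k i) + (- t) *\<^sub>R l i) \<in> L" by (intro lin kl)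
    then have "(\<lambda>i. v i - ((l i + t *\<^sub>R k i) + (- t) *\<^sub>R l i)) \<in> C"
      unfolding C_def by (rule imageI)
    then show ?thesis by (simp add: kl algebra_simps)
  qed
  obtain m where m: "\<And>e. 0 < e \<Longrightarrow> \<exists>f\<in>C. \<forall>i\<in>I. norm (f i - m i) < e"
    "\<And>f. f \<in> C \<Longrightarrow> 0 \<le> (\<Sum>i\<in>I. Re (cinner (m i) (f i - m i)))"
    using minimal_family[OF I _ conv] ne by (auto simp: C_def)
  show ?thesis
  proof (rule that[of m])
    show "\<exists>l\<in>L. \<forall>i\<in>I. norm (v i - m i - l i) < e" if "0 < e" for e
      using m(1)[OF that] by (auto simp: C_def algebra_simps)
    fix l assume l: "l \<in> L"
    obtain k where k: "k \<in> L" using ne by blast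
    define A B where "A = (\<Sum>i\<in>I. Re (cinner (m i) (v i - k i - m i)))"
      and "B = (\<Sum>i\<in>I. Re (cinner (m i) (l i)))"
    have *: "0 \<le> A - r * B" for r
    proof -
      have "(\<lambda>i. v i - (k i + r *\<^sub>R l i)) \<in> C" using lin[OF k l, of r] by (auto simp: C_def)
      then have "0 \<le> (\<Sum>i\<in>I. Re (cinner (m i) (v i - (k i + r *\<^sub>R l i) - m i)))" by (rule m(2))
      also have "\<dots> = A - r * B"
        by (simp add: A_def B_def cinner_simps sum_distrib_left sum.distrib sum_subtractf algebra_simps)
      finally show ?thesis .
    qed
    show "(\<Sum>i\<in>I. Re (cinner (m i) (l i))) = 0"
    proof (rule ccontr)
      assume "\<not> ?thesis"
      then have "B \<noteq> 0" by (simp add: B_def)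
      then show False using *[of "(A + 1) / B"] by simp
    qed
  qed
qed

section \<open>Schur's lemma and density\<close>

context faithful_irreducible
begin

text \<open>In terms of spectral theory: a self-adjoint operator \<open>S\<close> commuting with the algebra cannot have both a
  positive and a negative part, since the kernel of \<open>\<bar>S\<bar> - S\<close> is an invariant subspace.\<close>

lemma commutant_definite:
  fixes S :: "'h \<Rightarrow>\<^sub>L 'h"
  assumes comm: "\<And>a x. blinfun_apply S (a \<odot> x) = a \<odot> blinfun_apply S x"
    and sa: "\<And>x y. cinner (blinfun_apply S x) y = cinner x (blinfun_apply S y)"
  shows "(\<forall>x. 0 \<le> Re (cinner (blinfun_apply S x) x)) \<or> (\<forall>x. Re (cinner (blinfun_apply S x) x) \<le> 0)"
proof -
  define \<kappa> where "\<kappa> = inverse (norm S + 1)"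
  have \<kappa>: "0 < \<kappa>" by (simp add: \<kappa>_def add_nonneg_pos)
  define T where "T = \<kappa> *\<^sub>R S"
  have T1: "norm T \<le> 1"
  proof -
    have "0 < norm S + 1" by (simp add: add_nonneg_pos)
    moreover from this have "norm T = norm S / (norm S + 1)"
      by (simp add: T_def \<kappa>_def divide_inverse)
    ultimately show ?thesis by simp
  qed
  have T_sa: "cinner (T x) y = cinner x (T y)" for x y
    by (simp add: T_def blinfun.scaleR_left cinner_simps sa)
  have T_comm: "T (a \<odot> x) = a \<odot> T x" for a x
    by (simp add: T_def blinfun.scaleR_left comm act_right)
  have T_le: "norm (T x) \<le> norm x" for x
    using norm_blinfun[of T x] mult_right_mono[OF T1, of "norm x"] by simp
  define X where "X = id_blinfun - (T o\<^sub>L T)"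
  have X_apply: "X x = x - T (T x)" for x
    by (simp add: X_def blinfun.diff_left)
  have TT: "Re (cinner (T (T x)) x) = (norm (T x))\<^sup>2" for x
    by (subst T_sa) (rule Re_cinner_self)
  have X1: "norm X \<le> 1"
  proof (rule norm_blinfun_bound)
    fix x
    show "norm (X x) \<le> 1 * norm x"
    proof (rule norm_le_of_form_le)
      show "cinner (X x) y = cinner x (X y)" for x y
        by (simp add: X_apply cinner_simps T_sa)
      show "0 \<le> Re (cinner (X x) x)" "Re (cinner (X x) x) \<le> 1 * (norm x)\<^sup>2" for x
        using T_le[of x] by (simp_all add: X_apply cinner_simps TT Re_cinner_self)
    qed
  qed simp
  define Z where "Z = {U :: 'h \<Rightarrow>\<^sub>L 'h. (\<forall>x y. cinner (U x) y = cinner x (U y))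
    \<and> (\<forall>a x. U (a \<odot> x) = a \<odot> U x) \<and> (\<forall>x. U (T x) = T (U x))}"
  have "closed Z"
    unfolding Z_def
    by (intro closed_Collect_conj closed_Collect_all closed_Collect_eq continuous_intros
        bounded_bilinear.continuous_on[OF bounded_bilinear_cinner])
  moreover have "0 \<in> Z" by (simp add: Z_def)
  moreover have "(1/2) *\<^sub>R (X + (U o\<^sub>L U)) \<in> Z" if "U \<in> Z" for U
  proof -
    have U: "cinner (U x) y = cinner x (U y)" "U (a \<odot> x) = a \<odot> U x" "U (T x) = T (U x)" for x y a
      using that by (simp_all add: Z_def)
    show ?thesis
      by (simp add: Z_def blinfun.add_left blinfun.scaleR_left X_apply cinner_simps U T_sa T_comm
          act_right blinfun.diff_right blinfun.add_right blinfun.scaleR_right)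
  qed
  ultimately obtain Y where Y: "norm Y \<le> 1" "Y \<in> Z" "X + (Y o\<^sub>L Y) = 2 *\<^sub>R Y"
    using square_root_exists[OF bounded_bilinear_blinfun_compose norm_blinfun_compose X1, of Z] by blast
  have Y_sa: "cinner (Y x) y = cinner x (Y y)" and Y_comm: "Y (a \<odot> x) = a \<odot> Y x"
    and YT: "Y (T x) = T (Y x)" for x y a
    using Y(2) by (simp_all add: Z_def)
  have YY: "X x + Y (Y x) = 2 *\<^sub>R Y x" for x
    using arg_cong[OF Y(3), of "\<lambda>U. blinfun_apply U x"] by (simp add: blinfun.add_left blinfun.scaleR_left)
  have Y_le: "Re (cinner (Y x) x) \<le> (norm x)\<^sup>2" for x
  proof -
    have "Re (cinner (Y x) x) \<le> norm (Y x) * norm x" by (rule Cauchy_Schwarz_Re)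
    also have "\<dots> \<le> (1 * norm x) * norm x"
      using norm_blinfun[of Y x] mult_right_mono[OF Y(1), of "norm x"] by (intro mult_right_mono) auto
    finally show ?thesis by (simp add: power2_eq_square)
  qed
  \<comment> \<open>\<open>w x\<close> is the absolute value of \<open>T\<close> at \<open>x\<close>.\<close>
  define w where "w x = x - Y x" for x
  have w_pos: "0 \<le> Re (cinner (w x) x)" for x
    using Y_le[of x] by (simp add: w_def cinner_simps Re_cinner_self)
  have ww: "w (w x) = T (T x)" for x
    using YY[of x] by (simp add: w_def X_apply blinfun.diff_right scaleR_2 algebra_simps)
  have wT: "w (T x) = T (w x)" for x
    by (simp add: w_def YT blinfun.diff_right)
  define M where "M = {x. w x = T x}"
  have T_scaleC: "T (c *\<^sub>C x) = c *\<^sub>C T x" and Y_scaleC: "Y (c *\<^sub>C x) = c *\<^sub>C Y x" for c x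
    using T_comm[of "c *\<^sub>C 1" x] Y_comm[of "c *\<^sub>C 1" x] by (simp_all add: act_left)
  have "M = {0} \<or> M = UNIV"
  proof (rule invariant_subspace_trivial)
    show "complex_vector.subspace M"
      unfolding complex_vector.subspace_def
      by (auto simp: M_def w_def T_scaleC Y_scaleC blinfun.add_right algebra_simps
          simp flip: scaleC_add_right)
    show "closed M"
      unfolding M_def w_def by (intro closed_Collect_eq continuous_intros)
    show "a \<odot> x \<in> M" if "x \<in> M" for a x
      using that by (simp add: M_def w_def T_comm Y_comm flip: blinfun.diff_right)
  qed
  then have "(\<forall>x. 0 \<le> Re (cinner (T x) x)) \<or> (\<forall>x. Re (cinner (T x) x) \<le> 0)"
  proof
    assume "M = {0}"
    have "w x + T x \<in> M" for x
    proof -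
      have "w (w x + T x) = w (w x) + w (T x)" by (simp add: w_def blinfun.add_right)
      then show ?thesis by (simp add: M_def ww wT blinfun.add_right)
    qed
    then have "w x + T x = 0" for x using \<open>M = {0}\<close> by auto
    then have "T x = - w x" for x by (simp add: eq_neg_iff_add_eq_0 add.commute)
    then show ?thesis using w_pos by (simp add: cinner_minus_left)
  next
    assume "M = UNIV"
    then have "T x = w x" for x by (simp add: M_def set_eq_iff)
    then show ?thesis using w_pos by simp
  qed
  then show ?thesis
    using \<kappa> by (simp add: T_def blinfun.scaleR_left cinner_scaleR_left zero_le_mult_iff mult_le_0_iff)
qed

lemma Schur_selfadjoint:
  fixes S :: "'h \<Rightarrow>\<^sub>L 'h"
  assumes comm: "\<And>a x. blinfun_apply S (a \<odot> x) = a \<odot> blinfun_apply S x"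
    and sa: "\<And>x y. cinner (blinfun_apply S x) y = cinner x (blinfun_apply S y)"
  shows "\<exists>r. \<forall>x. blinfun_apply S x = r *\<^sub>R x"
proof -
  \<comment> \<open>Every \<open>S - t\<close> is definite, so the largest lower bound of \<open>S\<close> is also an upper bound.\<close>
  define \<Lambda> where "\<Lambda> = {r. \<forall>x. r * (norm x)\<^sup>2 \<le> Re (cinner (S x) x)}"
  obtain x0 :: 'h where x0: "x0 \<noteq> 0" using Hilbert_space_nontrivial by blast
  have S_le: "\<bar>Re (cinner (S x) x)\<bar> \<le> norm S * (norm x)\<^sup>2" for x
  proof -
    have "\<bar>Re (cinner (S x) x)\<bar> \<le> norm (S x) * norm x"
      using Cauchy_Schwarz[of "S x" x] abs_Re_le_cmod order.trans by blast
    also have "\<dots> \<le> (norm S * norm x) * norm x"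
      by (intro mult_right_mono norm_blinfun) simp
    finally show ?thesis by (simp add: power2_eq_square mult_ac)
  qed
  have "- norm S \<in> \<Lambda>"
    unfolding \<Lambda>_def using S_le by (auto simp: abs_le_iff) (smt (verit))
  then have ne: "\<Lambda> \<noteq> {}" by blast
  have bdd: "bdd_above \<Lambda>"
  proof (rule bdd_aboveI)
    fix r assume "r \<in> \<Lambda>"
    then have "r * (norm x0)\<^sup>2 \<le> norm S * (norm x0)\<^sup>2"
      using S_le[of x0] by (simp add: \<Lambda>_def abs_le_iff) (meson order.trans)
    then show "r \<le> norm S" using x0 by simp
  qed
  define r where "r = Sup \<Lambda>"
  have lower: "r * (norm x)\<^sup>2 \<le> Re (cinner (S x) x)" for x
  proof (cases "x = 0")
    case False
    have "r \<le> Re (cinner (S x) x) / (norm x)\<^sup>2"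
      unfolding r_def using ne False by (intro cSup_least) (auto simp: \<Lambda>_def field_simps)
    then show ?thesis using False by (simp add: field_simps)
  qed simp
  have upper: "Re (cinner (S x) x) \<le> r * (norm x)\<^sup>2" for x
  proof (rule field_le_epsilon)
    fix e :: real assume e: "0 < e"
    define t where "t = r + e / ((norm x)\<^sup>2 + 1)"
    have pos: "0 < (norm x)\<^sup>2 + 1" by (simp add: add_nonneg_pos)
    have "r < t" using e pos by (simp add: t_def)
    then have "t \<notin> \<Lambda>" using bdd cSup_upper r_def by force
    then have "\<exists>x. Re (cinner (S x) x) < t * (norm x)\<^sup>2" by (auto simp: \<Lambda>_def not_le)
    moreover have "(\<forall>x. 0 \<le> Re (cinner ((S - t *\<^sub>R id_blinfun) x) x))
        \<or> (\<forall>x. Re (cinner ((S - t *\<^sub>R id_blinfun) x) x) \<le> 0)"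
      by (rule commutant_definite)
        (simp_all add: blinfun.diff_left blinfun.scaleR_left comm sa act_right cinner_simps)
    ultimately have "Re (cinner (S x) x) \<le> t * (norm x)\<^sup>2"
      by (simp add: blinfun.diff_left blinfun.scaleR_left cinner_simps Re_cinner_self) (smt (verit))
    also have "\<dots> \<le> r * (norm x)\<^sup>2 + e"
      using e pos by (simp add: t_def field_simps)
    finally show "Re (cinner (S x) x) \<le> r * (norm x)\<^sup>2 + e" .
  qed
  have "S x - r *\<^sub>R x = 0" for x
    by (rule positive_kernel[of "\<lambda>x. S x - r *\<^sub>R x"])
      (use lower upper in \<open>auto simp: cinner_simps sa Re_cinner_self intro: antisym\<close>)
  then show ?thesis by auto
qed

text \<open>Linearity of \<open>S\<close> is implied by the existence of an adjoint.\<close>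

lemma Schur:
  fixes S S' :: "'h \<Rightarrow> 'h"
  assumes adj: "\<And>x y. cinner (S x) y = cinner x (S' y)"
    and comm: "\<And>a x. S (a \<odot> x) = a \<odot> S x" "\<And>a x. S' (a \<odot> x) = a \<odot> S' x"
    and le: "\<And>x. norm (S x) \<le> norm x" "\<And>x. norm (S' x) \<le> norm x"
  shows "\<exists>c. \<forall>x. S x = c *\<^sub>C x"
proof -
  have adj': "cinner (S' x) y = cinner x (S y)" for x y
    by (metis adj cinner_commute)
  have lin: "S (x + y) = S x + S y" "S (r *\<^sub>R x) = r *\<^sub>R S x"
    "S' (x + y) = S' x + S' y" "S' (r *\<^sub>R x) = r *\<^sub>R S' x" for x y r
    by (rule cinner_eqI, simp add: adj adj' cinner_simps)+
  have bl: "bounded_linear S" "bounded_linear S'"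
    by (rule bounded_linear_intro[where K = 1]; simp add: lin le)+
  define A where "A = Blinfun S + Blinfun S'"
  define B where "B = (\<pi> (\<i> *\<^sub>C 1)) o\<^sub>L (Blinfun S - Blinfun S')"
  have A: "A x = S x + S' x" for x
    by (simp add: A_def blinfun.add_left bounded_linear_Blinfun_apply bl)
  have B: "B x = \<i> *\<^sub>C (S x - S' x)" for x
    by (simp add: B_def blinfun.diff_left bounded_linear_Blinfun_apply bl act_left)
  obtain r where r: "\<And>x. A x = r *\<^sub>R x"
    using Schur_selfadjoint[of A] by (auto simp: A adj adj' comm cinner_simps act_right)
  obtain t where t: "\<And>x. B x = t *\<^sub>R x"
    using Schur_selfadjoint[of B] by (auto simp: B adj adj' comm cinner_simps act_right algebra_simps)
  have "S x = ((r - \<i> * t) / 2) *\<^sub>C x" for x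
  proof -
    have "S x + S' x = complex_of_real r *\<^sub>C x" "\<i> *\<^sub>C (S x - S' x) = complex_of_real t *\<^sub>C x"
      using r[of x] t[of x] by (simp_all add: A B scaleR_scaleC)
    then have "(S x + S' x) - \<i> *\<^sub>C \<i> *\<^sub>C (S x - S' x) = complex_of_real r *\<^sub>C x - \<i> *\<^sub>C complex_of_real t *\<^sub>C x"
      by simp
    then have "2 *\<^sub>R S x = (complex_of_real r - \<i> * complex_of_real t) *\<^sub>C x"
      by (simp add: scaleC_scaleC scaleC_minus_one scaleR_2 complex_vector.scale_left_diff_distrib)
    then have "(1/2) *\<^sub>R (2 *\<^sub>R S x) = (1/2) *\<^sub>R ((complex_of_real r - \<i> * complex_of_real t) *\<^sub>C x)"
      by simp
    then show ?thesis by (simp add: scaleR_scaleC scaleC_scaleC)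
  qed
  then show ?thesis by blast
qed

text \<open>The families \<open>f\<close> in \<open>H\<^sup>n\<close> orthogonal to all \<open>(a e)\<^sub>e\<close> form a closed subspace invariant under the diagonal
  action. By Schur's lemma the projection onto it is a matrix of scalars, and it annihilates the family
  \<open>(e)\<^sub>e\<close> of linearly independent vectors, so it vanishes.\<close>

lemma density:
  assumes E: "cinner.orthonormal E"
    and f: "\<And>a. (\<Sum>e\<in>E. cinner (a \<odot> e) (f e)) = 0" and k: "k \<in> E"
  shows "f k = 0"
proof -
  have fin: "finite E" using E by (simp add: cinner.orthonormal_def)
  define ip where "ip u v = (\<Sum>e\<in>E. cinner (u e) (v e))" for u v :: "'h \<Rightarrow> 'h"
  have ip_commute: "ip u v = cnj (ip v u)" for u v
    unfolding ip_def cnj_sum by (intro sum.cong refl cinner_commute)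
  define M where "M = {f. \<forall>a. ip (\<lambda>e. a \<odot> e) f = 0}"
  have M_add: "(\<lambda>e. u e + r *\<^sub>R w e) \<in> M" if "u \<in> M" "w \<in> M" for u w r
    using that by (simp add: M_def ip_def cinner_simps sum.distrib flip: sum_distrib_left)
  have M_scaleC: "(\<lambda>e. c *\<^sub>C u e) \<in> M" if "u \<in> M" for u c
    using that by (simp add: M_def ip_def cinner_simps flip: sum_distrib_left)
  have ip_act: "ip (\<lambda>e. a \<odot> u e) w = ip u (\<lambda>e. star a \<odot> w e)" for a u w
    by (simp add: ip_def cinner_act_star)
  have M_act: "(\<lambda>e. a \<odot> u e) \<in> M" if "u \<in> M" for a u
  proof -
    have "ip (\<lambda>e. b \<odot> e) (\<lambda>e. a \<odot> u e) = ip (\<lambda>e. (star a * b) \<odot> e) u" for b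
      by (simp add: ip_def cinner_star_act act_mult)
    then show ?thesis using that by (simp add: M_def)
  qed
  define \<delta> where "\<delta> k z = (\<lambda>e. if e = k then z else 0)" for k z :: 'h
  have ip_\<delta>: "ip (\<delta> k z) u = cinner z (u k)" if "k \<in> E" for k z u
  proof -
    have "ip (\<delta> k z) u = (\<Sum>e\<in>E. if e = k then cinner z (u k) else 0)"
      unfolding ip_def \<delta>_def by (intro sum.cong) auto
    then show ?thesis using fin that by simp
  qed
  have "\<exists>p\<in>M. \<forall>u\<in>M. ip v u = ip p u" for v
  proof -
    have "(\<lambda>e. 0) \<in> M" by (simp add: M_def ip_def)
    then obtain m where m: "\<And>e. 0 < e \<Longrightarrow> \<exists>l\<in>M. \<forall>i\<in>E. norm (v i - m i - l i) < e"
      "\<And>l. l \<in> M \<Longrightarrow> (\<Sum>i\<in>E. Re (cinner (m i) (l i))) = 0"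
      using projection_family[OF fin _ M_add, of v] by blast
    define p where "p e = v e - m e" for e
    have "p \<in> M"
      unfolding M_def
    proof (intro CollectI allI)
      fix a
      define K where "K = (\<Sum>e\<in>E. norm (a \<odot> e))"
      have K: "0 \<le> K" by (simp add: K_def sum_nonneg)
      have "cmod (ip (\<lambda>e. a \<odot> e) p) \<le> 0"
      proof (rule field_le_epsilon)
        fix d :: real assume d: "0 < d"
        then obtain l where l: "l \<in> M" "\<And>i. i \<in> E \<Longrightarrow> norm (p i - l i) < d / (K + 1)"
          using m(1)[of "d / (K + 1)"] K by (auto simp: p_def)
        have "ip (\<lambda>e. a \<odot> e) p = ip (\<lambda>e. a \<odot> e) p - ip (\<lambda>e. a \<odot> e) l"
          using l(1) by (simp add: M_def)
        also have "\<dots> = (\<Sum>e\<in>E. cinner (a \<odot> e) (p e - l e))"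
          by (simp add: ip_def cinner_simps sum_subtractf)
        also have "cmod \<dots> \<le> (\<Sum>e\<in>E. norm (a \<odot> e) * (d / (K + 1)))"
          using l(2) by (intro order.trans[OF norm_sum] sum_mono order.trans[OF Cauchy_Schwarz]
              mult_left_mono) (auto intro: less_imp_le)
        also have "\<dots> = K * d / (K + 1)" by (simp add: K_def sum_distrib_right sum_divide_distrib)
        also have "\<dots> \<le> 0 + d" using K d by (simp add: field_simps)
        finally show "cmod (ip (\<lambda>e. a \<odot> e) p) \<le> 0 + d" .
      qed
      then show "ip (\<lambda>e. a \<odot> e) p = 0" by simp
    qed
    moreover have "ip v u = ip p u" if u: "u \<in> M" for u
    proof -
      have Re0: "Re (ip m u) = 0" if "u \<in> M" for u
        using m(2)[OF that] by (simp add: ip_def)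
      have "ip m (\<lambda>e. \<i> *\<^sub>C u e) = - \<i> * ip m u"
        by (simp add: ip_def cinner_simps sum_distrib_left sum_negf)
      then have "Im (ip m u) = 0" using Re0[OF M_scaleC[OF u, of \<i>]] by simp
      then have "ip m u = 0" using Re0[OF u] by (simp add: complex_eq_iff)
      then show ?thesis by (simp add: ip_def p_def cinner_simps sum_subtractf)
    qed
    ultimately show ?thesis by blast
  qed
  then have "\<exists>P. \<forall>v. P v \<in> M \<and> (\<forall>u\<in>M. ip v u = ip (P v) u)" by metis
  then obtain P where P: "\<And>v. P v \<in> M" "\<And>v u. u \<in> M \<Longrightarrow> ip v u = ip (P v) u" by blast
  \<comment> \<open>\<open>P\<close> is the projection onto \<open>M\<close>, and \<open>q j k\<close> are its matrix entries.\<close>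
  define q where "q j k z = P (\<delta> k z) j" for j k z
  have adj: "cinner (q j k x) y = cinner x (q k j y)" if "j \<in> E" "k \<in> E" for j k x y
  proof -
    have "cinner (q j k x) y = cnj (ip (\<delta> j y) (P (\<delta> k x)))"
      by (simp add: ip_\<delta> that q_def cinner_commute[of y])
    also have "\<dots> = ip (P (\<delta> k x)) (P (\<delta> j y))"
      by (subst P(2)[OF P(1)]) (rule ip_commute[symmetric])
    also have "\<dots> = cinner x (q k j y)"
      by (simp add: P(2)[OF P(1), symmetric] ip_\<delta> that q_def)
    finally show ?thesis .
  qed
  have comm: "q j k (a \<odot> x) = a \<odot> q j k x" if "j \<in> E" "k \<in> E" for j k a x
  proof (rule cinner_eqI)
    fix y
    have "cinner (q j k (a \<odot> x)) y = cinner (a \<odot> x) (q k j y)"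
      by (rule adj[OF that])
    also have "\<dots> = cinner x (star a \<odot> P (\<delta> j y) k)"
      by (simp add: q_def cinner_act_star)
    also have "\<dots> = ip (\<delta> k x) (\<lambda>e. star a \<odot> P (\<delta> j y) e)"
      by (simp add: ip_\<delta> that)
    also have "\<dots> = ip (P (\<delta> k x)) (\<lambda>e. star a \<odot> P (\<delta> j y) e)"
      by (intro P(2) M_act P(1))
    also have "\<dots> = cnj (ip (P (\<delta> j y)) (\<lambda>e. a \<odot> P (\<delta> k x) e))"
      by (subst ip_commute) (simp add: ip_act star_star)
    also have "\<dots> = cnj (ip (\<delta> j y) (\<lambda>e. a \<odot> P (\<delta> k x) e))"
      by (subst P(2)[OF M_act[OF P(1)], symmetric]) simp
    also have "\<dots> = cinner (a \<odot> q j k x) y"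
      by (simp add: ip_\<delta> that q_def cinner_commute[of y])
    finally show "cinner (q j k (a \<odot> x)) y = cinner (a \<odot> q j k x) y" .
  qed
  have bound: "norm (q j k x) \<le> norm x" if j: "j \<in> E" and k: "k \<in> E" for j k x
  proof -
    have le: "(norm (q j k x))\<^sup>2 \<le> norm x * norm (q k k x)" if "j \<in> E" for j
    proof -
      have "(norm (q j k x))\<^sup>2 \<le> (\<Sum>e\<in>E. (norm (P (\<delta> k x) e))\<^sup>2)"
        unfolding q_def using fin that by (intro member_le_sum) auto
      also have "\<dots> = Re (ip (P (\<delta> k x)) (P (\<delta> k x)))"
        by (simp add: ip_def Re_cinner_self)
      also have "\<dots> = Re (cinner x (q k k x))"
        by (simp add: P(2)[OF P(1), symmetric] ip_\<delta> k q_def)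
      also have "\<dots> \<le> norm x * norm (q k k x)" by (rule Cauchy_Schwarz_Re)
      finally show ?thesis .
    qed
    have kk: "norm (q k k x) \<le> norm x"
      using le[OF k] by (cases "q k k x = 0") (simp_all add: power2_eq_square)
    have "(norm (q j k x))\<^sup>2 \<le> (norm x)\<^sup>2"
      using le[OF j] mult_left_mono[OF kk, of "norm x"] by (simp add: power2_eq_square)
    then show ?thesis by simp
  qed
  have scalar: "\<exists>c. \<forall>x. q j k x = c *\<^sub>C x" if "j \<in> E" "k \<in> E" for j k
    by (rule Schur[of "q j k" "q k j"]) (simp_all add: adj comm bound that)
  have q0: "q i k x = 0" if i: "i \<in> E" and k: "k \<in> E" for i k x
  proof -
    have "\<forall>j\<in>E. \<exists>c. \<forall>x. q j k x = c *\<^sub>C x" using scalar k by blast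
    then obtain c where c: "\<And>j x. j \<in> E \<Longrightarrow> q j k x = c j *\<^sub>C x" by metis
    have "ip (\<lambda>e. 1 \<odot> e) (P (\<delta> k i)) = 0" using P(1)[of "\<delta> k i"] by (simp only: M_def mem_Collect_eq)
    then have "0 = (\<Sum>e\<in>E. cinner e (q e k i))" by (simp add: ip_def q_def)
    also have "\<dots> = (\<Sum>e\<in>E. if e = i then cnj (c i) else 0)"
      using E i by (intro sum.cong) (auto simp: c cinner_simps cinner.orthonormal_def)
    also have "\<dots> = cnj (c i)" using fin i by simp
    finally show ?thesis using c[OF i] by (simp add: scaleC_simps)
  qed
  have "f \<in> M" using f by (simp add: M_def ip_def)
  then have "cinner (f k) (f k) = ip (P (\<delta> k (f k))) f"
    using P(2)[of f "\<delta> k (f k)"] by (simp add: ip_\<delta> k)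
  also have "\<dots> = (\<Sum>e\<in>E. cinner (q e k (f k)) (f e))" by (simp add: ip_def q_def)
  also have "\<dots> = 0" by (simp add: q0 k)
  finally show ?thesis using Re_cinner_self[of "f k"] by simp
qed

text \<open>An operator and its adjoint on a finite-dimensional subspace are approximated simultaneously.
  Since \<open>a \<mapsto> a\<^sup>*\<close> is not complex linear, the pairs \<open>(a e, a\<^sup>* e)\<^sub>e\<close> form only a real subspace \<open>L\<close>. A functional
  vanishing on \<open>L\<close> has the form \<open>a \<mapsto> Re \<Sum> \<langle>a e, \<alpha> e\<rangle> + \<langle>a (\<beta> e), e\<rangle>\<close>, and by density it vanishes also on the operator
  \<open>v\<close>.\<close>

lemma star_approximation:
  assumes E: "cinner.orthonormal E" and \<epsilon>: "0 < \<epsilon>"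
    and adj: "\<And>e f. e \<in> E \<Longrightarrow> f \<in> E \<Longrightarrow> cinner (v e) f = cinner e (v' f)"
    and v': "\<And>e. e \<in> E \<Longrightarrow> v' e \<in> complex_vector.span E"
  obtains a where "\<And>e. e \<in> E \<Longrightarrow> norm (a \<odot> e - v e) < \<epsilon>"
    "\<And>e. e \<in> E \<Longrightarrow> norm (star a \<odot> e - v' e) < \<epsilon>"
proof -
  have fin: "finite E" using E by (simp add: cinner.orthonormal_def)
  define I where "I = E \<times> (UNIV :: bool set)"
  have finI: "finite I" using fin by (simp add: I_def)
  have sum_I: "(\<Sum>i\<in>I. h i) = (\<Sum>e\<in>E. h (e, True) + h (e, False))" for h :: "'h \<times> bool \<Rightarrow> real"
  proof -
    have "(\<Sum>i\<in>I. h i) = (\<Sum>e\<in>E. \<Sum>b\<in>UNIV. h (e, b))"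
      unfolding I_def by (simp add: sum.cartesian_product)
    then show ?thesis by (simp add: UNIV_bool add.commute)
  qed
  define F where "F a = (\<lambda>(e, b). if b then a \<odot> e else star a \<odot> e)" for a
  have F_add: "(\<lambda>i. F a i + r *\<^sub>R F b i) = F (a + r *\<^sub>R b)" for a b r
    by (auto simp: F_def fun_eq_iff act_left star_simps)
  have lin: "(\<lambda>i. f i + r *\<^sub>R g i) \<in> range F" if "f \<in> range F" "g \<in> range F" for f g r
    using that F_add by auto
  define V where "V = (\<lambda>(e, b). if b then v e else v' e)"
  obtain m where m: "\<And>e. 0 < e \<Longrightarrow> \<exists>l\<in>range F. \<forall>i\<in>I. norm (V i - m i - l i) < e"
    "\<And>l. l \<in> range F \<Longrightarrow> (\<Sum>i\<in>I. Re (cinner (m i) (l i))) = 0"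
    using projection_family[OF finI _ lin, of V] by blast
  define \<alpha> \<beta> where "\<alpha> e = m (e, True)" and "\<beta> e = m (e, False)" for e
  have \<omega>: "(\<Sum>e\<in>E. cinner (a \<odot> e) (\<alpha> e) + cinner (a \<odot> \<beta> e) e) = 0" for a
  proof -
    define \<omega> where "\<omega> a = (\<Sum>e\<in>E. cinner (a \<odot> e) (\<alpha> e) + cinner (a \<odot> \<beta> e) e)" for a
    have Re0: "Re (\<omega> a) = 0" for a
    proof -
      have "0 = (\<Sum>i\<in>I. Re (cinner (m i) (F a i)))" using m(2) by simp
      also have "\<dots> = Re (\<omega> a)"
        by (simp add: sum_I \<omega>_def F_def \<alpha>_def \<beta>_def cinner_act_star[of a "m (_, False)"]
            Re_cinner_commute[of "a \<odot> _"] del: sum.distrib)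
      finally show ?thesis by simp
    qed
    have "\<omega> (\<i> *\<^sub>C a) = \<i> * \<omega> a"
      by (simp add: \<omega>_def act_left cinner_simps sum_distrib_left algebra_simps)
    then have "Im (\<omega> a) = 0" using Re0[of "\<i> *\<^sub>C a"] by simp
    then show ?thesis using Re0[of a] by (simp add: \<omega>_def[symmetric] complex_eq_iff)
  qed
  obtain E' where E': "cinner.orthonormal E'" "complex_vector.span E' = complex_vector.span (E \<union> \<beta> ` E)"
    using orthonormal_basis_exists[of "E \<union> \<beta> ` E"] fin by auto
  have span: "e \<in> complex_vector.span E'" "\<beta> e \<in> complex_vector.span E'" if "e \<in> E" for e
    unfolding E'(2) using that by (auto intro: complex_vector.span_base)
  define \<theta> where "\<theta> k = (\<Sum>e\<in>E. cnj (cinner e k) *\<^sub>C \<alpha> e + cnj (cinner (\<beta> e) k) *\<^sub>C e)" for k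
  have \<theta>: "(\<Sum>k\<in>E'. cinner (h k) (\<theta> k)) = (\<Sum>e\<in>E. cinner (h e) (\<alpha> e) + cinner (h (\<beta> e)) e)"
    if h: "\<And>x. x \<in> complex_vector.span E' \<Longrightarrow> h x = (\<Sum>k\<in>E'. cinner x k *\<^sub>C h k)" for h
  proof -
    have "(\<Sum>k\<in>E'. cinner (h k) (\<theta> k))
        = (\<Sum>e\<in>E. \<Sum>k\<in>E'. cinner e k * cinner (h k) (\<alpha> e) + cinner (\<beta> e) k * cinner (h k) e)"
      unfolding \<theta>_def cinner_sum_right
      by (subst sum.swap) (simp add: cinner_add_right cinner_scaleC_right)
    also have "\<dots> = (\<Sum>e\<in>E. cinner (h e) (\<alpha> e) + cinner (h (\<beta> e)) e)"
      using h[OF span(1)] h[OF span(2)]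
      by (intro sum.cong refl) (simp add: cinner_sum_left cinner_scaleC_left sum.distrib)
    finally show ?thesis .
  qed
  have expand: "x = (\<Sum>k\<in>E'. cinner x k *\<^sub>C k)" if "x \<in> complex_vector.span E'" for x
    using cinner.orthonormal_expansion[OF E'(1) that] .
  have "\<theta> k = 0" if "k \<in> E'" for k
  proof (rule density[OF E'(1) _ that])
    fix a
    have "a \<odot> x = (\<Sum>k\<in>E'. cinner x k *\<^sub>C (a \<odot> k))" if "x \<in> complex_vector.span E'" for x
      by (subst expand[OF that]) (simp add: act_right)
    then show "(\<Sum>e\<in>E'. cinner (a \<odot> e) (\<theta> e)) = 0" by (simp add: \<theta> \<omega>)
  qed
  then have zero: "(\<Sum>k\<in>E'. cinner (h k) (\<theta> k)) = 0" for h by simp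
  define u where "u x = (\<Sum>f\<in>E. cinner x f *\<^sub>C v f)" for x
  have u_expand: "u x = (\<Sum>k\<in>E'. cinner x k *\<^sub>C u k)" if "x \<in> complex_vector.span E'" for x
  proof -
    have "u x = (\<Sum>f\<in>E. (\<Sum>k\<in>E'. cinner x k * cinner k f) *\<^sub>C v f)"
      unfolding u_def by (intro sum.cong refl arg_cong2[where f = scaleC], subst expand[OF that])
        (simp add: cinner_sum_left cinner_scaleC_left)
    also have "\<dots> = (\<Sum>k\<in>E'. cinner x k *\<^sub>C u k)"
      unfolding u_def complex_vector.scale_sum_left complex_vector.scale_sum_right
      by (subst sum.swap) (simp add: scaleC_scaleC)
    finally show ?thesis .
  qed
  have u_e: "u e = v e" if "e \<in> E" for e
  proof -
    have "u e = (\<Sum>f\<in>E. if f = e then v e else 0)"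
      unfolding u_def using E that
      by (intro sum.cong) (auto simp: cinner.orthonormal_def scaleC_one scaleC_simps)
    then show ?thesis using fin that by simp
  qed
  have u_\<beta>: "cinner (u x) e = cinner x (v' e)" if "e \<in> E" for x e
  proof -
    have "cinner (u x) e = (\<Sum>f\<in>E. cinner x f * cinner f (v' e))"
      by (simp add: u_def cinner_sum_left cinner_scaleC_left adj that)
    also have "\<dots> = cinner x (\<Sum>f\<in>E. cinner (v' e) f *\<^sub>C f)"
      unfolding cinner_sum_right cinner_scaleC_right
      by (intro sum.cong refl) (metis cinner_commute mult.commute)
    finally show ?thesis using cinner.orthonormal_expansion[OF E v'[OF that]] by simp
  qed
  have "0 = (\<Sum>e\<in>E. cinner (v e) (\<alpha> e) + cinner (\<beta> e) (v' e))"
    using \<theta>[of u, OF u_expand] by (simp add: zero u_e u_\<beta>)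
  then have "0 = Re (\<Sum>e\<in>E. cinner (v e) (\<alpha> e) + cinner (\<beta> e) (v' e))" by (metis zero_complex.sel(1))
  also have "\<dots> = (\<Sum>i\<in>I. Re (cinner (m i) (V i)))"
    unfolding sum_I V_def \<alpha>_def \<beta>_def Re_sum
    by (intro sum.cong refl) (simp add: Re_cinner_commute[of "v _"])
  finally have mV: "(\<Sum>i\<in>I. Re (cinner (m i) (V i))) = 0" by simp
  define K where "K = (\<Sum>i\<in>I. norm (m i))"
  have K: "0 \<le> K" by (simp add: K_def sum_nonneg)
  have "(\<Sum>i\<in>I. (norm (m i))\<^sup>2) \<le> 0"
  proof (rule field_le_epsilon)
    fix d :: real assume d: "0 < d"
    then obtain l where l: "l \<in> range F" "\<And>i. i \<in> I \<Longrightarrow> norm (V i - m i - l i) < d / (K + 1)"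
      using m(1)[of "d / (K + 1)"] K by auto
    have "(\<Sum>i\<in>I. (norm (m i))\<^sup>2)
        = (\<Sum>i\<in>I. Re (cinner (m i) (V i)) - Re (cinner (m i) (l i)) - Re (cinner (m i) (V i - m i - l i)))"
      by (intro sum.cong refl) (simp add: cinner_simps Re_cinner_self)
    also have "\<dots> = (\<Sum>i\<in>I. Re (cinner (m i) (- (V i - m i - l i))))"
      using mV m(2)[OF l(1)]
      by (simp add: sum_subtractf cinner_minus_right sum_negf del: minus_diff_eq)
    also have "\<dots> \<le> (\<Sum>i\<in>I. norm (m i) * (d / (K + 1)))"
    proof (rule sum_mono)
      fix i assume "i \<in> I"
      then have "norm (- (V i - m i - l i)) \<le> d / (K + 1)"
        unfolding norm_minus_cancel by (intro less_imp_le l(2))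
      then show "Re (cinner (m i) (- (V i - m i - l i))) \<le> norm (m i) * (d / (K + 1))"
        by (intro order.trans[OF Cauchy_Schwarz_Re] mult_left_mono norm_ge_zero)
    qed
    also have "\<dots> = K * d / (K + 1)" by (simp add: K_def sum_distrib_right sum_divide_distrib)
    also have "\<dots> \<le> 0 + d" using K d by (simp add: field_simps)
    finally show "(\<Sum>i\<in>I. (norm (m i))\<^sup>2) \<le> 0 + d" .
  qed
  then have m0: "m i = 0" if "i \<in> I" for i
    using member_le_sum[OF that, of "\<lambda>i. (norm (m i))\<^sup>2"] finI
    by (smt (verit) zero_le_power2 zero_eq_power2 norm_eq_zero)
  obtain a where a: "\<And>i. i \<in> I \<Longrightarrow> norm (V i - F a i) < \<epsilon>"
    using m(1)[OF \<epsilon>] m0 by auto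
  show ?thesis
  proof (rule that[of a])
    fix e assume "e \<in> E"
    then show "norm (a \<odot> e - v e) < \<epsilon>" "norm (star a \<odot> e - v' e) < \<epsilon>"
      using a[of "(e, True)"] a[of "(e, False)"] by (simp_all add: I_def V_def F_def norm_minus_commute)
  qed
qed

section \<open>Contractions close to a unitary on a subspace\<close>

text \<open>A Neumann series, so that the inverse remains in any closed subalgebra that contains \<open>h\<close>.\<close>

lemma inverse_of_bounded_below:
  assumes sa: "star h = h" and \<delta>: "0 < \<delta>" "\<And>x. \<delta> * (norm x)\<^sup>2 \<le> Re (cinner (h \<odot> x) x)"
    and Z: "unital_cstar_subalgebra Z" "h \<in> Z"
  obtains g where "g * h = 1" "h * g = 1" "g \<in> Z" "star g = g"
proof -
  define R where "R = norm h + 1"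
  have R: "0 < R" by (simp add: R_def add_nonneg_pos)
  define k where "k = 1 - (1 / R) *\<^sub>R h"
  have k_form: "Re (cinner (k \<odot> x) x) = (norm x)\<^sup>2 - (1 / R) * Re (cinner (h \<odot> x) x)" for x
    by (simp add: k_def act_left cinner_simps Re_cinner_self)
  have k_pos: "0 \<le> Re (cinner (k \<odot> x) x)" for x
  proof -
    have "Re (cinner (h \<odot> x) x) \<le> norm (h \<odot> x) * norm x" by (rule Cauchy_Schwarz_Re)
    also have "\<dots> \<le> (norm h * norm x) * norm x" by (intro mult_right_mono norm_act_le) simp
    also have "\<dots> \<le> R * (norm x)\<^sup>2" by (simp add: R_def power2_eq_square algebra_simps)
    finally show ?thesis using R by (simp add: k_form field_simps)
  qed
  have k_le: "Re (cinner (k \<odot> x) x) \<le> (1 - \<delta> / R) * (norm x)\<^sup>2" for x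
    using \<delta>(2)[of x] R by (simp add: k_form field_simps)
  have sk: "star k = k" by (simp add: k_def star_simps sa)
  obtain x0 :: 'h where "x0 \<noteq> 0" using Hilbert_space_nontrivial by blast
  then have r: "0 \<le> 1 - \<delta> / R"
    using k_pos[of x0] k_le[of x0] by (smt (verit) mult_neg_pos zero_less_norm_iff zero_less_power)
  have "norm (k \<odot> x) \<le> (1 - \<delta> / R) * norm x" for x
    by (rule norm_le_of_form_le[OF _ k_pos k_le]) (metis cinner_act_star sk)
  then have "norm k \<le> 1 - \<delta> / R" by (rule norm_le_of_act_le[OF r])
  also have "\<dots> < 1" using \<delta> R by simp
  finally have sm: "summable (\<lambda>n. k ^ n)" by (rule complete_algebra_summable_geometric)
  define G where "G = (\<Sum>n. k ^ n)"
  have tail: "(\<Sum>n. k ^ Suc n) = G - 1"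
    using suminf_split_head[OF sm] by (simp add: G_def)
  have "k * G = (\<Sum>n. k ^ Suc n)"
    unfolding G_def power_Suc by (rule suminf_mult[OF sm, symmetric])
  then have kG: "k * G = G - 1" by (simp only: tail)
  have "G * k = (\<Sum>n. k ^ Suc n)"
    unfolding G_def power_Suc2 by (rule suminf_mult2[OF sm])
  then have Gk: "G * k = G - 1" by (simp only: tail)
  have h: "h = R *\<^sub>R (1 - k)" using R by (simp add: k_def)
  have subZ: "complex_vector.subspace Z" "1 \<in> Z" "\<And>x y. x \<in> Z \<Longrightarrow> y \<in> Z \<Longrightarrow> x * y \<in> Z" "closed Z"
    using Z(1) by (auto simp: unital_cstar_subalgebra_def)
  have scaleR_Z: "r *\<^sub>R x \<in> Z" if "x \<in> Z" for r x
    using complex_vector.subspace_scale[OF subZ(1) that] by (simp add: scaleR_scaleC)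
  have kZ: "k \<in> Z"
    unfolding k_def by (intro complex_vector.subspace_diff subZ scaleR_Z Z(2))
  have "k ^ n \<in> Z" for n by (induction n) (simp_all add: subZ kZ)
  then have "(\<Sum>i<n. k ^ i) \<in> Z" for n by (intro complex_vector.subspace_sum subZ(1))
  then have GZ: "G \<in> Z"
    using closed_sequentially[OF subZ(4) _ summable_LIMSEQ[OF sm]] by (simp add: G_def)
  define g where "g = (1 / R) *\<^sub>R G"
  have gh: "g * h = 1" "h * g = 1"
    using R by (simp_all add: g_def h left_diff_distrib right_diff_distrib kG Gk flip: scaleR_diff_right)
  have "star g * h = 1" by (metis gh(2) sa star_mult star_one)
  then have "star g = g" by (metis gh(2) mult.assoc mult_1_left mult_1_right)
  moreover have "g \<in> Z" unfolding g_def by (intro scaleR_Z GZ)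
  ultimately show ?thesis using that gh by blast
qed

lemma unital_cstar_subalgebra_UNIV: "unital_cstar_subalgebra (UNIV :: 'b set)"
  by (simp add: unital_cstar_subalgebra_def complex_vector.subspace_UNIV)

text \<open>Kaplansky's device: \<open>W = 2 y (1 + y\<^sup>* y)\<^sup>-\<^sup>1\<close> is a contraction since \<open>2 t / (1 + t\<^sup>2) \<le> 1\<close>, and where \<open>y \<xi> = \<eta>\<close> and
  \<open>y\<^sup>* \<eta> = \<xi>\<close>, also \<open>W \<xi> = \<eta>\<close> and \<open>W\<^sup>* \<eta> = \<xi>\<close>. It is essential that the error bounds do not involve the norm of
  \<open>y\<close>, over which there is no control.\<close>

lemma contraction_from_operator:
  fixes y :: 'b
  obtains W where "norm W \<le> 1" "\<And>z. z * y = y * z \<Longrightarrow> z * star y = star y * z \<Longrightarrow> z * W = W * z"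
    "\<And>\<xi> \<eta>. norm (W \<odot> \<xi> - \<eta>) \<le> norm (y \<odot> \<xi> - \<eta>) + norm (star y \<odot> \<eta> - \<xi>)"
    "\<And>\<xi> \<eta>. norm (star W \<odot> \<eta> - \<xi>) \<le> norm (y \<odot> \<xi> - \<eta>) + norm (star y \<odot> \<eta> - \<xi>)"
proof -
  have inv: "\<exists>g. g * (1 + star y * y) = 1 \<and> (1 + star y * y) * g = 1 \<and> star g = g" for y :: 'b
  proof -
    have "1 * (norm x)\<^sup>2 \<le> Re (cinner ((1 + star y * y) \<odot> x) x)" for x
      by (simp add: act_add_left cinner_add_left Re_cinner_self Re_cinner_star_mult)
    then show ?thesis
      using inverse_of_bounded_below[of "1 + star y * y" 1 UNIV] unital_cstar_subalgebra_UNIV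
      by (auto simp: star_simps)
  qed
  have est: "norm (g \<odot> x) \<le> norm x" "norm (y \<odot> g \<odot> x) \<le> (1/2) * norm x"
    if g: "(1 + star y * y) * g = 1" for g y x
  proof -
    define \<zeta> where "\<zeta> = g \<odot> x"
    have x: "x = \<zeta> + star y \<odot> y \<odot> \<zeta>"
      using arg_cong[OF g, of "\<lambda>a. a \<odot> x"] by (simp add: \<zeta>_def act_left)
    have yy: "(norm (y \<odot> \<zeta>))\<^sup>2 = Re (cinner \<zeta> (star y \<odot> y \<odot> \<zeta>))"
      by (subst Re_cinner_commute) (simp flip: Re_cinner_star_mult add: act_mult)
    have sq: "(norm x)\<^sup>2 = (norm \<zeta>)\<^sup>2 + 2 * (norm (y \<odot> \<zeta>))\<^sup>2 + (norm (star y \<odot> y \<odot> \<zeta>))\<^sup>2"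
      by (subst x) (simp only: norm_add_square yy)
    have "(norm \<zeta>)\<^sup>2 \<le> (norm x)\<^sup>2" using sq by simp
    then show "norm (g \<odot> x) \<le> norm x" by (simp add: \<zeta>_def)
    have "(norm (y \<odot> \<zeta>))\<^sup>2 \<le> norm \<zeta> * norm (star y \<odot> y \<odot> \<zeta>)"
      unfolding yy by (rule Cauchy_Schwarz_Re)
    moreover have "0 \<le> (norm \<zeta> - norm (star y \<odot> y \<odot> \<zeta>))\<^sup>2" by simp
    ultimately have "(2 * norm (y \<odot> \<zeta>))\<^sup>2 \<le> (norm x)\<^sup>2"
      unfolding sq by (simp add: power2_diff power_mult_distrib)
    then have "2 * norm (y \<odot> \<zeta>) \<le> norm x" by (rule power2_le_imp_le) simp
    then show "norm (y \<odot> g \<odot> x) \<le> (1/2) * norm x" by (simp add: \<zeta>_def)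
  qed
  have approx: "norm ((2 *\<^sub>R (g * star y)) \<odot> \<eta> - \<xi>) \<le> norm (star y \<odot> \<eta> - \<xi>) + norm (y \<odot> \<xi> - \<eta>)"
    if g: "g * (1 + star y * y) = 1" "(1 + star y * y) * g = 1" "star g = g" for g y \<xi> \<eta>
  proof -
    have gy: "norm (g \<odot> star y \<odot> x) \<le> (1/2) * norm x" for x
      using norm_star_act_le[of "y * g" "1/2" x] est(2)[OF g(2)] by (simp add: act_mult star_mult g(3))
    have "\<xi> = g \<odot> \<xi> + g \<odot> star y \<odot> y \<odot> \<xi>"
      using arg_cong[OF g(1), of "\<lambda>a. a \<odot> \<xi>"] by (simp add: act_left act_right)
    then have "(2 *\<^sub>R (g * star y)) \<odot> \<eta> - \<xi> = g \<odot> (star y \<odot> \<eta> - \<xi>) + g \<odot> star y \<odot> (\<eta> - y \<odot> \<xi>)"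
      by (simp add: act_left act_right scaleR_2 algebra_simps)
    then have "norm ((2 *\<^sub>R (g * star y)) \<odot> \<eta> - \<xi>)
        \<le> norm (g \<odot> (star y \<odot> \<eta> - \<xi>)) + norm (g \<odot> star y \<odot> (\<eta> - y \<odot> \<xi>))"
      by (simp only: norm_triangle_ineq)
    also have "\<dots> \<le> norm (star y \<odot> \<eta> - \<xi>) + (1/2) * norm (\<eta> - y \<odot> \<xi>)"
      by (intro add_mono est[OF g(2)] gy)
    finally show ?thesis using norm_ge_zero[of "\<eta> - y \<odot> \<xi>"]
      unfolding norm_minus_commute[of \<eta>] by linarith
  qed
  obtain g where g: "g * (1 + star y * y) = 1" "(1 + star y * y) * g = 1" "star g = g"
    using inv by blast
  obtain g' where g': "g' * (1 + star (star y) * star y) = 1" "(1 + star (star y) * star y) * g' = 1" "star g' = g'"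
    using inv by blast
  define W where "W = 2 *\<^sub>R (y * g)"
  have sW: "star W = 2 *\<^sub>R (g * star y)" by (simp add: W_def star_simps g(3))
  \<comment> \<open>The inverses for \<open>y\<close> and \<open>y\<^sup>*\<close> are related by \<open>y g = g' y\<close>, so the estimate for \<open>W\<^sup>*\<close> also applies to \<open>W\<close>.\<close>
  have "(1 + y * star y) * y = y * (1 + star y * y)" by (simp add: algebra_simps)
  then have "g' * (1 + y * star y) * y * g = g' * y * ((1 + star y * y) * g)"
    by (simp only: mult.assoc)
  then have W': "W = 2 *\<^sub>R (g' * star (star y))"
    using g' g by (simp add: W_def star_star)
  show ?thesis
  proof (rule that[of W])
    show "norm W \<le> 1"
      by (rule norm_le_of_act_le)
        (use est(2)[OF g(2)] in \<open>simp_all add: W_def act_left mult.commute\<close>)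
    show "norm (star W \<odot> \<eta> - \<xi>) \<le> norm (y \<odot> \<xi> - \<eta>) + norm (star y \<odot> \<eta> - \<xi>)" for \<xi> \<eta>
      using approx[OF g, of \<eta> \<xi>] by (simp add: sW)
    show "norm (W \<odot> \<xi> - \<eta>) \<le> norm (y \<odot> \<xi> - \<eta>) + norm (star y \<odot> \<eta> - \<xi>)" for \<xi> \<eta>
      using approx[OF g', of \<xi> \<eta>] by (simp only: W' star_star)
    show "z * W = W * z" if z: "z * y = y * z" "z * star y = star y * z" for z
    proof -
      have "z * (star y * y) = (star y * y) * z"
        using z by (metis mult.assoc)
      then have "z * (1 + star y * y) = (1 + star y * y) * z" by (simp add: algebra_simps)
      then have "g * (z * (1 + star y * y)) * g = g * ((1 + star y * y) * z) * g" by simp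
      then have "(g * z) * ((1 + star y * y) * g) = (g * (1 + star y * y)) * (z * g)"
        by (simp only: mult.assoc)
      then have "g * z = z * g" using g by simp
      then have "y * (g * z) = (y * z) * g" by (simp add: mult.assoc)
      then show ?thesis by (simp add: W_def mult.assoc z(1)[symmetric])
    qed
  qed
qed

end

section \<open>Finite-dimensional subalgebras\<close>

context faithful_irreducible
begin

text \<open>Finitely many vectors separate the elements of a finite-dimensional space of operators.\<close>

lemma separating_vectors_span:
  assumes "finite S"
  shows "\<exists>X. finite X \<and> (\<forall>a\<in>complex_vector.span S. (\<forall>x\<in>X. a \<odot> x = 0) \<longrightarrow> a = 0)"
  using assms
proof (induction S rule: finite_induct)
  case empty
  then show ?case by (intro exI[of _ "{}"]) simp
next
  case (insert s S)
  then obtain X where X: "finite X" "\<And>a. a \<in> complex_vector.span S \<Longrightarrow> \<forall>x\<in>X. a \<odot> x = 0 \<Longrightarrow> a = 0"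
    by blast
  show ?case
  proof (cases "\<exists>y\<in>complex_vector.span S. s - y \<noteq> 0 \<and> (\<forall>x\<in>X. (s - y) \<odot> x = 0)")
    case True
    then obtain y where y: "y \<in> complex_vector.span S" "s - y \<noteq> 0" "\<And>x. x \<in> X \<Longrightarrow> (s - y) \<odot> x = 0"
      by blast
    have "\<not> (\<forall>\<xi>. (s - y) \<odot> \<xi> = 0 \<odot> \<xi>)" using act_inject[of "s - y" 0] y(2) by blast
    then obtain \<xi> where \<xi>: "(s - y) \<odot> \<xi> \<noteq> 0" by auto
    have "a = 0" if a: "a \<in> complex_vector.span (insert s S)" and z: "\<forall>x\<in>insert \<xi> X. a \<odot> x = 0" for a
    proof -
      obtain k where k: "a - k *\<^sub>C s \<in> complex_vector.span S"
        using a complex_vector.span_breakdown_eq by blast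
      have "a - k *\<^sub>C (s - y) = (a - k *\<^sub>C s) + k *\<^sub>C y"
        by (simp add: complex_vector.scale_right_diff_distrib)
      also have "\<dots> \<in> complex_vector.span S"
        by (intro complex_vector.span_add complex_vector.span_scale k y)
      finally have "a - k *\<^sub>C (s - y) = 0"
        by (rule X(2)) (use z y(3) in \<open>simp add: act_diff_left act_scaleC_left scaleC_simps\<close>)
      then have ak: "a = k *\<^sub>C (s - y)" by simp
      have "a \<odot> \<xi> = 0" using z by simp
      then have "k *\<^sub>C ((s - y) \<odot> \<xi>) = 0" by (simp only: ak act_scaleC_left)
      then show "a = 0" using \<xi> ak by simp
    qed
    then show ?thesis using X(1) by (intro exI[of _ "insert \<xi> X"]) blast
  next
    case False
    have "a = 0" if a: "a \<in> complex_vector.span (insert s S)" and z: "\<forall>x\<in>X. a \<odot> x = 0" for a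
    proof -
      obtain k where k: "a - k *\<^sub>C s \<in> complex_vector.span S"
        using a complex_vector.span_breakdown_eq by blast
      show ?thesis
      proof (cases "k = 0")
        case True
        then show ?thesis using X(2)[of a] k z by simp
      next
        case k0: False
        define y where "y = - (inverse k *\<^sub>C (a - k *\<^sub>C s))"
        have "y \<in> complex_vector.span S"
          unfolding y_def by (intro complex_vector.span_neg complex_vector.span_scale k)
        moreover have sy: "s - y = inverse k *\<^sub>C a"
          using k0 by (simp add: y_def complex_vector.scale_right_diff_distrib scaleC_scaleC scaleC_one)
        moreover have "\<forall>x\<in>X. (s - y) \<odot> x = 0"
          unfolding sy using z by (simp add: act_scaleC_left)
        ultimately have "s - y = 0" using False by blast
        then show ?thesis using k0 by (simp add: sy)
      qed
    qed
    then show ?thesis using X(1) by blast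
  qed
qed

text \<open>The Hilbert--Schmidt inner product of the operators restricted to the span of \<open>E\<close>.\<close>

definition hs_form :: "'h set \<Rightarrow> 'b \<Rightarrow> 'b \<Rightarrow> complex" where
  "hs_form E a b = (\<Sum>e\<in>E. cinner (a \<odot> e) (b \<odot> e))"

lemma positive_form_hs: "positive_form (hs_form E)"
proof
  show "hs_form E x y = cnj (hs_form E y x)" for x y
    unfolding hs_form_def cnj_sum by (intro sum.cong refl cinner_commute)
qed (simp_all add: hs_form_def act_left cinner_simps sum.distrib sum_distrib_left Re_cinner_self sum_nonneg)

lemma hs_form_mult: "hs_form E (c * a) b = hs_form E a (star c * b)"
  by (simp add: hs_form_def act_mult cinner_act_star)

end

text \<open>A finite-dimensional unital C*-subalgebra \<open>F\<close> of the represented algebra.\<close>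

locale finite_dimensional_subalgebra = faithful_irreducible \<pi>
  for \<pi> :: "'b::unital_cstar_algebra \<Rightarrow> 'h::chilbert_space \<Rightarrow>\<^sub>L 'h" +
  fixes F :: "'b set"
  assumes subalgebra: "unital_cstar_subalgebra F" and finite_dim: "finite_dimensional F"
begin

lemma F_subspace: "complex_vector.subspace F"
  and F_one: "1 \<in> F"
  and F_mult: "x \<in> F \<Longrightarrow> y \<in> F \<Longrightarrow> x * y \<in> F"
  and F_star: "x \<in> F \<Longrightarrow> star x \<in> F"
  using subalgebra by (auto simp: unital_cstar_subalgebra_def)

lemma separating_vectors:
  obtains X where "finite X" "\<And>a. a \<in> F \<Longrightarrow> (\<And>x. x \<in> X \<Longrightarrow> a \<odot> x = 0) \<Longrightarrow> a = 0"
proof -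
  obtain S where S: "finite S" "F \<subseteq> complex_vector.span S"
    using finite_dim by (auto simp: finite_dimensional_def)
  obtain X where X: "finite X" "\<forall>a\<in>complex_vector.span S. (\<forall>x\<in>X. a \<odot> x = 0) \<longrightarrow> a = 0"
    using separating_vectors_span[OF S(1)] by blast
  show ?thesis
  proof (rule that[OF X(1)])
    show "a = 0" if "a \<in> F" "\<And>x. x \<in> X \<Longrightarrow> a \<odot> x = 0" for a
      using X(2) S(2) that by blast
  qed
qed

lemma finite_spanning_set:
  obtains B where "finite B" "B \<subseteq> F" "complex_vector.span B = F"
proof -
  obtain S where S: "finite S" "F \<subseteq> complex_vector.span S"
    using finite_dim by (auto simp: finite_dimensional_def)
  obtain B where B: "B \<subseteq> F" "complex_vector.independent B" "F \<subseteq> complex_vector.span B"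
    by (rule complex_vector.maximal_independent_subset)
  have "finite B"
    using complex_vector.independent_span_bound[OF S(1) B(2)] B(1) S(2) by blast
  moreover have "complex_vector.span B = F"
    using B complex_vector.span_minimal[OF B(1) F_subspace] by blast
  ultimately show ?thesis using that B(1) by blast
qed

text \<open>\<open>F\<close> acts faithfully on the span of \<open>E\<close>, so that \<open>hs_form E\<close> is definite on \<open>F\<close>.\<close>

definition separating :: "'h set \<Rightarrow> bool" where
  "separating E \<longleftrightarrow> (\<forall>a\<in>F. (\<forall>e\<in>E. a \<odot> e = 0) \<longrightarrow> a = 0)"

lemma hs_basis:
  assumes fin: "finite E" and sep: "separating E"
  obtains A where "finite A" "A \<subseteq> F"
    "\<And>c. c \<in> F \<Longrightarrow> c = (\<Sum>a\<in>A. hs_form E c a *\<^sub>C a)"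
proof -
  interpret hs: positive_form "hs_form E" by (rule positive_form_hs)
  obtain B where B: "finite B" "B \<subseteq> F" "complex_vector.span B = F" by (rule finite_spanning_set)
  have "\<exists>A. hs.orthonormal A \<and> complex_vector.span A = complex_vector.span B"
  proof (rule hs.Gram_Schmidt[OF B(1)])
    fix x assume x: "x \<in> complex_vector.span B" "hs_form E x x = 0"
    have "(\<Sum>e\<in>E. (norm (x \<odot> e))\<^sup>2) = Re (hs_form E x x)"
      by (simp add: hs_form_def Re_cinner_self)
    then have "(\<Sum>e\<in>E. (norm (x \<odot> e))\<^sup>2) = 0" by (simp add: x(2))
    then have "\<forall>e\<in>E. x \<odot> e = 0" using fin by (simp add: sum_nonneg_eq_0_iff)
    then show "x = 0" using sep x(1) B(3) by (auto simp: separating_def)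
  qed
  then obtain A where A: "hs.orthonormal A" "complex_vector.span A = F" using B(3) by auto
  show ?thesis
  proof (rule that[of A])
    show "finite A" using A(1) by (simp add: hs.orthonormal_def)
    show "A \<subseteq> F" using A(2) complex_vector.span_superset by blast
    show "c = (\<Sum>a\<in>A. hs_form E c a *\<^sub>C a)" if "c \<in> F" for c
      using hs.orthonormal_expansion[OF A(1)] that A(2) by blast
  qed
qed

text \<open>The tensor \<open>\<Sum> a \<otimes> a\<^sup>*\<close> over an orthonormal basis of \<open>F\<close> commutes with \<open>F\<close>. It is evaluated through a map \<open>\<beta>\<close>
  that is linear in its first and conjugate linear in its second argument, the latter standing for \<open>a\<^sup>*\<close>.\<close>

lemma Casimir:
  fixes \<beta> :: "'b \<Rightarrow> 'b \<Rightarrow> 'v::complex_vector"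
  assumes A: "finite A" "A \<subseteq> F" "\<And>c. c \<in> F \<Longrightarrow> c = (\<Sum>a\<in>A. hs_form E c a *\<^sub>C a)"
    and \<beta>: "\<And>x y z. \<beta> (x + y) z = \<beta> x z + \<beta> y z" "\<And>k x z. \<beta> (k *\<^sub>C x) z = k *\<^sub>C \<beta> x z"
      "\<And>x y z. \<beta> x (y + z) = \<beta> x y + \<beta> x z" "\<And>k x z. \<beta> x (k *\<^sub>C z) = cnj k *\<^sub>C \<beta> x z"
    and c: "c \<in> F"
  shows "(\<Sum>a\<in>A. \<beta> (c * a) a) = (\<Sum>a\<in>A. \<beta> a (star c * a))"
proof -
  interpret hs: positive_form "hs_form E" by (rule positive_form_hs)
  have zero: "\<beta> 0 z = 0" "\<beta> x 0 = 0" for x z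
    using \<beta>(2)[of 0 0 z] \<beta>(4)[of x 0 0] by (simp_all add: scaleC_simps)
  have sum1: "\<beta> (\<Sum>i\<in>J. u i) z = (\<Sum>i\<in>J. \<beta> (u i) z)" for u z and J :: "'b set"
    by (induction J rule: infinite_finite_induct) (simp_all add: zero \<beta>)
  have sum2: "\<beta> x (\<Sum>i\<in>J. u i) = (\<Sum>i\<in>J. \<beta> x (u i))" for u x and J :: "'b set"
    by (induction J rule: infinite_finite_induct) (simp_all add: zero \<beta>)
  have "(\<Sum>a\<in>A. \<beta> (c * a) a) = (\<Sum>a\<in>A. \<Sum>b\<in>A. hs_form E (c * a) b *\<^sub>C \<beta> b a)"
  proof (rule sum.cong[OF refl])
    fix a assume "a \<in> A"
    then have "c * a \<in> F" using c A(2) F_mult by blast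
    then have "\<beta> (c * a) a = \<beta> (\<Sum>b\<in>A. hs_form E (c * a) b *\<^sub>C b) a" using A(3) by simp
    then show "\<beta> (c * a) a = (\<Sum>b\<in>A. hs_form E (c * a) b *\<^sub>C \<beta> b a)" by (simp add: sum1 \<beta>)
  qed
  also have "\<dots> = (\<Sum>b\<in>A. \<Sum>a\<in>A. hs_form E (c * a) b *\<^sub>C \<beta> b a)" by (rule sum.swap)
  also have "\<dots> = (\<Sum>b\<in>A. \<beta> b (star c * b))"
  proof (rule sum.cong[OF refl])
    fix b assume "b \<in> A"
    then have "star c * b \<in> F" using c A(2) F_mult F_star by blast
    then have "\<beta> b (star c * b) = \<beta> b (\<Sum>a\<in>A. hs_form E (star c * b) a *\<^sub>C a)" using A(3) by simp
    also have "\<dots> = (\<Sum>a\<in>A. cnj (hs_form E (star c * b) a) *\<^sub>C \<beta> b a)" by (simp add: sum2 \<beta>)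
    also have "\<dots> = (\<Sum>a\<in>A. hs_form E (c * a) b *\<^sub>C \<beta> b a)"
      by (simp add: hs_form_mult hs.form_commute[of "star c * b", symmetric]
          hs.form_commute[of _ "star c * b"])
    finally show "(\<Sum>a\<in>A. hs_form E (c * a) b *\<^sub>C \<beta> b a) = \<beta> b (star c * b)" by simp
  qed
  finally show ?thesis .
qed

text \<open>A finite-dimensional \<open>F\<close>-invariant subspace \<open>K\<close> of the Hilbert space on which \<open>F\<close> is faithful,
  given by an orthonormal basis \<open>E\<close>.\<close>

definition good_basis :: "'h set \<Rightarrow> bool" where
  "good_basis E \<longleftrightarrow> cinner.orthonormal E \<and> separating E
    \<and> (\<forall>a\<in>F. \<forall>x\<in>complex_vector.span E. a \<odot> x \<in> complex_vector.span E)"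

text \<open>A unitary \<open>u\<close> on the Hilbert space, with adjoint \<open>u'\<close>, that commutes with \<open>F\<close> and leaves the span of
  \<open>E\<close> invariant.\<close>

definition reducing_unitary :: "'h set \<Rightarrow> ('h \<Rightarrow> 'h) \<Rightarrow> ('h \<Rightarrow> 'h) \<Rightarrow> bool" where
  "reducing_unitary E u u' \<longleftrightarrow> (\<forall>x y. cinner (u x) y = cinner x (u' y))
    \<and> (\<forall>x. u (u' x) = x) \<and> (\<forall>x. u' (u x) = x)
    \<and> (\<forall>a\<in>F. \<forall>x. u (a \<odot> x) = a \<odot> u x)
    \<and> (\<forall>x\<in>complex_vector.span E. u x \<in> complex_vector.span E)
    \<and> (\<forall>x\<in>complex_vector.span E. u' x \<in> complex_vector.span E)"

lemma reducing_unitaryD: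
  assumes "reducing_unitary E u u'"
  shows "cinner (u x) y = cinner x (u' y)" "u (u' x) = x" "u' (u x) = x"
    "a \<in> F \<Longrightarrow> u (a \<odot> x) = a \<odot> u x"
    "x \<in> complex_vector.span E \<Longrightarrow> u x \<in> complex_vector.span E"
    "x \<in> complex_vector.span E \<Longrightarrow> u' x \<in> complex_vector.span E"
  using assms by (auto simp: reducing_unitary_def)

lemma reducing_unitary_linear:
  assumes "reducing_unitary E u u'"
  shows "u (x + y) = u x + u y" "u (x - y) = u x - u y" "u (c *\<^sub>C x) = c *\<^sub>C u x" "norm (u x) = norm x"
proof -
  note u = reducing_unitaryD[OF assms]
  show "u (x + y) = u x + u y" "u (x - y) = u x - u y" "u (c *\<^sub>C x) = c *\<^sub>C u x"
    by (rule cinner_eqI, simp add: u(1) cinner_simps)+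
  have "(norm (u x))\<^sup>2 = (norm x)\<^sup>2" by (simp add: u(1,3) flip: Re_cinner_self)
  then show "norm (u x) = norm x" by simp
qed

lemma reducing_unitary_sum:
  assumes "reducing_unitary E u u'"
  shows "u (\<Sum>i\<in>I. f i) = (\<Sum>i\<in>I. u (f i))"
proof -
  have "u 0 = 0" using reducing_unitary_linear(4)[OF assms, of 0] by simp
  then show ?thesis
    by (induction I rule: infinite_finite_induct) (simp_all add: reducing_unitary_linear[OF assms])
qed

lemma reducing_unitary_adjoint:
  assumes "reducing_unitary E u u'" shows "reducing_unitary E u' u"
proof -
  note u = reducing_unitaryD[OF assms]
  have "u' (a \<odot> x) = a \<odot> u' x" if "a \<in> F" for a x
    using u(4)[OF that, of "u' x"] by (metis u(2,3))
  moreover have "cinner (u' x) y = cinner x (u y)" for x y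
    by (metis u(1) cinner_commute)
  ultimately show ?thesis using u by (auto simp: reducing_unitary_def)
qed

lemma reducing_unitary_compose:
  assumes u: "reducing_unitary E u u'" and v: "reducing_unitary E v v'"
  shows "reducing_unitary E (\<lambda>x. v (u x)) (\<lambda>x. u' (v' x))"
  using reducing_unitaryD[OF u] reducing_unitaryD[OF v] unfolding reducing_unitary_def by auto

lemma norm_diff_on_span_le:
  assumes E: "cinner.orthonormal E" and u: "reducing_unitary E u u'"
    and e: "\<And>e. e \<in> E \<Longrightarrow> norm (a \<odot> e - u e) \<le> \<epsilon>" and x: "x \<in> complex_vector.span E"
  shows "norm (a \<odot> x - u x) \<le> \<epsilon> * card E * norm x"
proof -
  have x': "x = (\<Sum>e\<in>E. cinner x e *\<^sub>C e)" by (rule cinner.orthonormal_expansion[OF E x])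
  have "a \<odot> x - u x = (\<Sum>e\<in>E. cinner x e *\<^sub>C (a \<odot> e - u e))"
    by (subst x', subst (2) x') (simp add: act_right reducing_unitary_sum[OF u]
        reducing_unitary_linear[OF u] complex_vector.scale_right_diff_distrib sum_subtractf)
  also have "norm \<dots> \<le> (\<Sum>e\<in>E. norm x * \<epsilon>)"
  proof (intro order.trans[OF norm_sum] sum_mono)
    fix e' assume e': "e' \<in> E"
    then have "(norm e')\<^sup>2 = 1" using E by (simp add: cinner.orthonormal_def flip: Re_cinner_self)
    then have "norm e' = 1" using norm_ge_zero[of e'] by (auto simp: power2_eq_1_iff)
    then have "cmod (cinner x e') \<le> norm x" using Cauchy_Schwarz[of x e'] by simp
    then show "norm (cinner x e' *\<^sub>C (a \<odot> e' - u e')) \<le> norm x * \<epsilon>"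
      unfolding norm_scaleC_chilbert using e[OF e'] by (intro mult_mono) auto
  qed
  finally show ?thesis by (simp add: mult_ac)
qed

text \<open>Kaplansky's density theorem relative to \<open>F\<close>. An approximation of \<open>u\<close> by \<open>x\<close> is averaged to \<open>y = \<Phi> x g\<close>, where
  \<open>\<Phi> x = \<Sum> a x a\<^sup>*\<close> commutes with \<open>F\<close> and \<open>g\<close> is the inverse of \<open>z = \<Phi> 1\<close>; averaging does not change \<open>u\<close>, which
  commutes with \<open>F\<close>.\<close>

lemma F_commutant_approximation:
  assumes E: "good_basis E" and u: "reducing_unitary E u u'" and \<epsilon>: "0 < \<epsilon>"
  obtains W where "norm W \<le> 1" "\<And>c. c \<in> F \<Longrightarrow> c * W = W * c"
    "\<And>x. x \<in> complex_vector.span E \<Longrightarrow> norm (W \<odot> x - u x) \<le> \<epsilon> * norm x"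
    "\<And>x. x \<in> complex_vector.span E \<Longrightarrow> norm (star W \<odot> x - u' x) \<le> \<epsilon> * norm x"
proof -
  have on: "cinner.orthonormal E" and sep: "separating E"
    and inv: "\<And>a x. a \<in> F \<Longrightarrow> x \<in> complex_vector.span E \<Longrightarrow> a \<odot> x \<in> complex_vector.span E"
    using E by (auto simp: good_basis_def)
  have fin: "finite E" using on by (simp add: cinner.orthonormal_def)
  note uD = reducing_unitaryD[OF u]
  have u': "reducing_unitary E u' u" by (rule reducing_unitary_adjoint[OF u])
  obtain A where A: "finite A" "A \<subseteq> F" "\<And>c. c \<in> F \<Longrightarrow> c = (\<Sum>a\<in>A. hs_form E c a *\<^sub>C a)"
    using hs_basis[OF fin sep] by blast
  define \<Phi> where "\<Phi> x = (\<Sum>a\<in>A. a * x * star a)" for x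
  have \<Phi>_comm: "c * \<Phi> x = \<Phi> x * c" if c: "c \<in> F" for c x
  proof -
    have "(\<Sum>a\<in>A. (c * a) * x * star a) = (\<Sum>a\<in>A. a * x * star (star c * a))"
      by (rule Casimir[OF A _ _ _ _ c, where \<beta> = "\<lambda>y z. y * x * star z"])
        (auto simp: algebra_simps star_simps scaleC_mult_left scaleC_mult_right)
    then show ?thesis
      by (simp add: \<Phi>_def sum_distrib_left sum_distrib_right star_simps mult.assoc)
  qed
  have star_\<Phi>: "star (\<Phi> x) = \<Phi> (star x)" for x
    by (simp add: \<Phi>_def star_simps mult.assoc)
  define z where "z = \<Phi> 1"
  have zF: "z \<in> F"
    unfolding z_def \<Phi>_def using A(2) F_mult F_star
    by (intro complex_vector.subspace_sum[OF F_subspace]) auto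
  have sz: "star z = z" by (simp add: z_def star_\<Phi>)
  have z_form: "Re (cinner (z \<odot> x) x) = (\<Sum>a\<in>A. (norm (star a \<odot> x))\<^sup>2)" for x
  proof -
    have "Re (cinner (a \<odot> star a \<odot> x) x) = (norm (star a \<odot> x))\<^sup>2" for a
      by (subst cinner_act_star) (rule Re_cinner_self)
    then show ?thesis by (simp add: z_def \<Phi>_def act_left cinner_sum_left)
  qed
  \<comment> \<open>\<open>z\<close> is bounded below because \<open>1\<close> is a linear combination of the \<open>a\<^sup>*\<close>.\<close>
  define U where "U = (\<Sum>a\<in>A. (cmod (hs_form E 1 a))\<^sup>2)"
  have U: "0 \<le> U" by (simp add: U_def sum_nonneg)
  have z_below: "1 / (U + 1) * (norm x)\<^sup>2 \<le> Re (cinner (z \<odot> x) x)" for x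
  proof -
    have one: "1 = (\<Sum>a\<in>A. cnj (hs_form E 1 a) *\<^sub>C star a)"
      using arg_cong[OF A(3)[OF F_one], of star] by (simp add: star_sum star_scaleC)
    have "(\<Sum>a\<in>A. cnj (hs_form E 1 a) *\<^sub>C star a) \<odot> x = x"
      by (simp only: one[symmetric] act_one)
    then have "x = (\<Sum>a\<in>A. cnj (hs_form E 1 a) *\<^sub>C (star a \<odot> x))"
      by (simp only: act_sum_left act_scaleC_left)
    then have "norm x \<le> (\<Sum>a\<in>A. cmod (hs_form E 1 a) * norm (star a \<odot> x))"
      using norm_sum[of "\<lambda>a. cnj (hs_form E 1 a) *\<^sub>C (star a \<odot> x)" A] by (simp add: norm_scaleC_chilbert)
    then have "(norm x)\<^sup>2 \<le> (\<Sum>a\<in>A. cmod (hs_form E 1 a) * norm (star a \<odot> x))\<^sup>2"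
      by (intro power_mono) auto
    also have "\<dots> \<le> U * Re (cinner (z \<odot> x) x)"
      unfolding U_def z_form by (rule Cauchy_Schwarz_ineq_sum)
    also have "\<dots> \<le> (U + 1) * Re (cinner (z \<odot> x) x)"
      by (intro mult_right_mono) (auto simp: z_form sum_nonneg)
    finally show ?thesis using U by (simp add: field_simps)
  qed
  obtain g where g: "g * z = 1" "z * g = 1" "g \<in> F" "star g = g"
    using inverse_of_bounded_below[OF sz _ z_below subalgebra zF] U by (auto simp: add_nonneg_pos)
  define C where "C = (\<Sum>a\<in>A. norm a * (card E * (norm a * norm g)))"
  have C: "0 \<le> C" by (simp add: C_def sum_nonneg)
  define d where "d = \<epsilon> / (2 * (C + 1))"
  have d: "0 < d" using \<epsilon> C by (simp add: d_def)
  have base: "e \<in> complex_vector.span E" if "e \<in> E" for e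
    using that by (rule complex_vector.span_base)
  obtain x where x: "\<And>e. e \<in> E \<Longrightarrow> norm (x \<odot> e - u e) < d"
    "\<And>e. e \<in> E \<Longrightarrow> norm (star x \<odot> e - u' e) < d"
    using star_approximation[OF on d, of u u'] uD(1,6) base by auto
  have est: "norm ((\<Phi> w * g) \<odot> y - v y) \<le> d * C * norm y"
    if w: "\<And>e. e \<in> E \<Longrightarrow> norm (w \<odot> e - v e) < d" and v: "reducing_unitary E v v'"
      and y: "y \<in> complex_vector.span E" for w v v' y
  proof -
    have "v y = v (z \<odot> g \<odot> y)" by (simp flip: act_mult add: g)
    also have "\<dots> = (\<Sum>a\<in>A. a \<odot> v (star a \<odot> g \<odot> y))"
      unfolding z_def \<Phi>_def using A(2) reducing_unitaryD(4)[OF v]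
      by (auto simp: act_left reducing_unitary_sum[OF v] intro!: sum.cong)
    finally have "(\<Phi> w * g) \<odot> y - v y
        = (\<Sum>a\<in>A. a \<odot> (w \<odot> (star a \<odot> g \<odot> y) - v (star a \<odot> g \<odot> y)))"
      by (simp add: \<Phi>_def act_left act_right sum_subtractf)
    also have "norm \<dots> \<le> (\<Sum>a\<in>A. norm a * (d * card E * (norm a * norm g * norm y)))"
    proof (intro order.trans[OF norm_sum] sum_mono)
      fix a assume a: "a \<in> A"
      define q where "q = star a \<odot> g \<odot> y"
      have q: "q \<in> complex_vector.span E"
        unfolding q_def using a A(2) F_star g(3) y by (intro inv) auto
      have "norm q \<le> norm (star a) * norm (g \<odot> y)" unfolding q_def by (rule norm_act_le)
      also have "\<dots> \<le> norm a * (norm g * norm y)"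
        unfolding norm_star by (intro mult_left_mono norm_act_le) simp
      finally have "norm q \<le> norm a * norm g * norm y" by (simp add: mult_ac)
      then have "d * card E * norm q \<le> d * card E * (norm a * norm g * norm y)"
        using d by (intro mult_left_mono) auto
      moreover have "norm (w \<odot> q - v q) \<le> d * card E * norm q"
        using w by (intro norm_diff_on_span_le[OF on v _ q]) (auto intro: less_imp_le)
      ultimately have "norm (w \<odot> q - v q) \<le> d * card E * (norm a * norm g * norm y)" by linarith
      then have "norm a * norm (w \<odot> q - v q) \<le> norm a * (d * card E * (norm a * norm g * norm y))"
        by (rule mult_left_mono) simp
      then show "norm (a \<odot> (w \<odot> (star a \<odot> g \<odot> y) - v (star a \<odot> g \<odot> y)))
          \<le> norm a * (d * card E * (norm a * norm g * norm y))"
        using norm_act_le order.trans unfolding q_def by blast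
    qed
    also have "\<dots> = d * C * norm y" by (simp add: C_def sum_distrib_left sum_distrib_right mult_ac)
    finally show ?thesis .
  qed
  define y where "y = \<Phi> x * g"
  have sy: "star y = \<Phi> (star x) * g"
    using \<Phi>_comm[OF g(3), of "star x"] by (simp add: y_def star_simps star_\<Phi> g(4))
  have comm: "c * (\<Phi> w * g) = (\<Phi> w * g) * c" if c: "c \<in> F" for c w
  proof -
    have "z * c = c * z" unfolding z_def by (rule \<Phi>_comm[OF c, symmetric])
    then have "g * (z * c) * g = g * (c * z) * g" by simp
    then have "(g * z) * c * g = g * c * (z * g)" by (simp only: mult.assoc)
    then have "c * g = g * c" using g by simp
    then show ?thesis using \<Phi>_comm[OF c, of w] by (metis mult.assoc)
  qed
  obtain W where W: "norm W \<le> 1" "\<And>c. c * y = y * c \<Longrightarrow> c * star y = star y * c \<Longrightarrow> c * W = W * c"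
    "\<And>\<xi> \<eta>. norm (W \<odot> \<xi> - \<eta>) \<le> norm (y \<odot> \<xi> - \<eta>) + norm (star y \<odot> \<eta> - \<xi>)"
    "\<And>\<xi> \<eta>. norm (star W \<odot> \<eta> - \<xi>) \<le> norm (y \<odot> \<xi> - \<eta>) + norm (star y \<odot> \<eta> - \<xi>)"
    using contraction_from_operator[of y] by blast
  have small: "d * C * r + d * C * r \<le> \<epsilon> * r" if "0 \<le> r" for r
  proof -
    have "2 * (d * C) \<le> \<epsilon>" using \<epsilon> C by (simp add: d_def field_simps)
    then show ?thesis using mult_right_mono[OF _ that, of "2 * (d * C)" \<epsilon>] by (simp add: algebra_simps)
  qed
  have y_est: "norm (y \<odot> q - u q) \<le> d * C * norm q" "norm (star y \<odot> q - u' q) \<le> d * C * norm q"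
    if "q \<in> complex_vector.span E" for q
    using est[OF x(1) u that] est[OF x(2) u' that] by (simp_all add: sy) (simp add: y_def)
  show ?thesis
  proof (rule that[OF W(1)])
    show "c * W = W * c" if "c \<in> F" for c
    proof (rule W(2))
      show "c * y = y * c" unfolding y_def by (rule comm[OF that])
      show "c * star y = star y * c" unfolding sy by (rule comm[OF that])
    qed
    fix q assume q: "q \<in> complex_vector.span E"
    show "norm (W \<odot> q - u q) \<le> \<epsilon> * norm q"
      using W(3)[of q "u q"] y_est(1)[OF q] y_est(2)[OF uD(5)[OF q]] small[OF norm_ge_zero[of q]]
      unfolding uD(3) reducing_unitary_linear(4)[OF u] by linarith
    show "norm (star W \<odot> q - u' q) \<le> \<epsilon> * norm q"
      using W(4)[of q "u' q"] y_est(2)[OF q] y_est(1)[OF uD(6)[OF q]] small[OF norm_ge_zero[of q]]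
      unfolding uD(2) reducing_unitary_linear(4)[OF u'] by linarith
  qed
qed

text \<open>The hypothesis on contractions in the algebra passes to the commutator \<open>T u - u T\<close> compressed to the span
  of \<open>E\<close>.\<close>

lemma unitary_commutator_bound:
  assumes E: "good_basis E" and u: "reducing_unitary E u u'"
    and \<kappa>: "\<And>W. norm W \<le> 1 \<Longrightarrow> (\<And>c. c \<in> F \<Longrightarrow> c * W = W * c) \<Longrightarrow> norm (W * T - T * W) \<le> \<kappa>"
    and \<xi>: "\<xi> \<in> complex_vector.span E" and \<eta>: "\<eta> \<in> complex_vector.span E"
  shows "cmod (cinner (T \<odot> u \<xi>) \<eta> - cinner (T \<odot> \<xi>) (u' \<eta>)) \<le> \<kappa> * norm \<xi> * norm \<eta>"
proof (rule field_le_epsilon)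
  fix e :: real assume e: "0 < e"
  define R where "R = norm T * norm \<xi> * norm \<eta>"
  have R: "0 \<le> R" by (simp add: R_def)
  define \<epsilon> where "\<epsilon> = e / (2 * (R + 1))"
  have \<epsilon>: "0 < \<epsilon>" using e R by (simp add: \<epsilon>_def)
  obtain W where W: "norm W \<le> 1" "\<And>c. c \<in> F \<Longrightarrow> c * W = W * c"
    "\<And>x. x \<in> complex_vector.span E \<Longrightarrow> norm (W \<odot> x - u x) \<le> \<epsilon> * norm x"
    "\<And>x. x \<in> complex_vector.span E \<Longrightarrow> norm (star W \<odot> x - u' x) \<le> \<epsilon> * norm x"
    using F_commutant_approximation[OF E u \<epsilon>] by blast
  have "0 \<le> \<kappa>" using \<kappa>[of 0] by simp
  have "cinner (T \<odot> u \<xi>) \<eta> - cinner (T \<odot> \<xi>) (u' \<eta>)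
      = cinner (T \<odot> (u \<xi> - W \<odot> \<xi>)) \<eta> - cinner ((W * T - T * W) \<odot> \<xi>) \<eta>
        + cinner (T \<odot> \<xi>) (star W \<odot> \<eta> - u' \<eta>)"
    by (simp add: act_left act_right cinner_simps cinner_act_star[of W])
  also have "cmod \<dots> \<le> cmod (cinner (T \<odot> (u \<xi> - W \<odot> \<xi>)) \<eta>) + cmod (cinner ((W * T - T * W) \<odot> \<xi>) \<eta>)
        + cmod (cinner (T \<odot> \<xi>) (star W \<odot> \<eta> - u' \<eta>))"
    by (meson add_mono norm_triangle_ineq norm_triangle_ineq4 order.refl order.trans)
  also have "\<dots> \<le> norm T * (\<epsilon> * norm \<xi>) * norm \<eta> + \<kappa> * norm \<xi> * norm \<eta>
      + norm T * norm \<xi> * (\<epsilon> * norm \<eta>)"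
  proof (intro add_mono order.trans[OF Cauchy_Schwarz] mult_mono mult_right_mono order.trans[OF norm_act_le])
    show "norm (u \<xi> - W \<odot> \<xi>) \<le> \<epsilon> * norm \<xi>" using W(3)[OF \<xi>] by (simp add: norm_minus_commute)
    show "norm (W * T - T * W) \<le> \<kappa>" by (rule \<kappa>[OF W(1,2)])
    show "norm (star W \<odot> \<eta> - u' \<eta>) \<le> \<epsilon> * norm \<eta>" by (rule W(4)[OF \<eta>])
  qed (use \<epsilon> \<open>0 \<le> \<kappa>\<close> in auto)
  also have "\<dots> = \<kappa> * norm \<xi> * norm \<eta> + 2 * (\<epsilon> * R)" by (simp add: R_def algebra_simps)
  also have "2 * (\<epsilon> * R) \<le> e" using e R by (simp add: \<epsilon>_def field_simps)
  finally show "cmod (cinner (T \<odot> u \<xi>) \<eta> - cinner (T \<odot> \<xi>) (u' \<eta>)) \<le> \<kappa> * norm \<xi> * norm \<eta> + e"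
    by simp
qed

end

section \<open>Averaging over unitaries\<close>

text \<open>The convex hull of a set of functions.\<close>

inductive_set function_hull :: "('a \<Rightarrow> 'v::real_vector) set \<Rightarrow> ('a \<Rightarrow> 'v) set" for S where
  base: "f \<in> S \<Longrightarrow> f \<in> function_hull S"
| mix: "f \<in> function_hull S \<Longrightarrow> g \<in> function_hull S \<Longrightarrow> 0 \<le> t \<Longrightarrow> t \<le> 1
    \<Longrightarrow> (\<lambda>x. t *\<^sub>R f x + (1 - t) *\<^sub>R g x) \<in> function_hull S"

lemma continuous_on_scaleC_left:
  fixes a :: "'h::chilbert_space"
  assumes "continuous_on S f" shows "continuous_on S (\<lambda>x. f x *\<^sub>C a)"
proof -
  have "bounded_linear (\<lambda>z. z *\<^sub>C a)"
    by (rule bounded_linear_intro[where K = "norm a"])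
      (simp_all add: scaleC_add_left scaleR_scaleC scaleC_scaleC norm_scaleC_chilbert scaleR_conv_of_real)
  then show ?thesis using assms by (rule bounded_linear.continuous_on)
qed

context finite_dimensional_subalgebra
begin

text \<open>The orthogonal projection onto the span of \<open>E\<close>.\<close>

definition proj :: "'h set \<Rightarrow> 'h \<Rightarrow> 'h" where
  "proj E x = (\<Sum>e\<in>E. cinner x e *\<^sub>C e)"

lemma proj_in_span: "proj E x \<in> complex_vector.span E"
  unfolding proj_def
  by (intro complex_vector.span_sum complex_vector.span_scale complex_vector.span_base)

lemma cinner_proj: "cinner (proj E x) y = cinner x (proj E y)"
  unfolding proj_def cinner_sum_left cinner_sum_right cinner_scaleC_left cinner_scaleC_right
  by (intro sum.cong refl) (metis cinner_commute mult.commute)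

lemma proj_of_span: "cinner.orthonormal E \<Longrightarrow> x \<in> complex_vector.span E \<Longrightarrow> proj E x = x"
  unfolding proj_def by (rule cinner.orthonormal_expansion[symmetric])

lemma proj_linear: "proj E (x + y) = proj E x + proj E y" "proj E (c *\<^sub>C x) = c *\<^sub>C proj E x"
  "proj E (r *\<^sub>R x) = r *\<^sub>R proj E x"
  by (rule cinner_eqI, simp add: cinner_proj cinner_simps)+

lemma proj_commute:
  assumes E: "cinner.orthonormal E" and adj: "\<And>x y. cinner (u x) y = cinner x (u' y)"
    and inv: "\<And>x. x \<in> complex_vector.span E \<Longrightarrow> u x \<in> complex_vector.span E"
      "\<And>x. x \<in> complex_vector.span E \<Longrightarrow> u' x \<in> complex_vector.span E"
  shows "proj E (u x) = u (proj E x)"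
proof (rule cinner_eqI)
  fix y
  have "cinner (proj E (u x)) y = cinner x (u' (proj E y))" by (simp add: cinner_proj adj)
  also have "\<dots> = cinner x (proj E (u' (proj E y)))" by (simp add: proj_of_span[OF E] inv proj_in_span)
  also have "\<dots> = cinner (proj E (u (proj E x))) y" by (simp add: adj cinner_proj)
  also have "\<dots> = cinner (u (proj E x)) y" by (simp add: proj_of_span[OF E] inv proj_in_span)
  finally show "cinner (proj E (u x)) y = cinner (u (proj E x)) y" .
qed

text \<open>An operator commuting with the reducing unitaries commutes with every self-adjoint operator \<open>h\<close> that
  commutes with \<open>F\<close> and has its range in the span of \<open>E\<close>: a self-adjoint contraction \<open>h\<close> is the mean of the unitaries
  \<open>h \<plusminus> i (1 - h\<^sup>2)\<^sup>1\<^sup>/\<^sup>2\<close>.\<close>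

lemma commute_selfadjoint_of_unitary:
  assumes E: "cinner.orthonormal E"
    and sa: "\<And>x y. cinner (h x) y = cinner x (h y)"
    and hF: "\<And>a x. a \<in> F \<Longrightarrow> h (a \<odot> x) = a \<odot> h x"
    and hE: "\<And>x. h x \<in> complex_vector.span E"
    and bdd: "\<And>x. norm (h x) \<le> K * norm x"
    and m: "\<And>x y. m (x + y) = m x + m y" "\<And>c x. m (c *\<^sub>C x) = c *\<^sub>C m x"
    and comm: "\<And>u u' x. reducing_unitary E u u' \<Longrightarrow> m (u x) = u (m x)"
  shows "m (h x) = h (m x)"
proof -
  define r where "r = inverse (\<bar>K\<bar> + 1)"
  have r: "0 < r" by (simp add: r_def add_nonneg_pos)
  have h_lin: "h (x + y) = h x + h y" "h (c *\<^sub>C x) = c *\<^sub>C h x" for x y c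
    by (rule cinner_eqI, simp add: sa cinner_simps)+
  have "bounded_linear (\<lambda>x. r *\<^sub>R h x)"
  proof (rule bounded_linear_intro)
    show "norm (r *\<^sub>R h x) \<le> norm x * (r * K)" for x
      using bdd[of x] r by (simp add: mult_ac)
  qed (simp_all add: h_lin scaleR_scaleC scaleC_scaleC scaleC_add_right mult.commute)
  then obtain B :: "'h \<Rightarrow>\<^sub>L 'h" where B: "\<And>x. B x = r *\<^sub>R h x"
    using bounded_linear_Blinfun_apply by metis
  have B_sa: "cinner (B x) y = cinner x (B y)" for x y
    by (simp add: B cinner_simps sa)
  have B_le: "norm (B x) \<le> norm x" for x
  proof -
    have "norm (h x) \<le> (\<bar>K\<bar> + 1) * norm x"
      by (rule order.trans[OF bdd]) (intro mult_right_mono, auto)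
    moreover have "norm (B x) = r * norm (h x)" using r by (simp add: B)
    ultimately have "norm (B x) \<le> r * ((\<bar>K\<bar> + 1) * norm x)"
      using r by (simp add: mult_left_mono)
    also have "\<dots> = norm x" by (simp add: r_def field_simps)
    finally show ?thesis .
  qed
  have BF: "B (a \<odot> x) = a \<odot> B x" if "a \<in> F" for a x
    using hF[OF that] by (simp add: B act_right)
  have BE: "proj E (B x) = B x" for x
    by (simp add: B proj_linear proj_of_span[OF E hE])
  define X where "X = B o\<^sub>L B"
  have X1: "norm X \<le> 1"
  proof (rule norm_blinfun_bound)
    show "norm (X x) \<le> 1 * norm x" for x
      using B_le[of "B x"] B_le[of x] by (simp add: X_def)
  qed simp
  define Z where "Z = {U :: 'h \<Rightarrow>\<^sub>L 'h. (\<forall>x y. cinner (U x) y = cinner x (U y))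
    \<and> (\<forall>a\<in>F. \<forall>x. U (a \<odot> x) = a \<odot> U x) \<and> (\<forall>x. U (B x) = B (U x)) \<and> (\<forall>x. proj E (U x) = U x)}"
  have "closed Z"
    unfolding Z_def proj_def Ball_def imp_conv_disj
    by (intro closed_Collect_conj closed_Collect_all closed_Collect_disj closed_Collect_eq
        closed_Collect_const continuous_intros
        bounded_bilinear.continuous_on[OF bounded_bilinear_cinner]
        continuous_on_sum continuous_on_scaleC_left)
  moreover have "0 \<in> Z" by (simp add: Z_def proj_def scaleC_simps)
  moreover have "(1/2) *\<^sub>R (X + (U o\<^sub>L U)) \<in> Z" if "U \<in> Z" for U
  proof -
    have U: "cinner (U x) y = cinner x (U y)" "a \<in> F \<Longrightarrow> U (a \<odot> x) = a \<odot> U x" "U (B x) = B (U x)"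
      "proj E (U x) = U x" for x y a
      using that by (simp_all add: Z_def)
    show ?thesis
      by (auto simp: Z_def X_def blinfun.add_left blinfun.scaleR_left cinner_simps U B_sa BF
          act_right blinfun.add_right blinfun.scaleR_right proj_linear BE)
  qed
  ultimately obtain Y where Y: "norm Y \<le> 1" "Y \<in> Z" "X + (Y o\<^sub>L Y) = 2 *\<^sub>R Y"
    using square_root_exists[OF bounded_bilinear_blinfun_compose norm_blinfun_compose X1, of Z] by blast
  have Y_sa: "cinner (Y x) y = cinner x (Y y)" and YF: "a \<in> F \<Longrightarrow> Y (a \<odot> x) = a \<odot> Y x"
    and YB: "Y (B x) = B (Y x)" and YE: "proj E (Y x) = Y x" for x y a
    using Y(2) by (simp_all add: Z_def)
  have YY: "B (B x) + Y (Y x) = 2 *\<^sub>R Y x" for x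
    using arg_cong[OF Y(3), of "\<lambda>U. blinfun_apply U x"]
    by (simp add: blinfun.add_left blinfun.scaleR_left X_def)
  define w where "w x = x - Y x" for x
  have w_sa: "cinner (w x) y = cinner x (w y)" for x y by (simp add: w_def cinner_simps Y_sa)
  have wF: "w (a \<odot> x) = a \<odot> w x" if "a \<in> F" for a x by (simp add: w_def YF[OF that] act_right)
  have wB: "w (B x) = B (w x)" for x by (simp add: w_def YB blinfun.diff_right)
  have ww: "w (w x) = x - B (B x)" for x
    using YY[of x] by (simp add: w_def blinfun.diff_right scaleR_2 algebra_simps)
  have wE: "w x \<in> complex_vector.span E" if "x \<in> complex_vector.span E" for x
    unfolding w_def using that YE[of x] proj_in_span[of E "Y x"] by (intro complex_vector.span_diff) auto
  have BEs: "B x \<in> complex_vector.span E" for x using BE[of x] proj_in_span[of E "B x"] by simp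
  have lin: "B (c *\<^sub>C x) = c *\<^sub>C B x" "w (c *\<^sub>C x) = c *\<^sub>C w x" "w (x + y) = w x + w y"
    "w (x - y) = w x - w y" for c x y
    by (rule cinner_eqI, simp add: B_sa w_sa cinner_simps)+
  define u u' where "u x = B x + \<i> *\<^sub>C w x" and "u' x = B x - \<i> *\<^sub>C w x" for x
  have inv: "u (u' x) = x" "u' (u x) = x" for x
    by (simp_all add: u_def u'_def lin blinfun.add_right blinfun.diff_right ww wB
        scaleC_add_right complex_vector.scale_right_diff_distrib scaleC_scaleC scaleC_minus_one)
  have span: "u x \<in> complex_vector.span E" "u' x \<in> complex_vector.span E"
    if "x \<in> complex_vector.span E" for x
    unfolding u_def u'_def using wE[OF that] BEs
    by (auto intro: complex_vector.span_add complex_vector.span_diff complex_vector.span_scale)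
  have uF: "u (a \<odot> x) = a \<odot> u x" if "a \<in> F" for a x
    by (simp add: u_def BF[OF that] wF[OF that] act_right)
  have adj: "cinner (u x) y = cinner x (u' y)" for x y
    by (simp add: u_def u'_def cinner_simps B_sa w_sa)
  have U: "reducing_unitary E u u'"
    unfolding reducing_unitary_def using inv span uF adj by blast
  have Bu: "2 *\<^sub>R B x = u x + u' x" for x by (simp add: u_def u'_def scaleR_2)
  have m_scaleR: "m (t *\<^sub>R x) = t *\<^sub>R m x" for t x by (simp add: scaleR_scaleC m(2))
  have "m (2 *\<^sub>R B x) = 2 *\<^sub>R B (m x)"
    unfolding Bu m(1) comm[OF U] comm[OF reducing_unitary_adjoint[OF U]] ..
  then have "r *\<^sub>R m (h x) = r *\<^sub>R h (m x)" by (simp add: m_scaleR B)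
  then show ?thesis using r by simp
qed

text \<open>The unitaries generate the commutant of \<open>F\<close> on the span of \<open>E\<close>. It contains the operators
  \<open>\<theta> j k x = \<Sum> \<langle>x, a k\<rangle> a j\<close>, where \<open>a\<close> runs through an orthonormal basis of \<open>F\<close> and \<open>j, k\<close> are in \<open>E\<close>: they are the
  matrix entries of the projection onto \<open>F\<close> in the space of operators. As \<open>\<Sum>\<^sub>k \<theta> j k k = j\<close>, an operator \<open>m\<close> that
  commutes with them maps \<open>j\<close> to \<open>\<Sum>\<^sub>k \<theta> j k (m k) = c j\<close> with \<open>c\<close> in \<open>F\<close>.\<close>

lemma double_commutant:
  assumes E: "good_basis E"
    and m: "\<And>x y. m (x + y) = m x + m y" "\<And>c x. m (c *\<^sub>C x) = c *\<^sub>C m x"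
    and comm: "\<And>u u' x. reducing_unitary E u u' \<Longrightarrow> m (u x) = u (m x)"
  obtains c where "c \<in> F" "\<And>x. x \<in> complex_vector.span E \<Longrightarrow> m x = c \<odot> x"
proof -
  have on: "cinner.orthonormal E" and sep: "separating E"
    and inv: "\<And>a x. a \<in> F \<Longrightarrow> x \<in> complex_vector.span E \<Longrightarrow> a \<odot> x \<in> complex_vector.span E"
    using E by (auto simp: good_basis_def)
  have fin: "finite E" using on by (simp add: cinner.orthonormal_def)
  obtain A where A: "finite A" "A \<subseteq> F" "\<And>c. c \<in> F \<Longrightarrow> c = (\<Sum>a\<in>A. hs_form E c a *\<^sub>C a)"
    using hs_basis[OF fin sep] by blast
  have base: "e \<in> complex_vector.span E" if "e \<in> E" for e
    using that by (rule complex_vector.span_base)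
  have m0: "m 0 = 0" using m(2)[of 0 0] by (simp add: scaleC_simps)
  have m_sum: "m (\<Sum>i\<in>I. f i) = (\<Sum>i\<in>I. m (f i))" for f :: "'i \<Rightarrow> 'h" and I
    by (induction I rule: infinite_finite_induct) (simp_all add: m0 m)
  have m_diff: "m (x - y) = m x - m y" for x y
    using m(1)[of "x - y" y] by (simp add: algebra_simps)
  define \<theta> where "\<theta> j k x = (\<Sum>a\<in>A. cinner x (a \<odot> k) *\<^sub>C (a \<odot> j))" for j k x
  have \<theta>_adj: "cinner (\<theta> j k x) y = cinner x (\<theta> k j y)" for j k x y
    unfolding \<theta>_def cinner_sum_left cinner_sum_right cinner_scaleC_left cinner_scaleC_right
    by (intro sum.cong refl) (metis cinner_commute mult.commute)
  have \<theta>F: "\<theta> j k (c \<odot> x) = c \<odot> \<theta> j k x" if c: "c \<in> F" for j k c x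
  proof -
    have "(\<Sum>a\<in>A. cinner x (a \<odot> k) *\<^sub>C ((c * a) \<odot> j)) = (\<Sum>a\<in>A. cinner x ((star c * a) \<odot> k) *\<^sub>C (a \<odot> j))"
      by (rule Casimir[OF A _ _ _ _ c, where \<beta> = "\<lambda>y z. cinner x (z \<odot> k) *\<^sub>C (y \<odot> j)"])
        (auto simp: act_left cinner_simps scaleC_simps scaleC_scaleC mult_ac)
    then show ?thesis by (simp add: \<theta>_def act_left act_right cinner_act_star)
  qed
  have \<theta>E: "\<theta> j k x \<in> complex_vector.span E" if "j \<in> E" for j k x
    unfolding \<theta>_def using A(2) inv base[OF that]
    by (intro complex_vector.span_sum complex_vector.span_scale) blast
  have \<theta>_le: "norm (\<theta> j k x) \<le> (\<Sum>a\<in>A. norm (a \<odot> k) * norm (a \<odot> j)) * norm x" for j k x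
  proof -
    have "norm (\<theta> j k x) \<le> (\<Sum>a\<in>A. (norm x * norm (a \<odot> k)) * norm (a \<odot> j))"
      unfolding \<theta>_def by (intro order.trans[OF norm_sum] sum_mono)
        (simp add: norm_scaleC_chilbert mult_right_mono Cauchy_Schwarz)
    then show ?thesis by (simp add: sum_distrib_left mult_ac)
  qed
  have m\<theta>: "m (\<theta> j k x) = \<theta> j k (m x)" if j: "j \<in> E" and k: "k \<in> E" for j k x
  proof -
    define s d where "s x = \<theta> j k x + \<theta> k j x" and "d x = \<i> *\<^sub>C (\<theta> j k x - \<theta> k j x)" for x
    let ?L = "(\<Sum>a\<in>A. norm (a \<odot> k) * norm (a \<odot> j)) + (\<Sum>a\<in>A. norm (a \<odot> j) * norm (a \<odot> k))"
    have "m (s x) = s (m x)"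
    proof (rule commute_selfadjoint_of_unitary[OF on _ _ _ _ m comm])
      show "cinner (s x) y = cinner x (s y)" for x y by (simp add: s_def cinner_simps \<theta>_adj)
      show "s (a \<odot> x) = a \<odot> s x" if "a \<in> F" for a x by (simp add: s_def \<theta>F[OF that] act_right)
      show "s x \<in> complex_vector.span E" for x
        unfolding s_def by (intro complex_vector.span_add \<theta>E j k)
      show "norm (s x) \<le> ?L * norm x" for x
        unfolding s_def distrib_right by (intro order.trans[OF norm_triangle_ineq] add_mono \<theta>_le)
    qed
    then have 1: "m (\<theta> j k x) + m (\<theta> k j x) = \<theta> j k (m x) + \<theta> k j (m x)" by (simp add: s_def m)
    have "m (d x) = d (m x)"
    proof (rule commute_selfadjoint_of_unitary[OF on _ _ _ _ m comm])
      show "cinner (d x) y = cinner x (d y)" for x y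
        by (simp add: d_def cinner_simps \<theta>_adj algebra_simps)
      show "d (a \<odot> x) = a \<odot> d x" if "a \<in> F" for a x by (simp add: d_def \<theta>F[OF that] act_right)
      show "d x \<in> complex_vector.span E" for x
        unfolding d_def by (intro complex_vector.span_scale complex_vector.span_diff \<theta>E j k)
      show "norm (d x) \<le> ?L * norm x" for x
        unfolding d_def distrib_right norm_scaleC_chilbert norm_ii mult_1_left
        by (intro order.trans[OF norm_triangle_ineq4] add_mono \<theta>_le)
    qed
    then have "\<i> *\<^sub>C (m (\<theta> j k x) - m (\<theta> k j x)) = \<i> *\<^sub>C (\<theta> j k (m x) - \<theta> k j (m x))"
      by (simp add: d_def m m_diff)
    then have 2: "m (\<theta> j k x) - m (\<theta> k j x) = \<theta> j k (m x) - \<theta> k j (m x)"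
      by (simp add: complex_vector.scale_left_imp_eq)
    have "2 *\<^sub>R m (\<theta> j k x) = 2 *\<^sub>R \<theta> j k (m x)"
      using arg_cong2[OF 1 2, of "(+)"] by (simp add: scaleR_2 algebra_simps)
    then show ?thesis by simp
  qed
  define c where "c = (\<Sum>a\<in>A. (\<Sum>k\<in>E. cinner (m k) (a \<odot> k)) *\<^sub>C a)"
  have cF: "c \<in> F"
    unfolding c_def using A(2)
    by (intro complex_vector.subspace_sum complex_vector.subspace_scale F_subspace) auto
  have sum_\<theta>: "(\<Sum>k\<in>E. \<theta> j k (f k)) = (\<Sum>a\<in>A. (\<Sum>k\<in>E. cinner (f k) (a \<odot> k)) *\<^sub>C (a \<odot> j))" for f j
    unfolding \<theta>_def complex_vector.scale_sum_left by (rule sum.swap)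
  have mj: "m j = c \<odot> j" if j: "j \<in> E" for j
  proof -
    have "j = (\<Sum>a\<in>A. hs_form E 1 a *\<^sub>C a) \<odot> j" using A(3)[OF F_one] by simp
    also have "\<dots> = (\<Sum>k\<in>E. \<theta> j k k)" by (simp add: sum_\<theta> hs_form_def act_left)
    finally have "m j = (\<Sum>k\<in>E. m (\<theta> j k k))" by (metis m_sum)
    also have "\<dots> = (\<Sum>k\<in>E. \<theta> j k (m k))" using j by (intro sum.cong refl m\<theta>)
    also have "\<dots> = c \<odot> j" by (simp add: sum_\<theta> c_def act_left)
    finally show ?thesis .
  qed
  show ?thesis
  proof (rule that[OF cF])
    fix x assume x: "x \<in> complex_vector.span E"
    have x': "x = (\<Sum>e\<in>E. cinner x e *\<^sub>C e)" by (rule cinner.orthonormal_expansion[OF on x])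
    show "m x = c \<odot> x"
      by (subst x', subst (2) x') (simp add: m_sum m act_right mj)
  qed
qed

text \<open>The averaging step. The element of minimal Hilbert--Schmidt norm in the convex hull of the unitary conjugates
  of the compression \<open>\<tau>\<close> of \<open>T\<close> is unique, hence invariant under conjugation.\<close>

lemma compression_close_to_F:
  assumes E: "good_basis E"
    and \<kappa>: "\<And>W. norm W \<le> 1 \<Longrightarrow> (\<And>c. c \<in> F \<Longrightarrow> c * W = W * c) \<Longrightarrow> norm (W * T - T * W) \<le> \<kappa>"
  obtains c where "c \<in> F"
    "\<And>\<xi> \<eta>. \<xi> \<in> complex_vector.span E \<Longrightarrow> \<eta> \<in> complex_vector.span E
      \<Longrightarrow> cmod (cinner ((T - c) \<odot> \<xi>) \<eta>) \<le> \<kappa> * norm \<xi> * norm \<eta>"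
proof -
  have on: "cinner.orthonormal E" using E by (simp add: good_basis_def)
  have fin: "finite E" using on by (simp add: cinner.orthonormal_def)
  let ?K = "complex_vector.span E"
  have base: "e \<in> ?K" if "e \<in> E" for e using that by (rule complex_vector.span_base)
  define \<tau> where "\<tau> x = proj E (T \<odot> proj E x)" for x
  define C where "C = function_hull {(\<lambda>x. u (\<tau> (u' x))) | u u'. reducing_unitary E u u'}"
  have proj_u: "proj E (u x) = u (proj E x)" if "reducing_unitary E u u'" for u u' x
    using reducing_unitaryD[OF that] by (intro proj_commute[OF on, where u' = u']) auto
  have \<tau>_lin: "\<tau> (x + y) = \<tau> x + \<tau> y" "\<tau> (c *\<^sub>C x) = c *\<^sub>C \<tau> x" "\<tau> (proj E x) = \<tau> x" for x y c
    by (simp_all add: \<tau>_def proj_linear act_right proj_of_span[OF on] proj_in_span)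
  have C_lin: "f (x + y) = f x + f y" "f (c *\<^sub>C x) = c *\<^sub>C f x" "f (proj E x) = f x"
    if "f \<in> C" for f x y c
  proof -
    have "(\<forall>x y. f (x + y) = f x + f y) \<and> (\<forall>c x. f (c *\<^sub>C x) = c *\<^sub>C f x) \<and> (\<forall>x. f (proj E x) = f x)"
      using that unfolding C_def
    proof (induction rule: function_hull.induct)
      case (base f)
      then obtain u u' where u: "reducing_unitary E u u'" and f: "f = (\<lambda>x. u (\<tau> (u' x)))" by blast
      note u' = reducing_unitary_adjoint[OF u]
      show ?case
        by (simp add: f reducing_unitary_linear[OF u] reducing_unitary_linear[OF u'] \<tau>_lin
            flip: proj_u[OF u'])
    next
      case (mix f g t)
      then show ?case by (simp add: algebra_simps scaleR_scaleC scaleC_scaleC scaleC_add_right)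
    qed
    then show "f (x + y) = f x + f y" "f (c *\<^sub>C x) = c *\<^sub>C f x" "f (proj E x) = f x" by auto
  qed
  have C_expand: "f x = (\<Sum>e\<in>E. cinner x e *\<^sub>C f e)" if f: "f \<in> C" for f x
  proof -
    have f0: "f 0 = 0" using C_lin(2)[OF f, of 0 0] by (simp add: scaleC_simps)
    have f_sum: "f (\<Sum>i\<in>I. g i) = (\<Sum>i\<in>I. f (g i))" for g :: "'h \<Rightarrow> 'h" and I
      by (induction I rule: infinite_finite_induct) (simp_all add: f0 C_lin[OF f])
    have "f x = f (proj E x)" by (simp add: C_lin[OF f])
    then show ?thesis by (simp add: proj_def f_sum C_lin(2)[OF f])
  qed
  have C_close: "cmod (cinner (f \<xi> - T \<odot> \<xi>) \<eta>) \<le> \<kappa> * norm \<xi> * norm \<eta>"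
    if "f \<in> C" and \<xi>: "\<xi> \<in> ?K" and \<eta>: "\<eta> \<in> ?K" for f \<xi> \<eta>
    using that(1) unfolding C_def
  proof (induction rule: function_hull.induct)
    case (base f)
    then obtain u u' where u: "reducing_unitary E u u'" and f: "f = (\<lambda>x. u (\<tau> (u' x)))" by blast
    note u' = reducing_unitary_adjoint[OF u]
    note uD = reducing_unitaryD[OF u]
    have "cinner (f \<xi>) \<eta> = cinner (T \<odot> u' \<xi>) (u' \<eta>)"
      by (simp add: f uD \<tau>_def cinner_proj proj_of_span[OF on] \<xi> \<eta>)
    then have "cinner (f \<xi> - T \<odot> \<xi>) \<eta> = - (cinner (T \<odot> u (u' \<xi>)) \<eta> - cinner (T \<odot> u' \<xi>) (u' \<eta>))"
      by (simp add: cinner_simps uD)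
    then show ?case
      using unitary_commutator_bound[OF E u \<kappa> uD(6)[OF \<xi>] \<eta>]
      by (simp only: norm_minus_cancel reducing_unitary_linear(4)[OF u'])
  next
    case (mix f g t)
    have "cinner (t *\<^sub>R f \<xi> + (1 - t) *\<^sub>R g \<xi> - T \<odot> \<xi>) \<eta>
        = of_real t * cinner (f \<xi> - T \<odot> \<xi>) \<eta> + of_real (1 - t) * cinner (g \<xi> - T \<odot> \<xi>) \<eta>"
      by (simp add: cinner_simps algebra_simps)
    also have "cmod \<dots> \<le> t * cmod (cinner (f \<xi> - T \<odot> \<xi>) \<eta>) + (1 - t) * cmod (cinner (g \<xi> - T \<odot> \<xi>) \<eta>)"
      using mix.hyps by (intro order.trans[OF norm_triangle_ineq]) (simp add: norm_mult del: of_real_diff)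
    also have "\<dots> \<le> t * (\<kappa> * norm \<xi> * norm \<eta>) + (1 - t) * (\<kappa> * norm \<xi> * norm \<eta>)"
      using mix by (intro add_mono mult_left_mono) auto
    finally show ?case by (simp add: algebra_simps)
  qed
  have C_conj: "(\<lambda>x. v (f (v' x))) \<in> C" if "f \<in> C" and v: "reducing_unitary E v v'" for f v v'
    using that(1) unfolding C_def
  proof (induction rule: function_hull.induct)
    case (base f)
    then obtain u u' where u: "reducing_unitary E u u'" and f: "f = (\<lambda>x. u (\<tau> (u' x)))" by blast
    then show ?case
      using reducing_unitary_compose[OF u v] by (intro function_hull.base) (auto simp: f)
  next
    case (mix f g t)
    have "(\<lambda>x. v (t *\<^sub>R f (v' x) + (1 - t) *\<^sub>R g (v' x)))
        = (\<lambda>x. t *\<^sub>R v (f (v' x)) + (1 - t) *\<^sub>R v (g (v' x)))"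
      by (simp add: reducing_unitary_linear[OF v] scaleR_scaleC)
    then show ?case using function_hull.mix[OF mix.IH mix.hyps(3,4)] by simp
  qed
  have "reducing_unitary E (\<lambda>x. x) (\<lambda>x. x)" by (simp add: reducing_unitary_def)
  then have "\<tau> \<in> C"
    unfolding C_def by (intro function_hull.base CollectI exI[of _ "\<lambda>x. x"]) simp
  then have ne: "C \<noteq> {}" by blast
  have conv: "(\<lambda>i. t *\<^sub>R f i + (1 - t) *\<^sub>R g i) \<in> C" if "f \<in> C" "g \<in> C" "0 \<le> t" "t \<le> 1" for f g t
    using that unfolding C_def by (rule function_hull.mix)
  obtain m0 where m0: "\<And>e. 0 < e \<Longrightarrow> \<exists>f\<in>C. \<forall>i\<in>E. norm (f i - m0 i) < e"
    "\<And>f. f \<in> C \<Longrightarrow> 0 \<le> (\<Sum>i\<in>E. Re (cinner (m0 i) (f i - m0 i)))"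
    using minimal_family[OF fin ne conv] by blast
  have "\<forall>n. \<exists>f\<in>C. \<forall>i\<in>E. norm (f i - m0 i) < 1 / real (Suc n)" by (intro allI m0(1)) simp
  then obtain s where s: "\<And>n. s n \<in> C" "\<And>n i. i \<in> E \<Longrightarrow> norm (s n i - m0 i) < 1 / real (Suc n)"
    by metis
  have lim_e: "(\<lambda>n. s n e) \<longlonglongrightarrow> m0 e" if "e \<in> E" for e
  proof (rule LIM_zero_cancel, rule Lim_null_comparison)
    show "\<forall>\<^sub>F n in sequentially. norm (s n e - m0 e) \<le> 1 / real (Suc n)"
      using s(2)[OF that] by (intro always_eventually allI less_imp_le)
    show "(\<lambda>n. 1 / real (Suc n)) \<longlonglongrightarrow> 0"
      using LIMSEQ_inverse_real_of_nat by (simp add: divide_inverse)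
  qed
  define m where "m x = (\<Sum>e\<in>E. cinner x e *\<^sub>C m0 e)" for x
  have m_e: "m e = m0 e" if "e \<in> E" for e
  proof -
    have "m e = (\<Sum>f\<in>E. if f = e then m0 e else 0)"
      unfolding m_def using on that
      by (intro sum.cong) (auto simp: cinner.orthonormal_def scaleC_one scaleC_simps)
    then show ?thesis using fin that by simp
  qed
  have m_expand: "m x = (\<Sum>e\<in>E. cinner x e *\<^sub>C m e)" for x
    unfolding m_def by (intro sum.cong refl) (simp add: m_e[unfolded m_def])
  have m_lin: "m (x + y) = m x + m y" "m (c *\<^sub>C x) = c *\<^sub>C m x" for x y c
    by (simp_all add: m_def cinner_simps scaleC_add_left sum.distrib complex_vector.scale_sum_right
        scaleC_scaleC)
  have lim: "(\<lambda>n. s n x) \<longlonglongrightarrow> m x" for x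
    unfolding m_def C_expand[OF s(1), of _ x] by (intro tendsto_sum tendsto_scaleC lim_e)
  have m_proj: "m (proj E x) = m x" for x
    using lim[of "proj E x"] lim[of x] LIMSEQ_unique unfolding C_lin(3)[OF s(1)] by blast
  have m_conj: "v (m (v' x)) = m x" if v: "reducing_unitary E v v'" for v v' x
  proof -
    note v' = reducing_unitary_adjoint[OF v]
    note vD = reducing_unitaryD[OF v]
    have tends: "(\<lambda>n. v (s n (v' x))) \<longlonglongrightarrow> v (m (v' x))" for x
    proof -
      have "(\<lambda>n. norm (s n (v' x) - m (v' x))) \<longlonglongrightarrow> 0"
        using lim LIM_zero tendsto_norm_zero by blast
      then have "(\<lambda>n. norm (v (s n (v' x)) - v (m (v' x)))) \<longlonglongrightarrow> 0"
        by (simp only: reducing_unitary_linear(2)[OF v, symmetric] reducing_unitary_linear(4)[OF v])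
      then show ?thesis by (rule LIM_zero_cancel[OF tendsto_norm_zero_cancel])
    qed
    have ge: "0 \<le> (\<Sum>e\<in>E. Re (cinner (m e) (v (m (v' e)) - m e)))"
    proof (rule LIMSEQ_le_const)
      show "(\<lambda>n. \<Sum>e\<in>E. Re (cinner (m e) (v (s n (v' e)) - m e)))
          \<longlonglongrightarrow> (\<Sum>e\<in>E. Re (cinner (m e) (v (m (v' e)) - m e)))"
        by (intro tendsto_sum tendsto_Re tendsto_cinner tendsto_diff tendsto_const tends)
      have "0 \<le> (\<Sum>e\<in>E. Re (cinner (m e) (v (s n (v' e)) - m e)))" for n
        using m0(2)[OF C_conj[OF s(1) v], of n] by (simp add: m_e)
      then show "\<exists>N. \<forall>n\<ge>N. 0 \<le> (\<Sum>e\<in>E. Re (cinner (m e) (v (s n (v' e)) - m e)))" by blast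
    qed
    \<comment> \<open>The Hilbert--Schmidt norm is independent of the orthonormal basis.\<close>
    have hs: "(\<Sum>e\<in>E. (norm (m (v' e)))\<^sup>2) = (\<Sum>e\<in>E. (norm (m e))\<^sup>2)"
    proof -
      have "(\<Sum>e\<in>E. cinner (m (v' e)) (m (v' e)))
          = (\<Sum>e\<in>E. \<Sum>k\<in>E. \<Sum>l\<in>E. cinner (v' e) k * cnj (cinner (v' e) l) * cinner (m k) (m l))"
        by (subst (1 2) m_expand)
          (simp add: cinner_simps sum_distrib_left mult_ac, rule sum.cong[OF refl], rule sum.swap)
      also have "\<dots> = (\<Sum>k\<in>E. \<Sum>l\<in>E. (\<Sum>e\<in>E. cinner (v' e) k * cnj (cinner (v' e) l)) * cinner (m k) (m l))"
        unfolding sum_distrib_right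
        by (subst sum.swap) (rule sum.cong[OF refl], subst sum.swap, rule refl)
      also have "\<dots> = (\<Sum>k\<in>E. \<Sum>l\<in>E. (if l = k then 1 else 0) * cinner (m k) (m l))"
      proof (intro sum.cong refl arg_cong2[where f = "(*)"])
        fix k l assume kl: "k \<in> E" "l \<in> E"
        have "(\<Sum>e\<in>E. cinner (v' e) k * cnj (cinner (v' e) l)) = (\<Sum>e\<in>E. cinner (v l) e * cinner e (v k))"
          by (intro sum.cong refl) (metis cinner_commute mult.commute reducing_unitaryD(1)[OF v'])
        also have "\<dots> = cinner (\<Sum>e\<in>E. cinner (v l) e *\<^sub>C e) (v k)"
          by (simp add: cinner_sum_left cinner_scaleC_left)
        also have "\<dots> = cinner (v l) (v k)"
          using cinner.orthonormal_expansion[OF on vD(5)[OF base[OF kl(2)]]] by simp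
        also have "\<dots> = (if l = k then 1 else 0)"
          using on kl by (simp add: vD cinner.orthonormal_def)
        finally show "(\<Sum>e\<in>E. cinner (v' e) k * cnj (cinner (v' e) l)) = (if l = k then 1 else 0)" .
      qed
      also have "\<dots> = (\<Sum>k\<in>E. cinner (m k) (m k))"
      proof (rule sum.cong[OF refl])
        fix k assume "k \<in> E"
        moreover have "(\<Sum>l\<in>E. (if l = k then 1 else 0) * cinner (m k) (m l))
            = (\<Sum>l\<in>E. if l = k then cinner (m k) (m k) else 0)"
          by (intro sum.cong) auto
        ultimately show "(\<Sum>l\<in>E. (if l = k then 1 else 0) * cinner (m k) (m l)) = cinner (m k) (m k)"
          using fin by simp
      qed
      finally have "Re (\<Sum>e\<in>E. cinner (m (v' e)) (m (v' e))) = Re (\<Sum>k\<in>E. cinner (m k) (m k))" by simp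
      then show ?thesis by (simp add: Re_cinner_self)
    qed
    have "(\<Sum>e\<in>E. (norm (v (m (v' e)) - m e))\<^sup>2)
        = (\<Sum>e\<in>E. (norm (m (v' e)))\<^sup>2 - (norm (m e))\<^sup>2 - 2 * Re (cinner (m e) (v (m (v' e)) - m e)))"
      by (intro sum.cong refl)
        (simp add: norm_diff_square reducing_unitary_linear[OF v] cinner_simps Re_cinner_self
          Re_cinner_commute[of "m _" "v _"])
    also have "\<dots> = - 2 * (\<Sum>e\<in>E. Re (cinner (m e) (v (m (v' e)) - m e)))"
      by (simp add: sum_subtractf hs sum_distrib_left sum_negf)
    also have "\<dots> \<le> 0" using ge by simp
    finally have total: "(\<Sum>e\<in>E. (norm (v (m (v' e)) - m e))\<^sup>2) \<le> 0" .
    have zero: "(norm (v (m (v' e)) - m e))\<^sup>2 \<le> 0" if e: "e \<in> E" for e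
      by (rule order.trans[OF member_le_sum[OF e] total]) (use fin in auto)
    have on_E: "v (m (v' e)) = m e" if "e \<in> E" for e using zero[OF that] by simp
    have "v (m (v' x)) = v (m (v' (proj E x)))"
      by (metis m_proj proj_u[OF v'])
    also have "\<dots> = (\<Sum>e\<in>E. cinner x e *\<^sub>C v (m (v' e)))"
    proof -
      have m0': "m 0 = 0" by (simp add: m_def scaleC_simps)
      have "m (\<Sum>i\<in>I. g i) = (\<Sum>i\<in>I. m (g i))" for g :: "'h \<Rightarrow> 'h" and I
        by (induction I rule: infinite_finite_induct) (simp_all add: m0' m_lin)
      then show ?thesis
        by (simp add: proj_def reducing_unitary_sum[OF v] reducing_unitary_sum[OF v']
            reducing_unitary_linear[OF v] reducing_unitary_linear[OF v'] m_lin)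
    qed
    also have "\<dots> = m x" by (subst m_expand) (simp add: on_E)
    finally show ?thesis .
  qed
  have "m (u x) = u (m x)" if "reducing_unitary E u u'" for u u' x
    using m_conj[OF that, of "u x"] by (simp add: reducing_unitaryD[OF that])
  then obtain c where c: "c \<in> F" "\<And>x. x \<in> ?K \<Longrightarrow> m x = c \<odot> x"
    using double_commutant[OF E m_lin] by blast
  show ?thesis
  proof (rule that[OF c(1)])
    fix \<xi> \<eta> assume \<xi>: "\<xi> \<in> ?K" and \<eta>: "\<eta> \<in> ?K"
    have "cmod (cinner (m \<xi> - T \<odot> \<xi>) \<eta>) \<le> \<kappa> * norm \<xi> * norm \<eta>"
    proof (rule LIMSEQ_le_const2)
      show "(\<lambda>n. cmod (cinner (s n \<xi> - T \<odot> \<xi>) \<eta>)) \<longlonglongrightarrow> cmod (cinner (m \<xi> - T \<odot> \<xi>) \<eta>)"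
        by (intro tendsto_norm tendsto_cinner tendsto_diff tendsto_const lim)
      show "\<exists>N. \<forall>n\<ge>N. cmod (cinner (s n \<xi> - T \<odot> \<xi>) \<eta>) \<le> \<kappa> * norm \<xi> * norm \<eta>"
        using C_close[OF s(1) \<xi> \<eta>] by blast
    qed
    moreover have "(T - c) \<odot> \<xi> = - (m \<xi> - T \<odot> \<xi>)" by (simp add: act_left c(2)[OF \<xi>])
    ultimately show "cmod (cinner ((T - c) \<odot> \<xi>) \<eta>) \<le> \<kappa> * norm \<xi> * norm \<eta>"
      by (simp only: cinner_minus_left norm_minus_cancel)
  qed
qed

end

section \<open>The distance estimate\<close>

lemma compact_combinations:
  fixes A :: "'b::unital_cstar_algebra set"
  assumes "finite A"
  shows "compact {(\<Sum>a\<in>A. k a *\<^sub>C a) | k. \<forall>a\<in>A. cmod (k a) \<le> R a}"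
  using assms
proof (induction A rule: finite_induct)
  case empty
  then show ?case by simp
next
  case (insert a A)
  let ?S = "{(\<Sum>a\<in>A. k a *\<^sub>C a) | k. \<forall>a\<in>A. cmod (k a) \<le> R a}"
  have lin: "bounded_linear (\<lambda>z. z *\<^sub>C a)"
    by (rule bounded_linear_intro[where K = "norm a"])
      (simp_all add: scaleC_add_left scaleR_scaleC scaleC_scaleC norm_scaleC scaleR_conv_of_real)
  have "continuous_on (cball 0 (R a) \<times> ?S) (\<lambda>(z, w). z *\<^sub>C a + w)"
    unfolding case_prod_unfold
    by (intro continuous_on_add bounded_linear.continuous_on[OF lin]
        continuous_on_fst continuous_on_snd continuous_on_id)
  then have "compact ((\<lambda>(z, w). z *\<^sub>C a + w) ` (cball 0 (R a) \<times> ?S))"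
    by (intro compact_continuous_image compact_Times compact_cball insert.IH)
  also have "(\<lambda>(z, w). z *\<^sub>C a + w) ` (cball 0 (R a) \<times> ?S)
      = {(\<Sum>a\<in>insert a A. k a *\<^sub>C a) | k. \<forall>a\<in>insert a A. cmod (k a) \<le> R a}" (is "?L = ?R")
  proof (intro set_eqI iffI)
    fix x assume "x \<in> ?L"
    then obtain z k where zk: "cmod z \<le> R a" "\<forall>a\<in>A. cmod (k a) \<le> R a"
      "x = z *\<^sub>C a + (\<Sum>a\<in>A. k a *\<^sub>C a)" by auto
    have "(\<Sum>b\<in>A. (k(a := z)) b *\<^sub>C b) = (\<Sum>b\<in>A. k b *\<^sub>C b)"
      using insert.hyps by (intro sum.cong) auto
    then have "x = (\<Sum>b\<in>insert a A. (k(a := z)) b *\<^sub>C b)"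
      using insert.hyps by (simp add: zk(3))
    then show "x \<in> ?R" using zk by (intro CollectI exI[of _ "k(a := z)"]) auto
  next
    fix x assume "x \<in> ?R"
    then obtain k where k: "x = (\<Sum>b\<in>insert a A. k b *\<^sub>C b)" "\<forall>b\<in>insert a A. cmod (k b) \<le> R b" by blast
    then have "x = (\<lambda>(z, w). z *\<^sub>C a + w) (k a, \<Sum>b\<in>A. k b *\<^sub>C b)" using insert.hyps by simp
    moreover have "(k a, \<Sum>b\<in>A. k b *\<^sub>C b) \<in> cball 0 (R a) \<times> ?S" using k(2) by auto
    ultimately show "x \<in> ?L" by blast
  qed
  finally show ?case .
qed

context finite_dimensional_subalgebra
begin

text \<open>Every finite-dimensional subspace lies in a finite-dimensional \<open>F\<close>-invariant one on which \<open>F\<close> is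
  faithful.\<close>

lemma good_basis_exists:
  assumes X: "finite X"
  obtains E where "good_basis E" "X \<subseteq> complex_vector.span E"
proof -
  obtain X0 where X0: "finite X0" "\<And>a. a \<in> F \<Longrightarrow> (\<And>x. x \<in> X0 \<Longrightarrow> a \<odot> x = 0) \<Longrightarrow> a = 0"
    by (rule separating_vectors) blast
  obtain B where B: "finite B" "B \<subseteq> F" "complex_vector.span B = F" by (rule finite_spanning_set)
  define Y where "Y = (\<lambda>(b, x). b \<odot> x) ` (B \<times> (X \<union> X0))"
  have "finite Y" using X X0(1) B(1) by (simp add: Y_def)
  then obtain E where E: "cinner.orthonormal E" "complex_vector.span E = complex_vector.span Y"
    by (rule orthonormal_basis_exists)
  have act_span: "a \<odot> x \<in> complex_vector.span Y" if a: "a \<in> F" and x: "x \<in> X \<union> X0" for a x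
  proof -
    obtain k where "a = (\<Sum>b\<in>B. k b *\<^sub>C b)"
      using a complex_vector.span_finite[OF B(1)] B(3) by auto
    moreover have "b \<odot> x \<in> complex_vector.span Y" if "b \<in> B" for b
      using that x by (intro complex_vector.span_base) (auto simp: Y_def)
    ultimately show ?thesis
      by (auto simp: act_left intro!: complex_vector.span_sum complex_vector.span_scale)
  qed
  have contains: "X \<union> X0 \<subseteq> complex_vector.span E"
    using act_span[OF F_one] by (auto simp: E(2))
  have "separating E"
    unfolding separating_def
  proof (intro ballI impI)
    fix a assume a: "a \<in> F" "\<forall>e\<in>E. a \<odot> e = 0"
    show "a = 0"
    proof (rule X0(2)[OF a(1)])
      fix x assume "x \<in> X0"
      then have "x = (\<Sum>e\<in>E. cinner x e *\<^sub>C e)"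
        using contains by (intro cinner.orthonormal_expansion[OF E(1)]) auto
      then have "a \<odot> x = (\<Sum>e\<in>E. cinner x e *\<^sub>C (a \<odot> e))" by (metis (no_types, lifting) act_sum_right act_scaleC sum.cong)
      then show "a \<odot> x = 0" using a(2) by (simp add: scaleC_simps)
    qed
  qed
  moreover have "a \<odot> x \<in> complex_vector.span E" if a: "a \<in> F" and x: "x \<in> complex_vector.span E" for a x
  proof -
    obtain k where k: "x = (\<Sum>y\<in>Y. k y *\<^sub>C y)"
      using x complex_vector.span_finite[OF \<open>finite Y\<close>] by (auto simp: E(2))
    have "a \<odot> y \<in> complex_vector.span Y" if "y \<in> Y" for y
    proof -
      obtain b z where bz: "b \<in> B" "z \<in> X \<union> X0" "y = b \<odot> z" using \<open>y \<in> Y\<close> by (auto simp: Y_def)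
      have "(a * b) \<odot> z \<in> complex_vector.span Y" using a B(2) bz F_mult by (intro act_span) auto
      then show ?thesis by (simp add: bz(3) act_mult)
    qed
    then show ?thesis
      unfolding k E(2) act_sum_right act_scaleC
      by (intro complex_vector.span_sum complex_vector.span_scale)
  qed
  ultimately have "good_basis E" using E(1) by (simp add: good_basis_def)
  then show ?thesis using that contains by blast
qed

text \<open>Approximants of the compressions to larger and larger subspaces stay in a compact subset of \<open>F\<close>, so the
  finite intersection property yields one that serves for all vectors at once.\<close>

lemma close_to_F:
  assumes \<kappa>: "\<And>W. norm W \<le> 1 \<Longrightarrow> (\<And>c. c \<in> F \<Longrightarrow> c * W = W * c) \<Longrightarrow> norm (W * T - T * W) \<le> \<kappa>"
  obtains c where "c \<in> F" "norm (T - c) \<le> \<kappa>"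
proof -
  have \<kappa>0: "0 \<le> \<kappa>" using \<kappa>[of 0] by simp
  obtain E0 where E0: "good_basis E0" using good_basis_exists[of "{}"] by auto
  have fin0: "finite E0" and sep0: "separating E0"
    using E0 by (auto simp: good_basis_def cinner.orthonormal_def)
  obtain A where A: "finite A" "A \<subseteq> F" "\<And>c. c \<in> F \<Longrightarrow> c = (\<Sum>a\<in>A. hs_form E0 c a *\<^sub>C a)"
    using hs_basis[OF fin0 sep0] by blast
  \<comment> \<open>\<open>R\<close> bounds the coordinates of any \<open>c\<close> that approximates \<open>T\<close> on a subspace containing \<open>E0\<close> and all \<open>a e\<close>.\<close>
  define R where "R a = (\<Sum>e\<in>E0. (norm T + \<kappa>) * norm e * norm (a \<odot> e))" for a
  define S where "S = {(\<Sum>a\<in>A. k a *\<^sub>C a) | k. \<forall>a\<in>A. cmod (k a) \<le> R a}"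
  define D where "D = (\<lambda>(\<xi>, \<eta>). {c. cmod (cinner ((T - c) \<odot> \<xi>) \<eta>) \<le> \<kappa> * norm \<xi> * norm \<eta>})"
  have "S \<inter> (\<Inter>p\<in>UNIV. D p) \<noteq> {}"
  proof (rule compact_imp_fip_image)
    show "compact S" unfolding S_def by (rule compact_combinations[OF A(1)])
    fix p :: "'h \<times> 'h"
    have "closed {c. cmod (cinner ((T - c) \<odot> \<xi>) \<eta>) \<le> r}" for \<xi> \<eta> r
    proof -
      have lin: "bounded_linear (\<lambda>c. c \<odot> \<xi>)"
        by (rule bounded_linear_intro[where K = "norm \<xi>"]) (simp_all add: act_left norm_act_le)
      then show ?thesis
        by (intro closed_Collect_le continuous_on_norm continuous_on_diff continuous_on_const
            continuous_on_id bounded_linear.continuous_on[OF lin]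
            bounded_bilinear.continuous_on[OF bounded_bilinear_cinner])
    qed
    then show "closed (D p)" by (simp add: D_def case_prod_unfold)
  next
    fix I :: "('h \<times> 'h) set" assume I: "finite I"
    define X where "X = fst ` I \<union> snd ` I \<union> E0 \<union> (\<lambda>(a, e). a \<odot> e) ` (A \<times> E0)"
    have "finite X" using I fin0 A(1) by (simp add: X_def)
    then obtain E where E: "good_basis E" "X \<subseteq> complex_vector.span E" by (rule good_basis_exists)
    obtain c where c: "c \<in> F"
      "\<And>\<xi> \<eta>. \<xi> \<in> complex_vector.span E \<Longrightarrow> \<eta> \<in> complex_vector.span E
        \<Longrightarrow> cmod (cinner ((T - c) \<odot> \<xi>) \<eta>) \<le> \<kappa> * norm \<xi> * norm \<eta>"
      using compression_close_to_F[OF E(1) \<kappa>] by blast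
    have "c \<in> D p" if "p \<in> I" for p
      using c(2)[of "fst p" "snd p"] E(2) that by (auto simp: D_def X_def case_prod_unfold)
    moreover have "c \<in> S"
    proof -
      have "cmod (hs_form E0 c a) \<le> R a" if a: "a \<in> A" for a
        unfolding hs_form_def R_def
      proof (intro order.trans[OF norm_sum] sum_mono)
        fix e assume e: "e \<in> E0"
        have X: "e \<in> X" "a \<odot> e \<in> X" using e a by (auto simp: X_def)
        have "cinner (c \<odot> e) (a \<odot> e) = cinner (T \<odot> e) (a \<odot> e) - cinner ((T - c) \<odot> e) (a \<odot> e)"
          by (simp add: act_left cinner_simps)
        also have "cmod \<dots> \<le> cmod (cinner (T \<odot> e) (a \<odot> e)) + cmod (cinner ((T - c) \<odot> e) (a \<odot> e))"
          by (rule norm_triangle_ineq4)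
        also have "\<dots> \<le> (norm T * norm e) * norm (a \<odot> e) + \<kappa> * norm e * norm (a \<odot> e)"
          using X E(2) by (intro add_mono c(2) order.trans[OF Cauchy_Schwarz] mult_right_mono norm_act_le) auto
        finally show "cmod (cinner (c \<odot> e) (a \<odot> e)) \<le> (norm T + \<kappa>) * norm e * norm (a \<odot> e)"
          by (simp add: algebra_simps)
      qed
      then show ?thesis using A(3)[OF c(1)] unfolding S_def by blast
    qed
    ultimately show "S \<inter> (\<Inter>p\<in>I. D p) \<noteq> {}" by blast
  qed
  then obtain c where c: "c \<in> S" "\<And>p. c \<in> D p" by auto
  show ?thesis
  proof (rule that)
    show "c \<in> F"
      using c(1) A(2) by (auto simp: S_def intro!: complex_vector.subspace_sum[OF F_subspace]
          complex_vector.subspace_scale[OF F_subspace])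
    show "norm (T - c) \<le> \<kappa>"
    proof (rule norm_le_of_act_le[OF \<kappa>0])
      fix x
      define y where "y = (T - c) \<odot> x"
      have "cmod (cinner y y) \<le> \<kappa> * norm x * norm y"
        using c(2)[of "(x, y)"] by (simp add: D_def y_def)
      then have "norm y * norm y \<le> (\<kappa> * norm x) * norm y"
        by (simp add: cinner_norm_sq norm_mult power2_eq_square)
      then have "norm y \<le> \<kappa> * norm x"
        using \<kappa>0 by (cases "y = 0") auto
      then show "norm ((T - c) \<odot> x) \<le> \<kappa> * norm x" by (simp add: y_def)
    qed
  qed
qed

end

theorem theorem15:
  fixes A :: "'b::unital_cstar_algebra set"
  assumes "primitive_cstar_algebra TYPE('h::chilbert_space) TYPE('b)"
    and "unital_AF_subalgebra A"
  shows "K_an A \<le> 1"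
proof -
  obtain \<pi> :: "'b \<Rightarrow> 'h \<Rightarrow>\<^sub>L 'h" where \<pi>: "irreducible_representation \<pi>" "inj \<pi>"
    using assms(1) by (auto simp: primitive_cstar_algebra_def)
  obtain \<F> where \<F>: "\<F> \<noteq> {}" "\<And>F. F \<in> \<F> \<Longrightarrow> unital_cstar_subalgebra F \<and> finite_dimensional F"
    "\<And>F G. F \<in> \<F> \<Longrightarrow> G \<in> \<F> \<Longrightarrow> \<exists>H\<in>\<F>. F \<subseteq> H \<and> G \<subseteq> H" "A = closure (\<Union>\<F>)"
    using assms(2) unfolding unital_AF_subalgebra_def by metis
  have "ereal (infdist T A) \<le> 1" if T: "d_an T A \<le> 1" for T
  proof (rule ccontr)
    assume "\<not> ereal (infdist T A) \<le> 1"
    then have "1 < infdist T A" by simp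
    then obtain \<kappa> where \<kappa>: "1 < \<kappa>" "\<kappa> < infdist T A" using dense by blast
    have "\<exists>W. norm W \<le> 1 \<and> (\<forall>c\<in>F. c * W = W * c) \<and> \<kappa> < norm (W * T - T * W)" if F: "F \<in> \<F>" for F
    proof (rule ccontr)
      assume no: "\<not> ?thesis"
      interpret finite_dimensional_subalgebra \<pi> F
        using \<pi> \<F>(2)[OF F] by unfold_locales auto
      have bound: "norm (W * T - T * W) \<le> \<kappa>"
        if W: "norm W \<le> 1" "\<And>c. c \<in> F \<Longrightarrow> c * W = W * c" for W
      proof (rule ccontr)
        assume "\<not> ?thesis"
        then have "\<kappa> < norm (W * T - T * W)" by simp
        with W no show False by blast
      qed
      obtain c where c: "c \<in> F" "norm (T - c) \<le> \<kappa>"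
        using close_to_F[OF bound] by blast
      have "c \<in> \<Union>\<F>" using c(1) F by blast
      then have "c \<in> A" unfolding \<F>(4) by (rule subsetD[OF closure_subset])
      then have "infdist T A \<le> dist T c" by (rule infdist_le)
      then show False using c(2) \<kappa>(2) by (simp add: dist_norm)
    qed
    then have "\<forall>F\<in>\<F>. \<exists>W. norm W \<le> 1 \<and> (\<forall>c\<in>F. c * W = W * c) \<and> \<kappa> < norm (W * T - T * W)" by blast
    then obtain W where W: "\<And>F. F \<in> \<F> \<Longrightarrow> norm (W F) \<le> 1"
      "\<And>F c. F \<in> \<F> \<Longrightarrow> c \<in> F \<Longrightarrow> c * W F = W F * c"
      "\<And>F. F \<in> \<F> \<Longrightarrow> \<kappa> < norm (W F * T - T * W F)" by metis
    define r where "r = {(F, G). F \<in> \<F> \<and> G \<in> \<F> \<and> F \<subseteq> G}"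
    have dir: "directed_set \<F> r"
      unfolding directed_set_def
    proof (intro conjI ballI)
      show "preorder_on \<F> r" by (auto simp: preorder_on_def refl_on_def trans_def r_def)
      show "\<exists>H\<in>\<F>. (F, H) \<in> r \<and> (G, H) \<in> r" if "F \<in> \<F>" "G \<in> \<F>" for F G
        using \<F>(3)[OF that] that by (auto simp: r_def)
    qed (rule \<F>(1))
    have "((\<lambda>F. norm (a * W F - W F * a)) \<longlongrightarrow> 0) (tails \<F> r)" if a: "a \<in> A" for a
    proof (rule tendstoI)
      fix e :: real assume e: "0 < e"
      then obtain b where b: "b \<in> \<Union>\<F>" "dist b a < e / 2"
        using a half_gt_zero[OF e] unfolding \<F>(4) closure_approachable by blast
      then obtain F where F: "F \<in> \<F>" "b \<in> F" by blast
      have "dist (norm (a * W G - W G * a)) 0 < e" if "(F, G) \<in> r" for G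
      proof -
        have G: "G \<in> \<F>" "b \<in> G" using that F by (auto simp: r_def)
        have "a * W G - W G * a = (a - b) * W G - W G * (a - b)"
          using W(2)[OF G] by (simp add: algebra_simps)
        also have "norm \<dots> \<le> norm (a - b) * norm (W G) + norm (W G) * norm (a - b)"
          by (intro order.trans[OF norm_triangle_ineq4] add_mono norm_mult_ineq)
        also have "\<dots> \<le> norm (a - b) * 1 + 1 * norm (a - b)"
          using W(1)[OF G(1)] by (intro add_mono mult_mono) auto
        also have "\<dots> < e" using b(2) by (simp add: dist_norm norm_minus_commute)
        finally show ?thesis by simp
      qed
      then show "\<forall>\<^sub>F G in tails \<F> r. dist (norm (a * W G - W G * a)) 0 < e"
        unfolding eventually_tails[OF dir] using F(1) by blast
    qed
    then have "asymp_commuting_contractions A \<F> r W"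
      unfolding asymp_commuting_contractions_def using dir W(1) by blast
    then have "Limsup (tails \<F> r) (\<lambda>F. ereal (norm (W F * T - T * W F))) \<le> d_an T A"
      by (rule net_le_d_an)
    moreover have "ereal \<kappa> \<le> Limsup (tails \<F> r) (\<lambda>F. ereal (norm (W F * T - T * W F)))"
    proof (rule le_Limsup)
      show "tails \<F> r \<noteq> bot"
      proof
        assume "tails \<F> r = bot"
        then have "eventually (\<lambda>_. False) (tails \<F> r)" by simp
        then obtain F where "F \<in> \<F>" "\<forall>G. (F, G) \<in> r \<longrightarrow> False"
          unfolding eventually_tails[OF dir] by blast
        then show False by (auto simp: r_def)
      qed
      obtain F where F: "F \<in> \<F>" using \<F>(1) by blast
      have "ereal \<kappa> \<le> ereal (norm (W G * T - T * W G))" if "(F, G) \<in> r" for G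
        using that W(3)[of G] by (simp add: r_def)
      then show "\<forall>\<^sub>F G in tails \<F> r. ereal \<kappa> \<le> ereal (norm (W G * T - T * W G))"
        unfolding eventually_tails[OF dir] using F by blast
    qed
    ultimately have "ereal \<kappa> \<le> 1" using T by (meson order.trans)
    then show False using \<kappa>(1) by simp
  qed
  then show ?thesis unfolding K_an_def by (intro SUP_least) simp
qed

end
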